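(* Let $N\ge2$, $s\in(0,1)$, let $\Omega$ be a ball in $\mathbb{R}^N$ and let $\rho_0\in L^\infty(\Omega)$ be such that $|\{\rho_0>0\}|>0$. Then every minimizer $\check{\rho}_1$ of the problem $$\lambda_1(\check{\rho}_1)=\min_{\rho\in\mathcal{G}(\rho_0)}\lambda_1(\rho),\qquad\check{\rho}_1\in\mathcal{G}(\rho_0),$$ is decreasing radially symmetric.
   Context: $H_0^s(\Omega)=\{u\in H^s(\mathbb{R}^N): u=0 \text{ a.e. in } \mathbb{R}^N\setminus\Omega\}$ is a Hilbert space with inner product $\langle u,v\rangle_{H_0^s(\Omega)}=\int_{\mathbb{R}^{2N}}\frac{(u(x)-u(y))(v(x)-v(y))}{|x-y|^{N+2s}}\,dx\,dy$ and associated norm. For $\rho\in L^\infty(\Omega)$, an eigenvalue of the problem $(-\Delta)^su=\lambda\rho u$ in $\Omega$, $u=0$ in $\mathbb{R}^N\setminus\Omega$, is a $\lambda\in\mathbb{R}$ for which there is $u\in H_0^s(\Omega)\setminus\{0\}$ with $\langle u,\varphi\rangle_{H_0^s(\Omega)}=\lambda\int_\Omega\rho u\varphi\,dx$ for all $\varphi\in H_0^s(\Omega)$. If $|\{\rho>0\}|>0$ (where $\{\rho>0\}=\{x\in\Omega:\rho(x)>0\}$ and $|\cdot|$ is Lebesgue measure), $\lambda_1(\rho)>0$ denotes the smallest positive eigenvalue; $1/\lambda_1(\rho)=\max_{f\in H_0^s(\Omega),\,f\neq0}\frac{\int_\Omega\rho f^2\,dx}{\|f\|^2_{H_0^s(\Omega)}}$.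 Two measurable functions $f,g:\Omega\to\mathbb{R}$ are rearrangements of one another ($f\sim g$) if $|\{x\in\Omega:f(x)>t\}|=|\{x\in\Omega:g(x)>t\}|$ for all $t\in\mathbb{R}$; $\mathcal{G}(\rho_0)=\{g:\Omega\to\mathbb{R}\text{ measurable}: g\sim\rho_0\}$. "Decreasing radially symmetric" means equal a.e. in $\Omega$ to a nonincreasing function of the distance $|x-x_0|$ from the center $x_0$ of the ball; elements of $L^\infty(\Omega)$ are identified when equal a.e. *)

theory Defs
  imports "HOL-Analysis.Analysis"
begin

text \<open>
  Functions on \<open>\<Omega>\<close> are represented by total functions whose values outside \<open>\<Omega>\<close> are irrelevant;
  elements of Lebesgue and Sobolev spaces are represented by individual Lebesgue measurable
  functions, identification almost everywhere being made explicit where it matters.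
  The integrals over \<open>\<real>\<^sup>2\<^sup>N\<close> are taken with respect to the (complete) Lebesgue measure on the
  product type. For \<open>'a = real ^ 'n\<close> we have \<open>DIM('a) = CARD('n)\<close>.
\<close>

text \<open>On the null set \<open>x = y\<close> the quotient is \<open>0\<close> by the convention for division by zero.\<close>

definition gagliardo_integrand ::
  "real \<Rightarrow> ('a::euclidean_space \<Rightarrow> real) \<Rightarrow> ('a \<Rightarrow> real) \<Rightarrow> 'a \<times> 'a \<Rightarrow> real" where
  "gagliardo_integrand s u v = (\<lambda>(x, y).
     (u x - u y) * (v x - v y) / norm (x - y) powr (real DIM('a) + 2 * s))"

definition H_s :: "real \<Rightarrow> ('a::euclidean_space \<Rightarrow> real) set" where
  "H_s s = {u. u \<in> borel_measurable lebesgue \<and>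
               integrable lebesgue (\<lambda>x. (u x)\<^sup>2) \<and>
               integrable lebesgue (gagliardo_integrand s u u)}"

definition H0_s :: "real \<Rightarrow> 'a::euclidean_space set \<Rightarrow> ('a \<Rightarrow> real) set" where
  "H0_s s \<Omega> = {u \<in> H_s s. AE x in lebesgue. x \<notin> \<Omega> \<longrightarrow> u x = 0}"

definition H0_s_inner ::
  "real \<Rightarrow> ('a::euclidean_space \<Rightarrow> real) \<Rightarrow> ('a \<Rightarrow> real) \<Rightarrow> real" where
  "H0_s_inner s u v = (LINT z|lebesgue. gagliardo_integrand s u v z)"

definition L_infinity :: "'a::euclidean_space set \<Rightarrow> ('a \<Rightarrow> real) set" where
  "L_infinity \<Omega> = {f \<in> borel_measurable (lebesgue_on \<Omega>).
                     \<exists>C. AE x in lebesgue_on \<Omega>. \<bar>f x\<bar> \<le> C}"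

definition frac_eigenvalue ::
  "real \<Rightarrow> 'a::euclidean_space set \<Rightarrow> ('a \<Rightarrow> real) \<Rightarrow> real \<Rightarrow> bool" where
  "frac_eigenvalue s \<Omega> \<rho> \<mu> \<longleftrightarrow>
     (\<exists>u \<in> H0_s s \<Omega>. \<not> (AE x in lebesgue. u x = 0) \<and>
        (\<forall>\<phi> \<in> H0_s s \<Omega>.
           H0_s_inner s u \<phi> = \<mu> * (LINT x|lebesgue_on \<Omega>. \<rho> x * u x * \<phi> x)))"

text \<open>The smallest positive eigenvalue; meaningful only if \<open>\<rho>\<close> is positive on a subset of \<open>\<Omega>\<close>
  of positive measure.\<close>

definition lambda1 :: "real \<Rightarrow> 'a::euclidean_space set \<Rightarrow> ('a \<Rightarrow> real) \<Rightarrow> real" where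
  "lambda1 s \<Omega> \<rho> = (LEAST \<mu>. 0 < \<mu> \<and> frac_eigenvalue s \<Omega> \<rho> \<mu>)"

definition rearrangement ::
  "'a::euclidean_space set \<Rightarrow> ('a \<Rightarrow> real) \<Rightarrow> ('a \<Rightarrow> real) \<Rightarrow> bool" where
  "rearrangement \<Omega> f g \<longleftrightarrow>
     f \<in> borel_measurable (lebesgue_on \<Omega>) \<and> g \<in> borel_measurable (lebesgue_on \<Omega>) \<and>
     (\<forall>t. emeasure lebesgue {x \<in> \<Omega>. f x > t} = emeasure lebesgue {x \<in> \<Omega>. g x > t})"

definition rearrangement_class ::
  "'a::euclidean_space set \<Rightarrow> ('a \<Rightarrow> real) \<Rightarrow> ('a \<Rightarrow> real) set" where
  "rearrangement_class \<Omega> f = {g. rearrangement \<Omega> g f}"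

definition radially_decreasing ::
  "'a::euclidean_space \<Rightarrow> real \<Rightarrow> ('a \<Rightarrow> real) \<Rightarrow> bool" where
  "radially_decreasing x0 R f \<longleftrightarrow>
     (\<exists>h :: real \<Rightarrow> real. antimono_on {0..<R} h \<and>
        (AE x in lebesgue_on (ball x0 R). f x = h (norm (x - x0))))"

end

theory Submission
  imports Defs
begin

text \<open>
  The proof is by polarization, the two-point rearrangement with respect to a half-space \<open>H\<close> whose interior
  contains the centre of the ball. On each pair of points that are mirror images in the boundary of \<open>H\<close>,
  polarization places the larger of the two values in \<open>H\<close>. Polarizing a weight \<open>\<rho>\<close> inside the
  ball gives a weight \<open>\<rho>\<^sub>H\<close> in the same rearrangement class (\<open>polarize_in_equimeasurable\<close>). Polarizing
  a nonnegative function \<open>u\<close> as well gives a function \<open>u\<^sub>H\<close> with \<open>\<integral> \<rho> u\<^sup>2 \<le> \<integral> \<rho>\<^sub>H u\<^sub>H\<^sup>2\<close>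
  (\<open>weighted_integral_polarize_le\<close>) and \<open>\<parallel>u\<^sub>H\<parallel> \<le> \<parallel>u\<parallel>\<close> (\<open>polarize_borel_H0\<close>). Since \<open>1/\<lambda>\<^sub>1(\<rho>)\<close> is the
  maximum of the quotient \<open>\<integral> \<rho> u\<^sup>2 / \<parallel>u\<parallel>\<^sup>2\<close> (\<open>lambda1_attained\<close>), the passage from \<open>\<rho>\<close> to
  \<open>\<rho>\<^sub>H\<close> cannot increase \<open>\<lambda>\<^sub>1\<close>.

  For a minimizer \<open>\<rho>\<close> with a nonnegative maximizer \<open>u\<close> all these inequalities are equalities. The interaction
  kernel decreases strictly with the distance, so equality of the energies forces \<open>u\<close> minus its
  reflection to have a constant sign in \<open>H\<close>. This sign is the right one, because \<open>u\<close> is positive in the ball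
  (\<open>maximizer_positive\<close>) and the reflection moves a part of the ball outside of it; hence \<open>u\<^sub>H = u\<close>
  (\<open>polarize_fixes_if_energy_preserved\<close>). Thus the same function \<open>u\<close> maximizes the quotient for \<open>\<rho>\<close> and for
  \<open>\<rho>\<^sub>H\<close>, with the same maximum. The difference of the two Euler--Lagrange equations reads
  \<open>(\<rho> - \<rho>\<^sub>H) u = 0\<close>, and therefore \<open>\<rho>\<^sub>H = \<rho>\<close> (\<open>optimal_weight_is_polarized\<close>).

  A weight that is fixed by all these polarizations is radially decreasing
  (\<open>polarized_imp_radially_decreasing\<close>). If a superlevel set were not a ball about the centre, it would miss a
  set of positive measure that lies closer to the centre than some subset of positive measure of it. The
  reflection in the bisecting hyperplane of density points of these two sets would map points of the first
  set to points of the second one and contradict the invariance.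

  The analytic ingredients are the compact embedding of the Sobolev space into \<open>L\<^sup>2\<close>
  (\<open>borel_H0_compact\<close>), which provides the maximizers, and a supply of Lipschitz test functions
  (\<open>Lipschitz_imp_borel_H0\<close>, \<open>test_function_detects_positive_part\<close>).
\<close>

section \<open>Borel representatives\<close>

text \<open>The exceptional set lies in the union of the two cylinders over a null set, and both are null.\<close>

lemma AE_lborel_both_coordinates:
  fixes P :: "'a::euclidean_space \<Rightarrow> bool"
  assumes "AE x in lborel. P x"
  shows "AE z in lborel. P (fst z) \<and> P (snd z)"
proof -
  obtain N where N: "N \<in> null_sets lborel" "{x. \<not> P x} \<subseteq> N"
    using assms by (auto elim!: AE_E simp: null_sets_def)
  have N0 [measurable]: "N \<in> sets lborel" and "emeasure lborel N = 0"
    using N by auto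
  have "emeasure (lborel \<Otimes>\<^sub>M lborel) (N \<times> (UNIV::'a set)) = 0"
       "emeasure (lborel \<Otimes>\<^sub>M lborel) ((UNIV::'a set) \<times> N) = 0"
    by (subst lborel.emeasure_pair_measure_Times; use N0 in \<open>simp add: \<open>emeasure lborel N = 0\<close>\<close>)+
  then have "N \<times> UNIV \<in> null_sets (lborel :: ('a \<times> 'a) measure)"
            "UNIV \<times> N \<in> null_sets (lborel :: ('a \<times> 'a) measure)"
    using N0 unfolding lborel_prod [symmetric] by (auto intro!: null_setsI pair_measureI)
  then have "(N \<times> UNIV) \<union> (UNIV \<times> N) \<in> null_sets (lborel :: ('a \<times> 'a) measure)"
    by (rule null_sets.Un)
  then show ?thesis
    by (rule AE_I') (use N in auto)
qed

text \<open>At the origin the value is \<open>0\<close>, by the convention for division by zero; monotonicity in the norm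
  therefore holds only away from the origin.\<close>

definition riesz_kernel :: "real \<Rightarrow> 'a::euclidean_space \<Rightarrow> real" where
  "riesz_kernel s z = 1 / norm z powr (real DIM('a) + 2 * s)"

lemma gagliardo_integrand_eq:
  "gagliardo_integrand s u v (x, y) = (u x - u y) * (v x - v y) * riesz_kernel s (x - y)"
  by (simp add: gagliardo_integrand_def riesz_kernel_def)

lemma riesz_kernel_nonneg [simp]: "0 \<le> riesz_kernel s z"
  by (simp add: riesz_kernel_def)

lemma riesz_kernel_pos: "z \<noteq> 0 \<Longrightarrow> 0 < riesz_kernel s z"
  by (simp add: riesz_kernel_def)

lemma riesz_kernel_cong:
  fixes z w :: "'a::euclidean_space"
  shows "norm z = norm w \<Longrightarrow> riesz_kernel s z = riesz_kernel s w"
  by (simp add: riesz_kernel_def)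

lemma riesz_kernel_antimono:
  fixes z w :: "'a::euclidean_space"
  assumes "0 < norm z" "norm z \<le> norm w" "0 < s"
  shows "riesz_kernel s w \<le> riesz_kernel s z"
  unfolding riesz_kernel_def using assms
  by (intro divide_left_mono powr_mono2) (auto intro!: mult_pos_pos)

lemma riesz_kernel_strict_antimono:
  fixes z w :: "'a::euclidean_space"
  assumes "0 < norm z" "norm z < norm w" "0 < s"
  shows "riesz_kernel s w < riesz_kernel s z"
  unfolding riesz_kernel_def using assms
  by (intro divide_strict_left_mono powr_less_mono2)
     (auto intro!: mult_pos_pos add_pos_pos)

lemma measurable_riesz_kernel [measurable]: "riesz_kernel s \<in> borel_measurable borel"
  unfolding riesz_kernel_def by measurable

lemma measurable_gagliardo_integrand [measurable]:
  fixes u v :: "'a::euclidean_space \<Rightarrow> real"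
  assumes [measurable]: "u \<in> borel_measurable borel" "v \<in> borel_measurable borel"
  shows "gagliardo_integrand s u v \<in> borel_measurable borel"
  unfolding gagliardo_integrand_def case_prod_beta
  by (simp add: borel_prod [symmetric])

lemma gagliardo_integrand_AE_cong:
  assumes "AE x in lborel. u x = u' x" "AE x in lborel. v x = v' x"
  shows "AE z in lborel. gagliardo_integrand s u v z = gagliardo_integrand s u' v' z"
  using AE_lborel_both_coordinates[OF assms(1)] AE_lborel_both_coordinates[OF assms(2)]
  by eventually_elim (auto simp: gagliardo_integrand_def case_prod_beta)

text \<open>The elements of the Sobolev space that are Borel measurable and vanish at every point outside
  \<open>\<Omega>\<close>. Every class modulo null sets contains such a function, and for Borel functions the double
  integrals can be treated with Fubini's theorem on the product of two copies of \<open>lborel\<close>.\<close>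

definition borel_H0 :: "real \<Rightarrow> 'a::euclidean_space set \<Rightarrow> ('a \<Rightarrow> real) set" where
  "borel_H0 s \<Omega> = {u \<in> borel_measurable borel. (\<forall>x. x \<notin> \<Omega> \<longrightarrow> u x = 0) \<and>
     integrable lborel (\<lambda>x. (u x)\<^sup>2) \<and> integrable lborel (gagliardo_integrand s u u)}"

definition energy :: "real \<Rightarrow> ('a::euclidean_space \<Rightarrow> real) \<Rightarrow> ('a \<Rightarrow> real) \<Rightarrow> real" where
  "energy s u v = (LINT z|lborel. gagliardo_integrand s u v z)"

lemma borel_H0D:
  assumes "u \<in> borel_H0 s \<Omega>"
  shows borel_H0_measurable [measurable_dest]: "u \<in> borel_measurable borel"
    and borel_H0_outside: "x \<notin> \<Omega> \<Longrightarrow> u x = 0"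
    and borel_H0_square_integrable: "integrable lborel (\<lambda>x. (u x)\<^sup>2)"
    and borel_H0_gagliardo_integrable: "integrable lborel (gagliardo_integrand s u u)"
  using assms by (auto simp: borel_H0_def)

lemma borel_H0_imp_H0_s:
  assumes u: "u \<in> borel_H0 s \<Omega>"
  shows "u \<in> H0_s s \<Omega>"
proof -
  have [measurable]: "u \<in> borel_measurable borel"
    using u by (rule borel_H0_measurable)
  have 1: "u \<in> borel_measurable lebesgue"
    by (rule measurable_completion) simp
  have 2: "integrable lebesgue (\<lambda>x. (u x)\<^sup>2)"
    using borel_H0_square_integrable[OF u] by (subst integrable_completion) auto
  have 3: "integrable lebesgue (gagliardo_integrand s u u)"
    using borel_H0_gagliardo_integrable[OF u] by (subst integrable_completion) auto
  from 1 2 3 show ?thesis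
    using borel_H0_outside[OF u] by (auto simp: H0_s_def H_s_def intro!: AE_I2)
qed

lemma lebesgue_borel_representative:
  fixes u :: "'a::euclidean_space \<Rightarrow> real"
  assumes "u \<in> borel_measurable lebesgue"
  obtains u' where "u' \<in> borel_measurable borel" "AE x in lborel. u x = u' x"
  using completion_ex_borel_measurable_real[OF assms] by auto

text \<open>This is the bridge from the complete measure to the Borel one: a null modification turns a Lebesgue
  measurable integrand into a Borel one.\<close>

lemma integrable_lebesgue_cong_lborel:
  fixes f g :: "'a::euclidean_space \<Rightarrow> real"
  assumes "g \<in> borel_measurable borel" "AE x in lborel. f x = g x"
  shows "integrable lebesgue f \<longleftrightarrow> integrable lborel g"
    and "(LINT x|lebesgue. f x) = (LINT x|lborel. g x)"
proof -
  have ae: "AE x in lebesgue. f x = g x"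
    using assms(2) by (rule AE_completion)
  have g: "g \<in> borel_measurable lebesgue"
    using assms(1) by (intro measurable_completion) simp
  have f: "f \<in> borel_measurable lebesgue"
    using borel_measurable_AE[OF g] ae by (auto simp: eq_commute)
  show "integrable lebesgue f \<longleftrightarrow> integrable lborel g"
    using integrable_cong_AE[OF f g ae] assms(1) by (simp add: integrable_completion)
  show "(LINT x|lebesgue. f x) = (LINT x|lborel. g x)"
    using integral_cong_AE[OF f g ae] assms(1) by (simp add: integral_completion)
qed

lemma H0_s_borel_representative:
  fixes \<Omega> :: "'a::euclidean_space set"
  assumes \<Omega> [measurable]: "\<Omega> \<in> sets borel" and u: "u \<in> H0_s s \<Omega>"
  obtains u' where "u' \<in> borel_H0 s \<Omega>" "AE x in lborel. u x = u' x"
proof -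
  have u1: "u \<in> borel_measurable lebesgue" "integrable lebesgue (\<lambda>x. (u x)\<^sup>2)"
      "integrable lebesgue (gagliardo_integrand s u u)"
    and u0: "AE x in lborel. x \<notin> \<Omega> \<longrightarrow> u x = 0"
    using u by (auto simp: H0_s_def H_s_def AE_completion_iff)
  obtain w where w [measurable]: "w \<in> borel_measurable borel" and uw: "AE x in lborel. u x = w x"
    using lebesgue_borel_representative[OF u1(1)] .
  define u' where "u' = (\<lambda>x. if x \<in> \<Omega> then w x else 0)"
  have [measurable]: "u' \<in> borel_measurable borel"
    unfolding u'_def by measurable
  have ae: "AE x in lborel. u x = u' x"
    using uw u0 by eventually_elim (auto simp: u'_def)
  have "integrable lborel (\<lambda>x. (u' x)\<^sup>2)"
    using u1(2) by (subst integrable_lebesgue_cong_lborel(1)[symmetric, where f = "\<lambda>x. (u x)\<^sup>2"])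
      (use ae in auto)
  moreover have "integrable lborel (gagliardo_integrand s u' u')"
    using u1(3) gagliardo_integrand_AE_cong[OF ae ae]
    by (subst integrable_lebesgue_cong_lborel(1)[symmetric, where f = "gagliardo_integrand s u u"]) auto
  ultimately have "u' \<in> borel_H0 s \<Omega>"
    by (auto simp: borel_H0_def u'_def)
  then show ?thesis
    using ae that by blast
qed

lemma H0_s_inner_eq_energy:
  fixes u v u' v' :: "'a::euclidean_space \<Rightarrow> real"
  assumes "u' \<in> borel_measurable borel" "v' \<in> borel_measurable borel"
    and "AE x in lborel. u x = u' x" "AE x in lborel. v x = v' x"
  shows "H0_s_inner s u v = energy s u' v'"
  unfolding H0_s_inner_def energy_def
  using assms by (intro integrable_lebesgue_cong_lborel(2) gagliardo_integrand_AE_cong) auto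

text \<open>\<open>r\<close> is a representative of the restriction of \<open>\<rho>\<close> to \<open>\<Omega>\<close> that is bounded everywhere and extended by
  zero, so that integrals over \<open>\<Omega>\<close> become integrals over the whole space.\<close>

definition borel_weight ::
  "'a::euclidean_space set \<Rightarrow> ('a \<Rightarrow> real) \<Rightarrow> ('a \<Rightarrow> real) \<Rightarrow> bool" where
  "borel_weight \<Omega> \<rho> r \<longleftrightarrow> r \<in> borel_measurable borel \<and> (\<forall>x. x \<notin> \<Omega> \<longrightarrow> r x = 0) \<and>
     (\<exists>C. \<forall>x. \<bar>r x\<bar> \<le> C) \<and> (AE x in lborel. x \<in> \<Omega> \<longrightarrow> \<rho> x = r x)"

lemma weighted_integral_eq:
  fixes \<Omega> :: "'a::euclidean_space set"
  assumes \<Omega> [measurable]: "\<Omega> \<in> sets borel" and r: "borel_weight \<Omega> \<rho> r"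
    and [measurable]: "u' \<in> borel_measurable borel" "v' \<in> borel_measurable borel"
    and u: "AE x in lborel. u x = u' x" and v: "AE x in lborel. v x = v' x"
  shows "(LINT x|lebesgue_on \<Omega>. \<rho> x * u x * v x) = (LINT x|lborel. r x * u' x * v' x)"
proof -
  have [measurable]: "r \<in> borel_measurable borel"
    using r by (simp add: borel_weight_def)
  have \<rho>: "AE x in lborel. x \<in> \<Omega> \<longrightarrow> \<rho> x = r x"
    using r by (simp add: borel_weight_def)
  have "(LINT x|lebesgue_on \<Omega>. \<rho> x * u x * v x)
      = (LINT x|lebesgue. indicator \<Omega> x *\<^sub>R (\<rho> x * u x * v x))"
    by (subst integral_restrict_space) auto
  also have "\<dots> = (LINT x|lborel. r x * u' x * v' x)"
  proof (rule integrable_lebesgue_cong_lborel(2))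
    show "AE x in lborel. indicator \<Omega> x *\<^sub>R (\<rho> x * u x * v x) = r x * u' x * v' x"
      using \<rho> u v by eventually_elim (use r in \<open>auto simp: borel_weight_def indicator_def\<close>)
  qed measurable
  finally show ?thesis .
qed

text \<open>Both sides of the eigenvalue equation depend only on the classes modulo null sets of the weight,
  of the eigenfunction and of the test function.\<close>

lemma frac_eigenvalue_borel_iff:
  fixes \<Omega> :: "'a::euclidean_space set"
  assumes \<Omega>: "\<Omega> \<in> sets borel" and r: "borel_weight \<Omega> \<rho> r"
  shows "frac_eigenvalue s \<Omega> \<rho> \<mu> \<longleftrightarrow>
     (\<exists>u \<in> borel_H0 s \<Omega>. \<not> (AE x in lborel. u x = 0) \<and>
        (\<forall>\<phi> \<in> borel_H0 s \<Omega>. energy s u \<phi> = \<mu> * (LINT x|lborel. r x * u x * \<phi> x)))"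
    (is "_ \<longleftrightarrow> ?B")
proof
  assume "frac_eigenvalue s \<Omega> \<rho> \<mu>"
  then obtain u where u: "u \<in> H0_s s \<Omega>" "\<not> (AE x in lborel. u x = 0)"
    and eq: "\<And>\<phi>. \<phi> \<in> H0_s s \<Omega> \<Longrightarrow>
        H0_s_inner s u \<phi> = \<mu> * (LINT x|lebesgue_on \<Omega>. \<rho> x * u x * \<phi> x)"
    by (auto simp: frac_eigenvalue_def AE_completion_iff)
  obtain u' where u': "u' \<in> borel_H0 s \<Omega>" "AE x in lborel. u x = u' x"
    using H0_s_borel_representative[OF \<Omega> u(1)] .
  note [measurable] = borel_H0_measurable[OF u'(1)]
  have "\<not> (AE x in lborel. u' x = 0)"
  proof
    assume "AE x in lborel. u' x = 0"
    with u'(2) have "AE x in lborel. u x = 0" by eventually_elim simp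
    with u(2) show False ..
  qed
  moreover have "energy s u' \<phi> = \<mu> * (LINT x|lborel. r x * u' x * \<phi> x)"
    if \<phi>: "\<phi> \<in> borel_H0 s \<Omega>" for \<phi>
    using eq[OF borel_H0_imp_H0_s[OF \<phi>]] H0_s_inner_eq_energy[OF _ _ u'(2), of \<phi> \<phi> s]
      weighted_integral_eq[OF \<Omega> r _ _ u'(2), of \<phi> \<phi>] borel_H0_measurable[OF \<phi>]
      borel_H0_measurable[OF u'(1)] by simp
  ultimately show ?B
    using u'(1) by blast
next
  assume ?B
  then obtain u where u: "u \<in> borel_H0 s \<Omega>" "\<not> (AE x in lborel. u x = 0)"
    and eq: "\<And>\<phi>. \<phi> \<in> borel_H0 s \<Omega> \<Longrightarrow> energy s u \<phi> = \<mu> * (LINT x|lborel. r x * u x * \<phi> x)"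
    by blast
  have "H0_s_inner s u \<phi> = \<mu> * (LINT x|lebesgue_on \<Omega>. \<rho> x * u x * \<phi> x)"
    if \<phi>: "\<phi> \<in> H0_s s \<Omega>" for \<phi>
  proof -
    obtain \<phi>' where \<phi>': "\<phi>' \<in> borel_H0 s \<Omega>" "AE x in lborel. \<phi> x = \<phi>' x"
      using H0_s_borel_representative[OF \<Omega> \<phi>] .
    show ?thesis
      using eq[OF \<phi>'(1)] H0_s_inner_eq_energy[of u \<phi>' u \<phi> s]
        weighted_integral_eq[OF \<Omega> r, of u \<phi>' u \<phi>] borel_H0_measurable[OF \<phi>'(1)]
        borel_H0_measurable[OF u(1)] \<phi>'(2) by simp
  qed
  then show "frac_eigenvalue s \<Omega> \<rho> \<mu>"
    using u borel_H0_imp_H0_s[OF u(1)] by (auto simp: frac_eigenvalue_def AE_completion_iff)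
qed

section \<open>The Sobolev space and its energy\<close>

lemma gagliardo_integrand_diag:
  "gagliardo_integrand s u u (x, y) = (u x - u y)\<^sup>2 * riesz_kernel s (x - y)"
  by (simp add: gagliardo_integrand_eq power2_eq_square)

lemma gagliardo_integrand_diag_nonneg: "0 \<le> gagliardo_integrand s u u z"
  by (cases z) (simp add: gagliardo_integrand_diag)

text \<open>Domination of the values and of the increments carries over to both integrals, because the
  Gagliardo integrand is the squared increment times a nonnegative kernel. All closure properties of
  the space (linear combinations, contractions, squares of bounded functions) are instances.\<close>

lemma borel_H0_dominated:
  fixes u w v :: "'a::euclidean_space \<Rightarrow> real"
  assumes u: "u \<in> borel_H0 s \<Omega>" and w: "w \<in> borel_H0 s \<Omega>"
    and v [measurable]: "v \<in> borel_measurable borel"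
    and size: "\<And>x. \<bar>v x\<bar> \<le> A * \<bar>u x\<bar> + B * \<bar>w x\<bar>"
    and diff: "\<And>x y. \<bar>v x - v y\<bar> \<le> A * \<bar>u x - u y\<bar> + B * \<bar>w x - w y\<bar>"
  shows "v \<in> borel_H0 s \<Omega>"
proof -
  note [measurable] = borel_H0_measurable[OF u] borel_H0_measurable[OF w]
  have square: "a\<^sup>2 \<le> 2 * A\<^sup>2 * b\<^sup>2 + 2 * B\<^sup>2 * c\<^sup>2" if "\<bar>a\<bar> \<le> A * \<bar>b\<bar> + B * \<bar>c\<bar>" for a b c :: real
  proof -
    have "a\<^sup>2 \<le> (A * \<bar>b\<bar> + B * \<bar>c\<bar>)\<^sup>2"
      using that by (metis abs_ge_zero power2_abs power_mono)
    also have "\<dots> \<le> 2 * (A * \<bar>b\<bar>)\<^sup>2 + 2 * (B * \<bar>c\<bar>)\<^sup>2"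
      using sum_squares_bound[of "A * \<bar>b\<bar>" "B * \<bar>c\<bar>"] by (simp add: power2_sum)
    finally show ?thesis by (simp add: power_mult_distrib)
  qed
  have "integrable lborel (\<lambda>x. (v x)\<^sup>2)"
  proof (rule Bochner_Integration.integrable_bound)
    show "integrable lborel (\<lambda>x. 2 * A\<^sup>2 * (u x)\<^sup>2 + 2 * B\<^sup>2 * (w x)\<^sup>2)"
      using borel_H0_square_integrable[OF u] borel_H0_square_integrable[OF w] by simp
    show "AE x in lborel. norm ((v x)\<^sup>2) \<le> norm (2 * A\<^sup>2 * (u x)\<^sup>2 + 2 * B\<^sup>2 * (w x)\<^sup>2)"
      using square[OF size] by (intro AE_I2) (auto intro: order_trans[OF _ abs_ge_self])
  qed measurable
  moreover have "integrable lborel (gagliardo_integrand s v v)"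
  proof (rule Bochner_Integration.integrable_bound)
    show "integrable lborel
        (\<lambda>z. 2 * A\<^sup>2 * gagliardo_integrand s u u z + 2 * B\<^sup>2 * gagliardo_integrand s w w z)"
      using borel_H0_gagliardo_integrable[OF u] borel_H0_gagliardo_integrable[OF w] by simp
    show "AE z in lborel. norm (gagliardo_integrand s v v z)
        \<le> norm (2 * A\<^sup>2 * gagliardo_integrand s u u z + 2 * B\<^sup>2 * gagliardo_integrand s w w z)"
    proof (intro AE_I2)
      fix z :: "'a \<times> 'a"
      obtain x y where z: "z = (x, y)" by fastforce
      have "(v x - v y)\<^sup>2 * riesz_kernel s (x - y)
          \<le> (2 * A\<^sup>2 * (u x - u y)\<^sup>2 + 2 * B\<^sup>2 * (w x - w y)\<^sup>2) * riesz_kernel s (x - y)"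
        by (intro mult_right_mono square diff) simp
      also have "\<dots> = 2 * A\<^sup>2 * gagliardo_integrand s u u z + 2 * B\<^sup>2 * gagliardo_integrand s w w z"
        by (simp add: z gagliardo_integrand_diag algebra_simps)
      also have "\<dots> \<le> norm \<dots>" by simp
      finally have "gagliardo_integrand s v v z \<le> norm (2 * A\<^sup>2 * gagliardo_integrand s u u z
          + 2 * B\<^sup>2 * gagliardo_integrand s w w z)"
        by (simp add: z gagliardo_integrand_diag)
      then show "norm (gagliardo_integrand s v v z)
        \<le> norm (2 * A\<^sup>2 * gagliardo_integrand s u u z + 2 * B\<^sup>2 * gagliardo_integrand s w w z)"
        by (simp add: z gagliardo_integrand_diag)
    qed
  qed measurable
  ultimately show ?thesis
    using size borel_H0_outside[OF u] borel_H0_outside[OF w]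
    by (auto simp: borel_H0_def) (metis abs_le_zero_iff abs_zero add_0 mult_zero_right)
qed

lemma borel_H0_lincomb:
  assumes u: "u \<in> borel_H0 s \<Omega>" and w: "w \<in> borel_H0 s \<Omega>"
  shows "(\<lambda>x. a * u x + b * w x) \<in> borel_H0 s \<Omega>"
proof (rule borel_H0_dominated[OF u w])
  show "(\<lambda>x. a * u x + b * w x) \<in> borel_measurable borel"
    using borel_H0_measurable[OF u] borel_H0_measurable[OF w] by measurable
  show "\<bar>a * u x + b * w x\<bar> \<le> \<bar>a\<bar> * \<bar>u x\<bar> + \<bar>b\<bar> * \<bar>w x\<bar>" for x
    by (metis abs_mult abs_triangle_ineq)
  show "\<bar>a * u x + b * w x - (a * u y + b * w y)\<bar> \<le> \<bar>a\<bar> * \<bar>u x - u y\<bar> + \<bar>b\<bar> * \<bar>w x - w y\<bar>" for x y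
    using abs_triangle_ineq[of "a * (u x - u y)" "b * (w x - w y)"]
    by (simp add: abs_mult[symmetric] right_diff_distrib algebra_simps)
qed

lemma borel_H0_contraction:
  assumes u: "u \<in> borel_H0 s \<Omega>" and "v \<in> borel_measurable borel"
    and "\<And>x. \<bar>v x\<bar> \<le> \<bar>u x\<bar>" "\<And>x y. \<bar>v x - v y\<bar> \<le> \<bar>u x - u y\<bar>"
  shows "v \<in> borel_H0 s \<Omega>"
  using borel_H0_dominated[OF u u assms(2), of 1 0] assms(3,4) by simp

lemma borel_H0_abs: "u \<in> borel_H0 s \<Omega> \<Longrightarrow> (\<lambda>x. \<bar>u x\<bar>) \<in> borel_H0 s \<Omega>"
  by (rule borel_H0_contraction) (auto simp: borel_H0_def)

lemma borel_H0_pos_part: "u \<in> borel_H0 s \<Omega> \<Longrightarrow> (\<lambda>x. max 0 (u x)) \<in> borel_H0 s \<Omega>"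
  by (rule borel_H0_contraction) (auto simp: borel_H0_def)

lemma abs_mult_le_sum_squares: "\<bar>a * b\<bar> \<le> a\<^sup>2 + b\<^sup>2" for a b :: real
proof -
  have "2 * \<bar>a * b\<bar> \<le> a\<^sup>2 + b\<^sup>2"
    using sum_squares_bound[of "\<bar>a\<bar>" "\<bar>b\<bar>"] by (simp add: abs_mult)
  then show ?thesis by linarith
qed

lemma integrable_gagliardo_integrand:
  assumes u: "u \<in> borel_H0 s \<Omega>" and v: "v \<in> borel_H0 s \<Omega>"
  shows "integrable lborel (gagliardo_integrand s u v)"
proof (rule Bochner_Integration.integrable_bound)
  note [measurable] = borel_H0_measurable[OF u] borel_H0_measurable[OF v]
  show "gagliardo_integrand s u v \<in> borel_measurable lborel" by measurable
  show "integrable lborel (\<lambda>z. gagliardo_integrand s u u z + gagliardo_integrand s v v z)"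
    using borel_H0_gagliardo_integrable[OF u] borel_H0_gagliardo_integrable[OF v] by simp
  have "\<bar>gagliardo_integrand s u v z\<bar>
      \<le> gagliardo_integrand s u u z + gagliardo_integrand s v v z" for z
    using mult_right_mono[OF abs_mult_le_sum_squares riesz_kernel_nonneg,
        of "u (fst z) - u (snd z)" "v (fst z) - v (snd z)" s "fst z - snd z"]
    by (cases z) (simp add: gagliardo_integrand_diag gagliardo_integrand_eq abs_mult distrib_right)
  then show "AE z in lborel. norm (gagliardo_integrand s u v z)
      \<le> norm (gagliardo_integrand s u u z + gagliardo_integrand s v v z)"
    by (intro AE_I2) (auto intro: order_trans[OF _ abs_ge_self])
qed

lemma integrable_weighted_product:
  fixes r :: "'a::euclidean_space \<Rightarrow> real"
  assumes u: "u \<in> borel_H0 s \<Omega>" and v: "v \<in> borel_H0 s \<Omega>"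
    and r [measurable]: "r \<in> borel_measurable borel" and C: "\<And>x. \<bar>r x\<bar> \<le> C"
  shows "integrable lborel (\<lambda>x. r x * u x * v x)"
proof (rule Bochner_Integration.integrable_bound)
  note [measurable] = borel_H0_measurable[OF u] borel_H0_measurable[OF v]
  show "(\<lambda>x. r x * u x * v x) \<in> borel_measurable lborel" by measurable
  show "integrable lborel (\<lambda>x. C * ((u x)\<^sup>2 + (v x)\<^sup>2))"
    using borel_H0_square_integrable[OF u] borel_H0_square_integrable[OF v] by simp
  have "\<bar>r x * u x * v x\<bar> \<le> C * ((u x)\<^sup>2 + (v x)\<^sup>2)" for x
  proof -
    have "\<bar>u x * v x\<bar> \<le> (u x)\<^sup>2 + (v x)\<^sup>2"
      by (rule abs_mult_le_sum_squares)
    then have "\<bar>r x\<bar> * \<bar>u x * v x\<bar> \<le> C * ((u x)\<^sup>2 + (v x)\<^sup>2)"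
      using C[of x] by (intro mult_mono) auto
    then show ?thesis by (simp add: abs_mult mult.assoc)
  qed
  then show "AE x in lborel. norm (r x * u x * v x) \<le> norm (C * ((u x)\<^sup>2 + (v x)\<^sup>2))"
    by (intro AE_I2) (auto intro: order_trans[OF _ abs_ge_self])
qed

lemma energy_nonneg: "0 \<le> energy s u u"
  unfolding energy_def
  by (intro integral_nonneg_AE AE_I2) (auto simp: gagliardo_integrand_def)

lemma energy_quadratic:
  assumes u: "u \<in> borel_H0 s \<Omega>" and v: "v \<in> borel_H0 s \<Omega>"
  shows "energy s (\<lambda>x. u x + t * v x) (\<lambda>x. u x + t * v x)
    = energy s u u + 2 * t * energy s u v + t\<^sup>2 * energy s v v"
proof -
  have eq: "gagliardo_integrand s (\<lambda>x. u x + t * v x) (\<lambda>x. u x + t * v x)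
     = (\<lambda>z. gagliardo_integrand s u u z + 2 * t * gagliardo_integrand s u v z
       + t\<^sup>2 * gagliardo_integrand s v v z)"
    by (simp add: fun_eq_iff gagliardo_integrand_eq power2_eq_square algebra_simps)
  show ?thesis
    unfolding energy_def eq
    using integrable_gagliardo_integrand[OF u u] integrable_gagliardo_integrand[OF u v]
      integrable_gagliardo_integrand[OF v v] by simp
qed

lemma energy_contraction:
  assumes u: "u \<in> borel_H0 s \<Omega>" and v: "v \<in> borel_H0 s \<Omega>"
    and "\<And>x y. \<bar>v x - v y\<bar> \<le> \<bar>u x - u y\<bar>"
  shows "energy s v v \<le> energy s u u"
  unfolding energy_def
proof (rule integral_mono)
  show "gagliardo_integrand s v v z \<le> gagliardo_integrand s u u z" for z
    using abs_le_square_iff[of "v (fst z) - v (snd z)" "u (fst z) - u (snd z)"] assms(3)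
    by (cases z) (auto simp: gagliardo_integrand_eq power2_eq_square intro!: mult_right_mono)
qed (use integrable_gagliardo_integrand[OF u u] integrable_gagliardo_integrand[OF v v] in auto)

text \<open>It suffices to pair the points of \<open>\<Omega>\<close> with those of a unit ball \<open>B\<close> at positive distance from \<open>\<Omega>\<close>:
  there \<open>u\<close> vanishes in the second variable, so the increment is \<open>u x\<close>, and the kernel is bounded below
  because the distances are bounded.\<close>

lemma borel_H0_Poincare:
  fixes \<Omega> :: "'a::euclidean_space set"
  assumes "bounded \<Omega>" "0 < s"
  obtains C where "0 < C" "\<And>u. u \<in> borel_H0 s \<Omega> \<Longrightarrow> (LINT x|lborel. (u x)\<^sup>2) \<le> C * energy s u u"
proof -
  obtain R where R: "0 < R" "\<And>x. x \<in> \<Omega> \<Longrightarrow> norm x \<le> R"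
    using assms(1) by (auto simp: bounded_pos)
  obtain p :: 'a where p: "norm p = R + 2"
    using vector_choose_size[of "R + 2"] R by auto
  define B where "B = ball p 1"
  \<comment> \<open>An upper bound for the distances between points of \<open>\<Omega>\<close> and of \<open>B\<close>.\<close>
  define D where "D = 2 * R + 4"
  define \<kappa> where "\<kappa> = 1 / D powr (real DIM('a) + 2 * s)"
  have D: "0 < D" using R by (simp add: D_def)
  have \<kappa>: "0 < \<kappa>" using D by (simp add: \<kappa>_def)
  have [measurable]: "B \<in> sets borel" by (simp add: B_def)
  have Bpos: "0 < measure lborel B"
    by (simp add: B_def content_ball_pos)
  have Bfin: "emeasure lborel B = ennreal (measure lborel B)"
    using emeasure_lborel_ball_finite[of p 1] by (simp add: B_def emeasure_eq_ennreal_measure)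
  have kernel: "\<kappa> \<le> riesz_kernel s (x - y)" if x: "x \<in> \<Omega>" and y: "y \<in> B" for x y
  proof -
    have "norm p - 1 < norm y"
      using y norm_triangle_ineq2[of p y] by (auto simp: B_def dist_norm)
    moreover have "norm y < norm p + 1"
      using y norm_triangle_ineq2[of y p] by (auto simp: B_def dist_norm norm_minus_commute)
    ultimately have "0 < norm (x - y)" "norm (x - y) \<le> D"
      using R(2)[OF x] p norm_triangle_ineq4[of x y] by (auto simp: D_def)
    then show ?thesis
      unfolding \<kappa>_def riesz_kernel_def using \<open>0 < s\<close>
      by (intro divide_left_mono powr_mono2) (auto intro!: mult_pos_pos)
  qed
  have "(LINT x|lborel. (u x)\<^sup>2) \<le> 1 / (\<kappa> * measure lborel B) * energy s u u"
    if u: "u \<in> borel_H0 s \<Omega>" for u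
  proof -
    note [measurable] = borel_H0_measurable[OF u]
    have *: "ennreal (\<kappa> * (u x)\<^sup>2) * indicator B y \<le> ennreal (gagliardo_integrand s u u (x, y))"
      for x y
    proof (cases "x \<in> \<Omega> \<and> y \<in> B")
      case True
      then have "y \<notin> \<Omega>"
        using R p norm_triangle_ineq2[of p y] by (force simp: B_def dist_norm)
      then show ?thesis
        using True kernel[of x y] borel_H0_outside[OF u]
        by (auto simp: gagliardo_integrand_diag mult.commute[of "(u x)\<^sup>2"] intro!: ennreal_leI mult_right_mono)
    qed (auto simp: indicator_def borel_H0_outside[OF u])
    have "ennreal (\<kappa> * measure lborel B) * ennreal (LINT x|lborel. (u x)\<^sup>2)
        = ennreal (\<kappa> * measure lborel B) * (\<integral>\<^sup>+x. ennreal ((u x)\<^sup>2) \<partial>lborel)"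
      using borel_H0_square_integrable[OF u] by (simp add: nn_integral_eq_integral)
    also have "\<dots> = (\<integral>\<^sup>+x. ennreal (\<kappa> * (u x)\<^sup>2) * emeasure lborel B \<partial>lborel)"
      using \<kappa> Bpos unfolding Bfin
      by (subst nn_integral_cmult[symmetric]) (auto simp: ennreal_mult' ac_simps)
    also have "\<dots> = (\<integral>\<^sup>+x. (\<integral>\<^sup>+y. ennreal (\<kappa> * (u x)\<^sup>2) * indicator B y \<partial>lborel) \<partial>lborel)"
      by (simp add: nn_integral_cmult_indicator)
    also have "\<dots> \<le> (\<integral>\<^sup>+x. (\<integral>\<^sup>+y. ennreal (gagliardo_integrand s u u (x, y)) \<partial>lborel) \<partial>lborel)"
      by (intro nn_integral_mono *)
    also have "\<dots> = (\<integral>\<^sup>+z. ennreal (gagliardo_integrand s u u z) \<partial>(lborel \<Otimes>\<^sub>M lborel))"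
      by (subst lborel.nn_integral_fst) (auto simp: lborel_prod)
    also have "\<dots> = ennreal (energy s u u)"
      using borel_H0_gagliardo_integrable[OF u] unfolding energy_def lborel_prod
      by (intro nn_integral_eq_integral) (auto intro!: AE_I2 simp: gagliardo_integrand_def)
    finally have "\<kappa> * measure lborel B * (LINT x|lborel. (u x)\<^sup>2) \<le> energy s u u"
      using \<kappa> Bpos energy_nonneg[of s u] by (simp add: ennreal_mult'[symmetric] ennreal_le_iff del: mult_le_cancel_left)
    then show ?thesis
      using \<kappa> Bpos by (simp add: field_simps)
  qed
  then show ?thesis
    using that[of "1 / (\<kappa> * measure lborel B)"] \<kappa> Bpos by simp
qed

section \<open>Compactness in the space of square integrable functions\<close>

text \<open>Fatou's lemma for real-valued integrals.\<close>

lemma integral_le_of_AE_tendsto: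
  fixes h :: "nat \<Rightarrow> 'b \<Rightarrow> real"
  assumes [measurable]: "\<And>n. h n \<in> borel_measurable M" "g \<in> borel_measurable M"
    and lim: "AE x in M. (\<lambda>n. h n x) \<longlonglongrightarrow> g x"
    and nonneg: "\<And>n x. 0 \<le> h n x" "\<And>x. 0 \<le> g x"
    and int: "\<And>n. integrable M (h n)"
    and bound: "\<forall>\<^sub>F n in sequentially. (LINT x|M. h n x) \<le> c"
  shows "integrable M g" "(LINT x|M. g x) \<le> c"
proof -
  have c: "0 \<le> c"
  proof -
    obtain n where "(LINT x|M. h n x) \<le> c"
      using bound by (auto simp: eventually_sequentially)
    moreover have "0 \<le> (LINT x|M. h n x)"
      using nonneg by simp
    ultimately show ?thesis by linarith
  qed
  have "(\<integral>\<^sup>+x. ennreal (g x) \<partial>M) = (\<integral>\<^sup>+x. liminf (\<lambda>n. ennreal (h n x)) \<partial>M)"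
  proof (rule nn_integral_cong_AE)
    show "AE x in M. ennreal (g x) = liminf (\<lambda>n. ennreal (h n x))"
      using lim
    proof eventually_elim
      case (elim x)
      then have "(\<lambda>n. ennreal (h n x)) \<longlonglongrightarrow> ennreal (g x)"
        by (rule tendsto_ennrealI)
      then show ?case
        by (simp add: lim_imp_Liminf)
    qed
  qed
  also have "\<dots> \<le> liminf (\<lambda>n. \<integral>\<^sup>+x. ennreal (h n x) \<partial>M)"
    by (rule nn_integral_liminf) simp
  also have "\<dots> \<le> ennreal c"
  proof (rule Liminf_le)
    show "\<forall>\<^sub>F n in sequentially. (\<integral>\<^sup>+x. ennreal (h n x) \<partial>M) \<le> ennreal c"
      using bound
    proof eventually_elim
      case (elim n)
      have "(\<integral>\<^sup>+x. ennreal (h n x) \<partial>M) = ennreal (LINT x|M. h n x)"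
        using int nonneg by (intro nn_integral_eq_integral) auto
      with elim show ?case by (simp add: ennreal_leI)
    qed
  qed simp
  finally have *: "(\<integral>\<^sup>+x. ennreal (g x) \<partial>M) \<le> ennreal c" .
  show int: "integrable M g"
    using * nonneg by (intro integrableI_nonneg) (auto simp: top_unique less_top[symmetric])
  show "(LINT x|M. g x) \<le> c"
    using * nonneg c by (simp add: nn_integral_eq_integral[OF int])
qed

text \<open>\<open>D m n\<close> stands for the distance of the \<open>m\<close>-th and the \<open>n\<close>-th term of a Cauchy sequence.\<close>

lemma rapid_subsequence:
  fixes D :: "nat \<Rightarrow> nat \<Rightarrow> real" and e :: "nat \<Rightarrow> real"
  assumes cauchy: "\<And>\<epsilon>. 0 < \<epsilon> \<Longrightarrow> \<exists>N. \<forall>m\<ge>N. \<forall>n\<ge>N. D m n \<le> \<epsilon>" and e: "\<And>k. 0 < e k"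
  obtains r where "strict_mono r" "\<And>k. D (r (Suc k)) (r k) \<le> e k"
proof -
  have "\<forall>k. \<exists>N. \<forall>m\<ge>N. \<forall>n\<ge>N. D m n \<le> e k"
    using cauchy e by blast
  then obtain N where N: "\<And>k m n. N k \<le> m \<Longrightarrow> N k \<le> n \<Longrightarrow> D m n \<le> e k"
    by metis
  define r where "r k = (\<Sum>i\<le>k. Suc (N i))" for k
  have "strict_mono r"
    by (rule strict_mono_Suc_iff[THEN iffD2]) (simp add: r_def)
  moreover have Nr: "N k \<le> r k" for k
    by (cases k) (simp_all add: r_def)
  have "D (r (Suc k)) (r k) \<le> e k" for k
  proof (rule N)
    show "N k \<le> r (Suc k)"
      using Nr[of k] by (simp add: r_def)
  qed (rule Nr)
  ultimately show ?thesis
    using that by blast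
qed

text \<open>Along a subsequence whose \<open>k\<close>-th increment \<open>d\<close> satisfies \<open>\<integral> d\<^sup>2 \<le> (1/4) ^ k\<close>, the increments are
  summable in \<open>L\<^sup>1\<close>, since \<open>\<bar>d\<bar> \<le> (1/2) ^ k + 2 ^ k * d\<^sup>2\<close> and the supports lie in a set of finite measure;
  hence they are absolutely summable at almost every point.\<close>

lemma L2_Cauchy_imp_AE_convergent_subsequence:
  fixes f :: "nat \<Rightarrow> 'b \<Rightarrow> real"
  assumes f [measurable]: "\<And>n. f n \<in> borel_measurable M"
    and sq: "\<And>m n. integrable M (\<lambda>x. (f m x - f n x)\<^sup>2)"
    and \<Omega> [measurable]: "\<Omega> \<in> sets M" and fin: "emeasure M \<Omega> < \<infinity>"
    and out: "\<And>n x. x \<notin> \<Omega> \<Longrightarrow> f n x = 0"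
    and cauchy: "\<And>\<epsilon>. 0 < \<epsilon> \<Longrightarrow> \<exists>N. \<forall>m\<ge>N. \<forall>n\<ge>N. (LINT x|M. (f m x - f n x)\<^sup>2) \<le> \<epsilon>"
  obtains r where "strict_mono r" "AE x in M. convergent (\<lambda>n. f (r n) x)"
proof -
  obtain r where r: "strict_mono r"
    and small: "\<And>k. (LINT x|M. (f (r (Suc k)) x - f (r k) x)\<^sup>2) \<le> (1/4) ^ k"
    using rapid_subsequence[of "\<lambda>m n. LINT x|M. (f m x - f n x)\<^sup>2" "\<lambda>k. (1/4) ^ k"] cauchy by auto
  define d where "d k x = f (r (Suc k)) x - f (r k) x" for k x
  have [measurable]: "d k \<in> borel_measurable M" for k
    unfolding d_def by measurable
  define c where "c = measure M \<Omega> + 1"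
  have bound: "(\<integral>\<^sup>+x. ennreal \<bar>d k x\<bar> \<partial>M) \<le> ennreal (c * (1/2) ^ k)" for k
  proof -
    have int: "integrable M (\<lambda>x. (1/2) ^ k * indicator \<Omega> x + 2 ^ k * (d k x)\<^sup>2)"
      using sq fin by (auto simp: d_def)
    have pt: "\<bar>d k x\<bar> \<le> (1/2) ^ k * indicator \<Omega> x + 2 ^ k * (d k x)\<^sup>2" for x
    proof (cases "x \<in> \<Omega>")
      case True
      define q :: real where "q = 2 ^ k"
      have q: "0 < q" "(1/2) ^ k = 1 / q"
        by (simp_all add: q_def power_one_over)
      have "2 * (\<bar>d k x\<bar> * q) \<le> 1 + (\<bar>d k x\<bar> * q)\<^sup>2"
        using sum_squares_bound[of 1 "\<bar>d k x\<bar> * q"] by simp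
      moreover have "0 \<le> \<bar>d k x\<bar> * q"
        using q by simp
      ultimately have "\<bar>d k x\<bar> * q \<le> 1 + (\<bar>d k x\<bar> * q)\<^sup>2"
        by linarith
      then have "\<bar>d k x\<bar> \<le> (1 + (\<bar>d k x\<bar> * q)\<^sup>2) / q"
        using q by (simp add: pos_le_divide_eq)
      also have "\<dots> = (1/2) ^ k + 2 ^ k * (d k x)\<^sup>2"
        using q(1) by (simp add: q(2) flip: q_def) (simp add: field_simps power2_eq_square)
      finally show ?thesis using True by simp
    qed (simp add: d_def out)
    have "(\<integral>\<^sup>+x. ennreal \<bar>d k x\<bar> \<partial>M)
        \<le> (\<integral>\<^sup>+x. ennreal ((1/2) ^ k * indicator \<Omega> x + 2 ^ k * (d k x)\<^sup>2) \<partial>M)"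
      using pt by (intro nn_integral_mono ennreal_leI)
    also have "\<dots> = ennreal (LINT x|M. (1/2) ^ k * indicator \<Omega> x + 2 ^ k * (d k x)\<^sup>2)"
      using int by (intro nn_integral_eq_integral) auto
    also have "(LINT x|M. (1/2) ^ k * indicator \<Omega> x + 2 ^ k * (d k x)\<^sup>2)
        = (1/2) ^ k * measure M \<Omega> + 2 ^ k * (LINT x|M. (d k x)\<^sup>2)"
      using sq fin by (subst Bochner_Integration.integral_add) (auto simp: d_def)
    also have "\<dots> \<le> (1/2) ^ k * measure M \<Omega> + 2 ^ k * (1/4) ^ k"
      using small by (simp add: d_def)
    also have "\<dots> = c * (1/2) ^ k"
      by (simp add: c_def algebra_simps power_mult_distrib[symmetric])
    finally show ?thesis
      by (simp add: ennreal_leI)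
  qed
  have "(\<integral>\<^sup>+x. (\<Sum>k. ennreal \<bar>d k x\<bar>) \<partial>M) = (\<Sum>k. \<integral>\<^sup>+x. ennreal \<bar>d k x\<bar> \<partial>M)"
    by (rule nn_integral_suminf) simp
  also have "\<dots> \<le> (\<Sum>k. ennreal (c * (1/2) ^ k))"
    using bound by (intro suminf_le) auto
  also have "\<dots> = ennreal (\<Sum>k. c * (1/2) ^ k)"
    by (intro suminf_ennreal2) (auto simp: c_def intro!: summable_mult summable_geometric)
  also have "\<dots> < \<infinity>" by simp
  finally have "AE x in M. (\<Sum>k. ennreal \<bar>d k x\<bar>) \<noteq> \<infinity>"
    by (intro nn_integral_PInf_AE) auto
  then have "AE x in M. convergent (\<lambda>n. f (r n) x)"
  proof eventually_elim
    case (elim x)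
    have "summable (\<lambda>k. \<bar>d k x\<bar>)"
      using elim by (intro summable_suminf_not_top) auto
    then have "summable (\<lambda>k. d k x)"
      by (rule summable_rabs_cancel)
    then have "convergent (\<lambda>n. \<Sum>k<n. d k x)"
      by (simp add: summable_iff_convergent)
    moreover have "(\<Sum>k<n. d k x) = f (r n) x - f (r 0) x" for n
      using sum_lessThan_telescope[of "\<lambda>n. f (r n) x"] by (simp add: d_def)
    ultimately have "convergent (\<lambda>n. f (r n) x - f (r 0) x)"
      by simp
    then show ?case
      by (simp add: convergent_diff_const_right_iff)
  qed
  then show ?thesis
    using that r by blast
qed

text \<open>The cells of a cubic grid of mesh \<open>1/k\<close>. With \<open>N\<close> the dimension, their diameters are at most \<open>N/k\<close> and
  their volumes at least \<open>(1/k) ^ N\<close>, so the quotient that has to be small is at most a constant times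
  \<open>k powr (- 2 * s)\<close>.\<close>

lemma fine_partition:
  fixes \<Omega> :: "'a::euclidean_space set"
  assumes "bounded \<Omega>" "0 < s" "0 < \<epsilon>"
  obtains \<Q> where "finite \<Q>" "disjoint \<Q>" "\<Omega> \<subseteq> \<Union>\<Q>"
    "\<And>Q. Q \<in> \<Q> \<Longrightarrow> Q \<in> sets borel \<and> 0 < measure lborel Q \<and> emeasure lborel Q < \<infinity>"
    "\<And>Q x y. Q \<in> \<Q> \<Longrightarrow> x \<in> Q \<Longrightarrow> y \<in> Q \<Longrightarrow>
       norm (x - y) powr (real DIM('a) + 2 * s) \<le> \<epsilon> * measure lborel Q"
proof -
  define N where "N = real DIM('a)"
  define A where "A = N powr (N + 2 * s)"
  have N: "0 < N" by (simp add: N_def)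
  have A: "0 < A" using N by (simp add: A_def)
  have "(\<lambda>k. real k powr (- (2 * s))) \<longlonglongrightarrow> 0"
    using \<open>0 < s\<close> by (intro tendsto_neg_powr filterlim_real_sequentially) simp
  then have "\<forall>\<^sub>F k in sequentially. real k powr (- (2 * s)) < \<epsilon> / A"
    using A \<open>0 < \<epsilon>\<close> by (intro order_tendstoD) auto
  then obtain k :: nat where k: "0 < k" "real k powr (- (2 * s)) < \<epsilon> / A"
    using eventually_gt_at_top[of 0] by (metis (mono_tags, lifting) eventually_conj eventually_happens
        sequentially_bot)
  obtain R where R: "\<And>x. x \<in> \<Omega> \<Longrightarrow> norm x \<le> R"
    using assms(1) by (auto simp: bounded_iff)
  define grid where "grid z = {y :: 'a. \<forall>b\<in>Basis. \<lfloor>real k * (y \<bullet> b)\<rfloor> = z b}" for z :: "'a \<Rightarrow> int"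
  define cell where "cell x = grid (\<lambda>b\<in>Basis. \<lfloor>real k * (x \<bullet> b)\<rfloor>)" for x :: 'a
  define L where "L = \<lceil>real k * R\<rceil>"
  have cell_iff: "y \<in> cell x \<longleftrightarrow> (\<forall>b\<in>Basis. \<lfloor>real k * (y \<bullet> b)\<rfloor> = \<lfloor>real k * (x \<bullet> b)\<rfloor>)" for x y
    by (simp add: cell_def grid_def)
  have "cell ` \<Omega> \<subseteq> grid ` (PiE Basis (\<lambda>_. {-L..L}))"
  proof
    fix Q assume "Q \<in> cell ` \<Omega>"
    then obtain x where x: "x \<in> \<Omega>" "Q = cell x" by auto
    have "\<lfloor>real k * (x \<bullet> b)\<rfloor> \<in> {-L..L}" if "b \<in> Basis" for b
    proof -
      have "\<bar>x \<bullet> b\<bar> \<le> R"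
        using Basis_le_norm[OF that, of x] R[OF x(1)] by linarith
      then have "\<bar>real k * (x \<bullet> b)\<bar> \<le> real k * R"
        by (simp add: abs_mult mult_left_mono)
      then show ?thesis
        unfolding L_def by (simp add: abs_le_iff) linarith
    qed
    then show "Q \<in> grid ` (PiE Basis (\<lambda>_. {-L..L}))"
      unfolding x(2) cell_def by (intro imageI) auto
  qed
  then have "finite (cell ` \<Omega>)"
    by (rule finite_subset) (intro finite_imageI finite_PiE finite_Basis finite_atLeastAtMost_int)
  have "disjoint (cell ` \<Omega>)"
    by (auto simp: disjoint_def cell_iff set_eq_iff)
  have "\<Omega> \<subseteq> \<Union>(cell ` \<Omega>)"
    by (auto simp: cell_iff)
  have meas: "cell x \<in> sets borel" for x
  proof -
    have "{y \<in> space borel. \<forall>b\<in>Basis. \<lfloor>real k * (y \<bullet> b)\<rfloor> = \<lfloor>real k * (x \<bullet> b)\<rfloor>} \<in> sets borel"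
      by measurable
    moreover have "cell x = {y \<in> space borel. \<forall>b\<in>Basis. \<lfloor>real k * (y \<bullet> b)\<rfloor> = \<lfloor>real k * (x \<bullet> b)\<rfloor>}"
      by (auto simp: cell_iff)
    ultimately show ?thesis by simp
  qed
  have diam: "norm (x - y) \<le> N / k" if xy: "x \<in> cell a" "y \<in> cell a" for x y a
  proof -
    have "\<bar>(x - y) \<bullet> b\<bar> \<le> 1 / k" if b: "b \<in> Basis" for b
    proof -
      have "\<lfloor>real k * (x \<bullet> b)\<rfloor> = \<lfloor>real k * (y \<bullet> b)\<rfloor>"
        using xy b by (simp add: cell_iff)
      then have "\<bar>real k * (x \<bullet> b) - real k * (y \<bullet> b)\<bar> \<le> 1"
        by linarith
      then have "real k * \<bar>(x - y) \<bullet> b\<bar> \<le> 1"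
        by (simp add: inner_diff_left right_diff_distrib[symmetric] abs_mult)
      then show ?thesis
        using k by (simp add: field_simps)
    qed
    then have "norm (x - y) \<le> (\<Sum>b\<in>(Basis :: 'a set). 1 / k)"
      by (intro order_trans[OF norm_le_l1] sum_mono)
    then show ?thesis by (simp add: N_def)
  qed
  have vol: "(1 / k) ^ DIM('a) \<le> measure lborel (cell x) \<and> emeasure lborel (cell x) < \<infinity>" for x
  proof -
    define a :: 'a where "a = (\<Sum>b\<in>Basis. (\<lfloor>real k * (x \<bullet> b)\<rfloor> / k) *\<^sub>R b)"
    define c :: 'a where "c = a + (1 / k) *\<^sub>R One"
    have a: "a \<bullet> b = \<lfloor>real k * (x \<bullet> b)\<rfloor> / k" "c \<bullet> b = (\<lfloor>real k * (x \<bullet> b)\<rfloor> + 1) / k" if "b \<in> Basis" for b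
      using that by (simp_all add: a_def c_def inner_add_left add_divide_distrib)
    have bounds: "a \<bullet> b \<le> t \<and> t < c \<bullet> b \<longleftrightarrow> \<lfloor>real k * t\<rfloor> = \<lfloor>real k * (x \<bullet> b)\<rfloor>" if "b \<in> Basis" for b t
      using k unfolding a[OF that]
      by (simp add: pos_divide_le_eq pos_less_divide_eq floor_eq_iff mult.commute)
    have "box a c \<subseteq> cell x"
      unfolding subset_iff mem_box cell_iff using bounds less_imp_le by blast
    have "cell x \<subseteq> cbox a c"
      unfolding subset_iff mem_box cell_iff using bounds less_imp_le by blast
    then have fin: "emeasure lborel (cell x) < \<infinity>"
      using emeasure_mono[of "cell x" "cbox a c" lborel] emeasure_lborel_cbox_finite[of a c]
      by (simp add: le_less_trans)
    have "measure lborel (box a c) \<le> measure lborel (cell x)"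
      using \<open>box a c \<subseteq> cell x\<close> fin meas[of x] by (intro measure_mono_fmeasurable) (auto simp: fmeasurable_def)
    moreover have "measure lborel (box a c) = (1 / k) ^ DIM('a)"
      using k by (simp add: measure_lborel_box_eq a inner_diff_left divide_right_mono diff_divide_distrib[symmetric])
    ultimately show ?thesis using fin by simp
  qed
  have "norm (x - y) powr (N + 2 * s) \<le> \<epsilon> * measure lborel (cell a)"
    if "x \<in> cell a" "y \<in> cell a" for x y a
  proof -
    have "norm (x - y) powr (N + 2 * s) \<le> (N / k) powr (N + 2 * s)"
      using diam[OF that] N \<open>0 < s\<close> by (intro powr_mono2) auto
    also have "\<dots> = A * (real k powr (- (2 * s)) * (1 / k) ^ DIM('a))"
      using k N by (simp add: A_def powr_divide powr_minus powr_add powr_realpow[symmetric]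
          N_def power_one_over field_simps)
    also have "\<dots> \<le> A * (\<epsilon> / A * measure lborel (cell a))"
      using k A \<open>0 < \<epsilon>\<close> vol[of a] by (intro mult_left_mono mult_mono) auto
    also have "\<dots> = \<epsilon> * measure lborel (cell a)"
      using A by simp
    finally show ?thesis .
  qed
  note small = this
  have pos: "0 < measure lborel (cell x)" for x
  proof -
    have "0 < (1 / real k) ^ DIM('a)" using k by simp
    with vol[of x] show ?thesis by linarith
  qed
  show ?thesis
  proof (rule that[of "cell ` \<Omega>"])
    show "finite (cell ` \<Omega>)" "disjoint (cell ` \<Omega>)" "\<Omega> \<subseteq> \<Union> (cell ` \<Omega>)" by fact+
    show "Q \<in> sets borel \<and> 0 < measure lborel Q \<and> emeasure lborel Q < \<infinity>" if "Q \<in> cell ` \<Omega>" for Q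
      using that meas pos vol by blast
    show "norm (x - y) powr (real DIM('a) + 2 * s) \<le> \<epsilon> * measure lborel Q"
      if "Q \<in> cell ` \<Omega>" "x \<in> Q" "y \<in> Q" for Q x y
      using that small unfolding N_def by blast
  qed
qed

lemma integrable_indicator_times_borel_H0:
  assumes w: "w \<in> borel_H0 s \<Omega>" and Q [measurable]: "Q \<in> sets borel" and fin: "emeasure lborel Q < \<infinity>"
  shows "integrable lborel (\<lambda>x. indicator Q x * w x)"
    and "\<bar>LINT x|lborel. indicator Q x * w x\<bar> \<le> measure lborel Q + (LINT x|lborel. (w x)\<^sup>2)"
proof -
  note [measurable] = borel_H0_measurable[OF w]
  have i: "integrable lborel (\<lambda>x. indicator Q x + (w x)\<^sup>2)"
    using borel_H0_square_integrable[OF w] fin by simp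
  have pt: "\<bar>indicator Q x * w x\<bar> \<le> indicator Q x + (w x)\<^sup>2" for x
    using abs_mult_le_sum_squares[of 1 "w x"] by (auto simp: indicator_def)
  show int: "integrable lborel (\<lambda>x. indicator Q x * w x)"
    by (rule Bochner_Integration.integrable_bound[OF i])
      (use pt in \<open>auto intro: order_trans[OF _ abs_ge_self]\<close>)
  have "\<bar>LINT x|lborel. indicator Q x * w x\<bar> \<le> (LINT x|lborel. \<bar>indicator Q x * w x\<bar>)"
    by (rule integral_abs_bound)
  also have "\<dots> \<le> (LINT x|lborel. indicator Q x + (w x)\<^sup>2)"
    using int i pt by (intro integral_mono) auto
  also have "\<dots> = measure lborel Q + (LINT x|lborel. (w x)\<^sup>2)"
    using borel_H0_square_integrable[OF w] fin by simp
  finally show "\<bar>LINT x|lborel. indicator Q x * w x\<bar> \<le> measure lborel Q + (LINT x|lborel. (w x)\<^sup>2)" .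
qed

text \<open>The case of Fubini's theorem needed to expand the square of an increment over a product of cells.\<close>

lemma lborel_product_integral:
  fixes f g :: "'a::euclidean_space \<Rightarrow> real"
  assumes f: "integrable lborel f" and g: "integrable lborel g"
  shows "integrable lborel (\<lambda>z. f (fst z) * g (snd z))"
    and "(LINT z|lborel. f (fst z) * g (snd z)) = (LINT x|lborel. f x) * (LINT x|lborel. g x)"
proof -
  have [measurable]: "f \<in> borel_measurable borel" "g \<in> borel_measurable borel"
    using f g by auto
  have *: "integrable (lborel \<Otimes>\<^sub>M lborel) (\<lambda>z. f (fst z) * g (snd z))"
  proof (rule lborel_pair.Fubini_integrable)
    show "(\<lambda>z. f (fst z) * g (snd z)) \<in> borel_measurable (lborel \<Otimes>\<^sub>M lborel)" by measurable
    show "integrable lborel (\<lambda>x. LINT y|lborel. norm (f (fst (x, y)) * g (snd (x, y))))"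
      using f by (simp add: abs_mult)
    show "AE x in lborel. integrable lborel (\<lambda>y. f (fst (x, y)) * g (snd (x, y)))"
      using g by simp
  qed
  then show "integrable lborel (\<lambda>z. f (fst z) * g (snd z))"
    by (simp add: lborel_prod)
  show "(LINT z|lborel. f (fst z) * g (snd z)) = (LINT x|lborel. f x) * (LINT x|lborel. g x)"
    using lborel_pair.integral_fst'[OF *] by (simp add: lborel_prod)
qed

text \<open>The double integral of \<open>(w x - w y)\<^sup>2\<close> over \<open>Q \<times> Q\<close> is \<open>2 |Q| \<integral>\<^sub>Q w\<^sup>2 - 2 (\<integral>\<^sub>Q w)\<^sup>2\<close>, and on \<open>Q \<times> Q\<close> the
  integrand is at most \<open>\<epsilon> |Q|\<close> times the Gagliardo integrand.\<close>

lemma square_integral_over_cell: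
  fixes w :: "'a::euclidean_space \<Rightarrow> real"
  assumes w: "w \<in> borel_H0 s \<Omega>"
    and Q [measurable]: "Q \<in> sets borel" and pos: "0 < measure lborel Q" and fin: "emeasure lborel Q < \<infinity>"
    and diam: "\<And>x y. x \<in> Q \<Longrightarrow> y \<in> Q \<Longrightarrow>
       norm (x - y) powr (real DIM('a) + 2 * s) \<le> \<epsilon> * measure lborel Q"
  shows "(LINT x|lborel. indicator Q x * (w x)\<^sup>2)
    \<le> (LINT x|lborel. indicator Q x * w x)\<^sup>2 / measure lborel Q
      + \<epsilon> / 2 * (LINT z|lborel. indicator (Q \<times> Q) z * gagliardo_integrand s w w z)"
proof -
  note [measurable] = borel_H0_measurable[OF w]
  have i1: "integrable lborel (indicator Q :: 'a \<Rightarrow> real)"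
    using fin by simp
  have i2: "integrable lborel (\<lambda>x. indicator Q x * (w x)\<^sup>2)"
    by (rule Bochner_Integration.integrable_bound[OF borel_H0_square_integrable[OF w]])
      (auto simp: indicator_def)
  have i3: "integrable lborel (\<lambda>x. indicator Q x * w x)"
    by (rule integrable_indicator_times_borel_H0(1)[OF w Q fin])
  let ?f = "\<lambda>z::'a \<times> 'a. indicator Q (fst z) * indicator Q (snd z) * (w (fst z) - w (snd z))\<^sup>2 :: real"
  let ?g = "\<lambda>z. indicator (Q \<times> Q) z * gagliardo_integrand s w w z"
  have f_eq: "?f = (\<lambda>z. (indicator Q (fst z) * (w (fst z))\<^sup>2) * indicator Q (snd z)
      + indicator Q (fst z) * (indicator Q (snd z) * (w (snd z))\<^sup>2)
      - 2 * ((indicator Q (fst z) * w (fst z)) * (indicator Q (snd z) * w (snd z))))"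
    by (simp add: fun_eq_iff power2_eq_square algebra_simps)
  have int_f: "integrable lborel ?f"
    unfolding f_eq using lborel_product_integral(1)[OF i2 i1] lborel_product_integral(1)[OF i1 i2]
      lborel_product_integral(1)[OF i3 i3] by simp
  have I: "(LINT z|lborel. ?f z) = 2 * measure lborel Q * (LINT x|lborel. indicator Q x * (w x)\<^sup>2)
      - 2 * (LINT x|lborel. indicator Q x * w x)\<^sup>2"
    unfolding f_eq using lborel_product_integral[OF i2 i1] lborel_product_integral[OF i1 i2]
      lborel_product_integral[OF i3 i3] by (simp add: power2_eq_square)
  have QQ: "Q \<times> Q \<in> sets borel"
    by (simp add: borel_prod[symmetric])
  have int_g: "integrable lborel ?g"
    by (rule Bochner_Integration.integrable_bound[OF borel_H0_gagliardo_integrable[OF w]])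
      (use QQ in \<open>auto simp: indicator_def\<close>)
  have "(LINT z|lborel. ?f z) \<le> (LINT z|lborel. \<epsilon> * measure lborel Q * ?g z)"
  proof (rule integral_mono[OF int_f])
    show "integrable lborel (\<lambda>z. \<epsilon> * measure lborel Q * ?g z)"
      using int_g by simp
    fix z :: "'a \<times> 'a"
    obtain x y where z: "z = (x, y)" by fastforce
    show "?f z \<le> \<epsilon> * measure lborel Q * ?g z"
    proof (cases "x \<in> Q \<and> y \<in> Q \<and> x \<noteq> y")
      case True
      define p where "p = norm (x - y) powr (real DIM('a) + 2 * s)"
      have p: "0 < p" "p \<le> \<epsilon> * measure lborel Q" "riesz_kernel s (x - y) = 1 / p"
        using True diam[of x y] by (auto simp: p_def riesz_kernel_def)
      have "(w x - w y)\<^sup>2 = p * ((w x - w y)\<^sup>2 * riesz_kernel s (x - y))"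
        using p by simp
      also have "\<dots> \<le> \<epsilon> * measure lborel Q * ((w x - w y)\<^sup>2 * riesz_kernel s (x - y))"
        using p(2) by (intro mult_right_mono) auto
      finally show ?thesis
        using True by (simp add: z gagliardo_integrand_diag)
    qed (auto simp: z gagliardo_integrand_diag)
  qed
  then have "2 * measure lborel Q * (LINT x|lborel. indicator Q x * (w x)\<^sup>2)
      \<le> 2 * (LINT x|lborel. indicator Q x * w x)\<^sup>2 + \<epsilon> * measure lborel Q * (LINT z|lborel. ?g z)"
    using I int_g by simp
  then show "(LINT x|lborel. indicator Q x * (w x)\<^sup>2)
    \<le> (LINT x|lborel. indicator Q x * w x)\<^sup>2 / measure lborel Q + \<epsilon> / 2 * (LINT z|lborel. ?g z)"
    using pos by (simp add: field_simps)
qed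

text \<open>A quantitative form of compactness: up to a small multiple of the energy, the \<open>L\<^sup>2\<close>-norm is controlled
  by finitely many linear functionals, the integrals over the cells.\<close>

lemma square_integral_over_partition:
  fixes w :: "'a::euclidean_space \<Rightarrow> real"
  assumes w: "w \<in> borel_H0 s \<Omega>" and "0 \<le> \<epsilon>"
    and \<Q>: "finite \<Q>" "disjoint \<Q>" "\<Omega> \<subseteq> \<Union>\<Q>"
    and Q: "\<And>Q. Q \<in> \<Q> \<Longrightarrow> Q \<in> sets borel \<and> 0 < measure lborel Q \<and> emeasure lborel Q < \<infinity>"
    and diam: "\<And>Q x y. Q \<in> \<Q> \<Longrightarrow> x \<in> Q \<Longrightarrow> y \<in> Q \<Longrightarrow>
       norm (x - y) powr (real DIM('a) + 2 * s) \<le> \<epsilon> * measure lborel Q"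
  shows "(LINT x|lborel. (w x)\<^sup>2)
    \<le> (\<Sum>Q\<in>\<Q>. (LINT x|lborel. indicator Q x * w x)\<^sup>2 / measure lborel Q) + \<epsilon> / 2 * energy s w w"
proof -
  note [measurable] = borel_H0_measurable[OF w]
  have Qm: "Q \<in> sets borel" "Q \<times> Q \<in> sets borel" if "Q \<in> \<Q>" for Q
    using Q[OF that] by (auto simp: borel_prod[symmetric])
  have i1: "integrable lborel (\<lambda>x. indicator Q x * (w x)\<^sup>2)" if "Q \<in> \<Q>" for Q
    by (rule Bochner_Integration.integrable_bound[OF borel_H0_square_integrable[OF w]])
      (use Qm[OF that] in \<open>auto simp: indicator_def\<close>)
  have i2: "integrable lborel (\<lambda>z. indicator (Q \<times> Q) z * gagliardo_integrand s w w z)" if "Q \<in> \<Q>" for Q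
    by (rule Bochner_Integration.integrable_bound[OF borel_H0_gagliardo_integrable[OF w]])
      (use Qm[OF that] in \<open>auto simp: indicator_def\<close>)
  have "(LINT x|lborel. (w x)\<^sup>2) \<le> (LINT x|lborel. (\<Sum>Q\<in>\<Q>. indicator Q x * (w x)\<^sup>2))"
  proof (rule integral_mono)
    show "integrable lborel (\<lambda>x. (w x)\<^sup>2)"
      by (rule borel_H0_square_integrable[OF w])
    show "integrable lborel (\<lambda>x. \<Sum>Q\<in>\<Q>. indicator Q x * (w x)\<^sup>2)"
      using i1 by simp
    show "(w x)\<^sup>2 \<le> (\<Sum>Q\<in>\<Q>. indicator Q x * (w x)\<^sup>2)" for x
    proof (cases "x \<in> \<Omega>")
      case True
      then obtain Q where "Q \<in> \<Q>" "x \<in> Q" using \<Q>(3) by auto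
      then have "indicator Q x * (w x)\<^sup>2 \<le> (\<Sum>Q\<in>\<Q>. indicator Q x * (w x)\<^sup>2)"
        by (intro member_le_sum) (auto simp: \<Q>(1))
      with \<open>x \<in> Q\<close> show ?thesis by simp
    qed (simp add: borel_H0_outside[OF w])
  qed
  also have "\<dots> = (\<Sum>Q\<in>\<Q>. (LINT x|lborel. indicator Q x * (w x)\<^sup>2))"
    using i1 by (rule Bochner_Integration.integral_sum)
  also have "\<dots> \<le> (\<Sum>Q\<in>\<Q>. (LINT x|lborel. indicator Q x * w x)\<^sup>2 / measure lborel Q
      + \<epsilon> / 2 * (LINT z|lborel. indicator (Q \<times> Q) z * gagliardo_integrand s w w z))"
    using Q diam by (intro sum_mono square_integral_over_cell[OF w]) auto
  also have "\<dots> = (\<Sum>Q\<in>\<Q>. (LINT x|lborel. indicator Q x * w x)\<^sup>2 / measure lborel Q)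
      + \<epsilon> / 2 * (LINT z|lborel. (\<Sum>Q\<in>\<Q>. indicator (Q \<times> Q) z * gagliardo_integrand s w w z))"
    using i2 by (simp add: sum.distrib sum_distrib_left Bochner_Integration.integral_sum)
  also have "\<dots> \<le> (\<Sum>Q\<in>\<Q>. (LINT x|lborel. indicator Q x * w x)\<^sup>2 / measure lborel Q)
      + \<epsilon> / 2 * energy s w w"
    unfolding energy_def
  proof (intro add_left_mono mult_left_mono integral_mono)
    show "integrable lborel (\<lambda>z. \<Sum>Q\<in>\<Q>. indicator (Q \<times> Q) z * gagliardo_integrand s w w z)"
      using i2 by simp
    show "integrable lborel (gagliardo_integrand s w w)"
      by (rule borel_H0_gagliardo_integrable[OF w])
    fix z :: "'a \<times> 'a"
    have nonneg: "0 \<le> gagliardo_integrand s w w z"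
      by (cases z) (simp add: gagliardo_integrand_diag)
    have "(\<Sum>Q\<in>\<Q>. indicator (Q \<times> Q) z) \<le> (1::real)"
    proof (cases "\<exists>Q0\<in>\<Q>. z \<in> Q0 \<times> Q0")
      case True
      then obtain Q0 where Q0: "Q0 \<in> \<Q>" "z \<in> Q0 \<times> Q0" by blast
      have "indicator (Q \<times> Q) z = (if Q = Q0 then 1 else 0::real)" if "Q \<in> \<Q>" for Q
        using Q0 that \<Q>(2) by (auto simp: disjoint_def indicator_def)
      then show ?thesis
        using Q0 \<Q>(1) by simp
    qed (auto simp: indicator_def)
    then show "(\<Sum>Q\<in>\<Q>. indicator (Q \<times> Q) z * gagliardo_integrand s w w z) \<le> gagliardo_integrand s w w z"
      using nonneg by (simp add: sum_distrib_right[symmetric] mult_left_le_one_le sum_nonneg)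
  qed (use \<open>0 \<le> \<epsilon>\<close> in auto)
  finally show ?thesis .
qed

text \<open>This is the diagonal argument, in the form of sequential compactness of a product of compact
  intervals.\<close>

lemma bounded_real_arrays_subsequence:
  fixes a :: "nat \<Rightarrow> nat \<Rightarrow> real"
  assumes "\<And>n i. \<bar>a n i\<bar> \<le> c i"
  obtains r where "strict_mono r" "\<And>i. convergent (\<lambda>n. a (r n) i)"
proof -
  define S where "S = PiE UNIV (\<lambda>i. {- c i..c i})"
  have "compact S"
    using compactin_PiE[of "\<lambda>_. euclidean" UNIV "\<lambda>i. {- c i..c i}"]
    by (simp add: euclidean_product_topology S_def)
  have mem: "a n \<in> S" for n
    unfolding S_def PiE_UNIV_domain Pi_iff atLeastAtMost_iff
    using abs_le_D1[OF assms] abs_le_D2[OF assms] by (simp add: minus_le_iff[of "c _"])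
  obtain l r where r: "strict_mono r" "(a \<circ> r) \<longlonglongrightarrow> l"
  proof (rule seq_compactE[of S a])
    show "seq_compact S"
      using \<open>compact S\<close> by (simp only: compact_eq_seq_compact_metric)
    show "\<forall>n. a n \<in> S"
      using mem by simp
  qed
  have "convergent (\<lambda>n. a (r n) i)" for i
  proof -
    have "continuous_on UNIV (\<lambda>f::nat \<Rightarrow> real. f i)"
      by (rule continuous_on_product_coordinates)
    then have "((\<lambda>n. (a \<circ> r) n i) \<longlonglongrightarrow> l i)"
      by (rule continuous_on_tendsto_compose[OF _ r(2)]) auto
    then show ?thesis
      by (auto simp: convergent_def)
  qed
  with r(1) show ?thesis
    by (rule that)
qed

text \<open>The partitions belonging to \<open>\<epsilon> = 1 / (j + 1)\<close> have only countably many cells altogether, so the integrals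
  over all of them converge along one subsequence. By the estimate over a partition this subsequence is
  Cauchy in \<open>L\<^sup>2\<close>.\<close>

lemma borel_H0_L2_Cauchy_subsequence:
  fixes f :: "nat \<Rightarrow> 'a::euclidean_space \<Rightarrow> real"
  assumes \<Omega>: "bounded \<Omega>" and s: "0 < s"
    and f: "\<And>n. f n \<in> borel_H0 s \<Omega>" and E: "\<And>n. energy s (f n) (f n) \<le> 1"
  obtains r :: "nat \<Rightarrow> nat" where "strict_mono r"
    "\<And>\<epsilon>. 0 < \<epsilon> \<Longrightarrow> \<exists>N. \<forall>m\<ge>N. \<forall>n\<ge>N. (LINT x|lborel. (f (r m) x - f (r n) x)\<^sup>2) \<le> \<epsilon>"
proof -
  obtain C where C: "0 < C" "\<And>u. u \<in> borel_H0 s \<Omega> \<Longrightarrow> (LINT x|lborel. (u x)\<^sup>2) \<le> C * energy s u u"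
    using borel_H0_Poincare[OF \<Omega> s] by blast
  have fC: "(LINT x|lborel. (f n x)\<^sup>2) \<le> C" for n
    using C(2)[OF f[of n]] E[of n] C(1) by (smt (verit) mult_left_le)
  define good where "good \<epsilon> \<Q> \<longleftrightarrow> finite \<Q> \<and> disjoint \<Q> \<and> \<Omega> \<subseteq> \<Union>\<Q> \<and>
    (\<forall>Q\<in>\<Q>. Q \<in> sets borel \<and> 0 < measure lborel Q \<and> emeasure lborel Q < \<infinity> \<and>
      (\<forall>x\<in>Q. \<forall>y\<in>Q. norm (x - y) powr (real DIM('a) + 2 * s) \<le> \<epsilon> * measure lborel Q))"
    for \<epsilon> and \<Q> :: "'a set set"
  have "\<exists>\<Q>. good (1 / real (Suc j)) \<Q>" for j
    using fine_partition[OF \<Omega> s, of "1 / real (Suc j)"] unfolding good_def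
    by (metis (no_types, lifting) of_nat_0_less_iff zero_less_Suc zero_less_divide_1_iff)
  then obtain \<Q> where \<Q>: "\<And>j. good (1 / real (Suc j)) (\<Q> j)"
    by metis
  define \<A> where "\<A> = insert {} (\<Union>j. \<Q> j)"
  have "countable \<A>"
    unfolding \<A>_def using \<Q> by (intro countable_insert countable_UN) (auto simp: good_def countable_finite)
  define A where "A = from_nat_into \<A>"
  have A: "A i \<in> \<A>" for i
    unfolding A_def by (rule from_nat_into) (simp add: \<A>_def)
  then have A2: "A i \<in> sets borel" "emeasure lborel (A i) < \<infinity>" for i
    using \<Q> A[of i] unfolding \<A>_def good_def by fastforce+
  define a where "a n i = (LINT x|lborel. indicator (A i) x * f n x)" for n i
  have "\<bar>a n i\<bar> \<le> measure lborel (A i) + C" for n i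
    using integrable_indicator_times_borel_H0(2)[OF f[of n] A2[of i]] fC[of n] by (simp add: a_def)
  then obtain r where r: "strict_mono r" "\<And>i. convergent (\<lambda>n. a (r n) i)"
    by (rule bounded_real_arrays_subsequence[of a "\<lambda>i. measure lborel (A i) + C"]) blast
  have "\<exists>N. \<forall>m\<ge>N. \<forall>n\<ge>N. (LINT x|lborel. (f (r m) x - f (r n) x)\<^sup>2) \<le> \<epsilon>" if \<epsilon>: "0 < \<epsilon>" for \<epsilon>
  proof -
    obtain j where j: "1 / real (Suc j) < \<epsilon> / 4"
      using \<epsilon> nat_approx_posE[of "\<epsilon> / 4"] by auto
    define e where "e = 1 / real (Suc j)"
    have e: "0 \<le> e" "e < \<epsilon> / 4" and gj: "good e (\<Q> j)"
      using j \<Q>[of j] by (auto simp: e_def)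
    define l where "l n Q = (LINT x|lborel. indicator Q x * f (r n) x)" for n Q
    have "convergent (\<lambda>n. l n Q)" if "Q \<in> \<Q> j" for Q
    proof -
      have "Q \<in> \<A>" using that by (auto simp: \<A>_def)
      then obtain i where "A i = Q"
        unfolding A_def using from_nat_into_surj[OF \<open>countable \<A>\<close>] by blast
      then show ?thesis
        using r(2)[of i] by (simp add: a_def l_def)
    qed
    then have "\<forall>Q\<in>\<Q> j. \<exists>L. (\<lambda>n. l n Q) \<longlonglongrightarrow> L"
      by (simp add: convergent_def)
    then obtain L where L: "\<And>Q. Q \<in> \<Q> j \<Longrightarrow> (\<lambda>n. l n Q) \<longlonglongrightarrow> L Q"
      by metis
    define T where "T n = (\<Sum>Q\<in>\<Q> j. (l n Q - L Q)\<^sup>2 / measure lborel Q)" for n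
    have "T \<longlonglongrightarrow> (\<Sum>Q\<in>\<Q> j. (L Q - L Q)\<^sup>2 / measure lborel Q)"
      unfolding T_def[abs_def] using gj by (intro tendsto_intros L) (auto simp: good_def)
    then have "\<forall>\<^sub>F n in sequentially. T n < \<epsilon> / 8"
      using \<epsilon> by (intro order_tendstoD) auto
    then obtain N where N: "\<And>n. N \<le> n \<Longrightarrow> T n < \<epsilon> / 8"
      by (auto simp: eventually_sequentially)
    have "(LINT x|lborel. (f (r m) x - f (r n) x)\<^sup>2) \<le> \<epsilon>" if mn: "N \<le> m" "N \<le> n" for m n
    proof -
      define w where "w = (\<lambda>x. f (r m) x + (-1) * f (r n) x)"
      have w: "w \<in> borel_H0 s \<Omega>"
        unfolding w_def using borel_H0_lincomb[OF f[of "r m"] f[of "r n"], of 1 "-1"] by simp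
      \<comment> \<open>The parallelogram law bounds the energy of a difference by \<open>2 * (1 + 1)\<close>.\<close>
      have Ew: "energy s w w \<le> 4"
        using energy_quadratic[OF f[of "r m"] f[of "r n"], of "-1"] energy_quadratic[OF f[of "r m"] f[of "r n"], of 1]
          energy_nonneg[of s "\<lambda>x. f (r m) x + 1 * f (r n) x"] E[of "r m"] E[of "r n"]
        unfolding w_def by simp
      have sub: "(LINT x|lborel. indicator Q x * w x) = l m Q - l n Q" if "Q \<in> \<Q> j" for Q
        using integrable_indicator_times_borel_H0(1)[OF f[of "r m"], of Q]
          integrable_indicator_times_borel_H0(1)[OF f[of "r n"], of Q] gj that
        by (simp add: w_def l_def good_def algebra_simps)
      have "(LINT x|lborel. (w x)\<^sup>2) \<le> (\<Sum>Q\<in>\<Q> j. (LINT x|lborel. indicator Q x * w x)\<^sup>2 / measure lborel Q)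
          + e / 2 * energy s w w"
        using gj e by (intro square_integral_over_partition[OF w]) (auto simp: good_def)
      moreover have "(\<Sum>Q\<in>\<Q> j. (LINT x|lborel. indicator Q x * w x)\<^sup>2 / measure lborel Q)
          = (\<Sum>Q\<in>\<Q> j. (l m Q - l n Q)\<^sup>2 / measure lborel Q)"
        using sub by simp
      moreover have "(\<Sum>Q\<in>\<Q> j. (l m Q - l n Q)\<^sup>2 / measure lborel Q)
          \<le> (\<Sum>Q\<in>\<Q> j. 2 * ((l m Q - L Q)\<^sup>2 / measure lborel Q)
          + 2 * ((l n Q - L Q)\<^sup>2 / measure lborel Q))"
      proof (intro sum_mono)
        fix Q assume "Q \<in> \<Q> j"
        have "(l m Q - l n Q)\<^sup>2 \<le> 2 * (l m Q - L Q)\<^sup>2 + 2 * (l n Q - L Q)\<^sup>2"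
          using sum_squares_ge_zero[of "l m Q + l n Q - 2 * L Q" 0] by (simp add: power2_eq_square algebra_simps)
        then have "(l m Q - l n Q)\<^sup>2 / measure lborel Q
            \<le> (2 * (l m Q - L Q)\<^sup>2 + 2 * (l n Q - L Q)\<^sup>2) / measure lborel Q"
          by (rule divide_right_mono) simp
        then show "(l m Q - l n Q)\<^sup>2 / measure lborel Q \<le> 2 * ((l m Q - L Q)\<^sup>2 / measure lborel Q)
          + 2 * ((l n Q - L Q)\<^sup>2 / measure lborel Q)"
          by (simp add: add_divide_distrib)
      qed
      moreover have "(\<Sum>Q\<in>\<Q> j. 2 * ((l m Q - L Q)\<^sup>2 / measure lborel Q)
          + 2 * ((l n Q - L Q)\<^sup>2 / measure lborel Q)) = 2 * T m + 2 * T n"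
        by (simp add: T_def sum.distrib sum_distrib_left)
      moreover have "e / 2 * energy s w w \<le> e / 2 * 4"
        using Ew e by (intro mult_left_mono) auto
      ultimately have "(LINT x|lborel. (w x)\<^sup>2) \<le> \<epsilon>"
        using N[OF mn(1)] N[OF mn(2)] e by linarith
      then show ?thesis by (simp add: w_def)
    qed
    then show ?thesis by blast
  qed
  then show ?thesis
    using that r(1) by blast
qed

text \<open>The compact embedding of the Sobolev space into \<open>L\<^sup>2\<close>, together with lower semicontinuity of the energy:
  both the membership of the limit and the bound for its energy come from Fatou's lemma along an almost
  everywhere convergent subsequence.\<close>

lemma borel_H0_compact:
  fixes f :: "nat \<Rightarrow> 'a::euclidean_space \<Rightarrow> real"
  assumes \<Omega>: "bounded \<Omega>" "\<Omega> \<in> sets borel" and s: "0 < s"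
    and f: "\<And>n. f n \<in> borel_H0 s \<Omega>" and E: "\<And>n. energy s (f n) (f n) \<le> 1"
  obtains r g where "strict_mono r" "g \<in> borel_H0 s \<Omega>" "energy s g g \<le> 1"
    "(\<lambda>n. LINT x|lborel. (f (r n) x - g x)\<^sup>2) \<longlonglongrightarrow> 0"
proof -
  obtain r1 :: "nat \<Rightarrow> nat" where r1: "strict_mono r1"
    "\<And>\<epsilon>. 0 < \<epsilon> \<Longrightarrow> \<exists>N. \<forall>m\<ge>N. \<forall>n\<ge>N. (LINT x|lborel. (f (r1 m) x - f (r1 n) x)\<^sup>2) \<le> \<epsilon>"
    by (rule borel_H0_L2_Cauchy_subsequence[where f = f, OF \<Omega>(1) s f E]) blast
  note [measurable] = borel_H0_measurable[OF f]
  have diff: "(\<lambda>x. f m x - f n x) \<in> borel_H0 s \<Omega>" for m n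
    using borel_H0_lincomb[OF f[of m] f[of n], of 1 "-1"] by simp
  obtain r2 where r2: "strict_mono r2" "AE x in lborel. convergent (\<lambda>n. f (r1 (r2 n)) x)"
  proof (rule L2_Cauchy_imp_AE_convergent_subsequence[of "\<lambda>n. f (r1 n)" lborel \<Omega>])
    show "emeasure lborel \<Omega> < \<infinity>"
      by (rule emeasure_bounded_finite[OF \<Omega>(1)])
  qed (use r1 borel_H0_square_integrable[OF diff] borel_H0_outside[OF f] \<Omega> in auto)
  define r where "r n = r1 (r2 n)" for n
  have r: "strict_mono r"
    using r1(1) r2(1) by (simp add: r_def strict_mono_def)
  define g where "g x = lim (\<lambda>n. f (r n) x)" for x
  have g [measurable]: "g \<in> borel_measurable borel"
    unfolding g_def by measurable
  have lim: "AE x in lborel. (\<lambda>n. f (r n) x) \<longlonglongrightarrow> g x"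
    using r2(2) by eventually_elim (simp add: g_def r_def convergent_LIMSEQ_iff)
  have g0: "g x = 0" if "x \<notin> \<Omega>" for x
    using that by (simp add: g_def borel_H0_outside[OF f] limI)
  have close: "integrable lborel (\<lambda>x. (f (r n) x - g x)\<^sup>2) \<and> (LINT x|lborel. (f (r n) x - g x)\<^sup>2) \<le> \<epsilon>"
    if N: "\<forall>m\<ge>N. \<forall>n\<ge>N. (LINT x|lborel. (f (r1 m) x - f (r1 n) x)\<^sup>2) \<le> \<epsilon>" and n: "N \<le> n" for \<epsilon> N n
  proof -
    have le: "k \<le> r2 k" for k by (rule strict_mono_imp_increasing[OF r2(1)])
    have *: "AE x in lborel. (\<lambda>m. (f (r n) x - f (r m) x)\<^sup>2) \<longlonglongrightarrow> (f (r n) x - g x)\<^sup>2"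
      using lim by eventually_elim (intro tendsto_intros)
    have **: "\<forall>\<^sub>F m in sequentially. (LINT x|lborel. (f (r n) x - f (r m) x)\<^sup>2) \<le> \<epsilon>"
      unfolding eventually_sequentially r_def using N n le by (meson order_trans)
    show ?thesis
      using integral_le_of_AE_tendsto[OF _ _ * _ _ borel_H0_square_integrable[OF diff] **] by simp
  qed
  have conv: "(\<lambda>n. LINT x|lborel. (f (r n) x - g x)\<^sup>2) \<longlonglongrightarrow> 0"
  proof (rule LIMSEQ_I)
    fix \<epsilon> :: real assume "0 < \<epsilon>"
    then obtain N where "\<forall>m\<ge>N. \<forall>n\<ge>N. (LINT x|lborel. (f (r1 m) x - f (r1 n) x)\<^sup>2) \<le> \<epsilon> / 2"
      using r1(2)[of "\<epsilon> / 2"] by auto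
    then have "(LINT x|lborel. (f (r n) x - g x)\<^sup>2) < \<epsilon>" if "N \<le> n" for n
      using close[OF _ that] \<open>0 < \<epsilon>\<close> by fastforce
    then show "\<exists>N. \<forall>n\<ge>N. norm ((LINT x|lborel. (f (r n) x - g x)\<^sup>2) - 0) < \<epsilon>"
      by (intro exI[of _ N]) auto
  qed
  have ae: "AE z in lborel. (\<lambda>n. gagliardo_integrand s (f (r n)) (f (r n)) z) \<longlonglongrightarrow> gagliardo_integrand s g g z"
    using AE_lborel_both_coordinates[OF lim]
  proof eventually_elim
    case (elim z)
    then show ?case
      by (cases z) (auto simp: gagliardo_integrand_eq intro!: tendsto_mult tendsto_diff tendsto_const)
  qed
  have gag: "integrable lborel (gagliardo_integrand s g g)" "energy s g g \<le> 1"
    using integral_le_of_AE_tendsto[OF _ _ ae _ _ borel_H0_gagliardo_integrable[OF f], of 1] E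
    by (simp_all add: energy_def gagliardo_integrand_diag_nonneg)
  obtain N where "\<forall>m\<ge>N. \<forall>n\<ge>N. (LINT x|lborel. (f (r1 m) x - f (r1 n) x)\<^sup>2) \<le> 1"
    using r1(2)[of 1] by auto
  then have i: "integrable lborel (\<lambda>x. (f (r N) x - g x)\<^sup>2)"
    using close by blast
  have "integrable lborel (\<lambda>x. (g x)\<^sup>2)"
  proof (rule Bochner_Integration.integrable_bound)
    show "integrable lborel (\<lambda>x. 2 * (f (r N) x - g x)\<^sup>2 + 2 * (f (r N) x)\<^sup>2)"
      using i borel_H0_square_integrable[OF f] by simp
    have "(b::real)\<^sup>2 \<le> 2 * (a - b)\<^sup>2 + 2 * a\<^sup>2" for a b
      using sum_squares_ge_zero[of "2 * a - b" 0] by (simp add: power2_eq_square algebra_simps)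
    then show "AE x in lborel. norm ((g x)\<^sup>2) \<le> norm (2 * (f (r N) x - g x)\<^sup>2 + 2 * (f (r N) x)\<^sup>2)"
      by (intro AE_I2) (auto intro: order_trans[OF _ abs_ge_self])
  qed measurable
  then have "g \<in> borel_H0 s \<Omega>"
    using gag g0 by (simp add: borel_H0_def)
  then show ?thesis
    using that r gag conv by blast
qed

section \<open>The first eigenvalue as the inverse of a maximum\<close>

text \<open>With \<open>d = f n - g\<close> the difference of the integrands is \<open>r (2 g d + d\<^sup>2)\<close>, which is at most
  \<open>C ((1 + 1/\<delta>) d\<^sup>2 + \<delta> g\<^sup>2)\<close> for every \<open>\<delta> > 0\<close>; let first \<open>n\<close> tend to infinity and then \<open>\<delta>\<close> to zero.\<close>

lemma weighted_square_lsc: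
  fixes r :: "'a::euclidean_space \<Rightarrow> real"
  assumes f: "\<And>n. f n \<in> borel_H0 s \<Omega>" and g: "g \<in> borel_H0 s \<Omega>"
    and r [measurable]: "r \<in> borel_measurable borel" and C: "\<And>x. \<bar>r x\<bar> \<le> C"
    and conv: "(\<lambda>n. LINT x|lborel. (f n x - g x)\<^sup>2) \<longlonglongrightarrow> 0"
    and lim: "(\<lambda>n. LINT x|lborel. r x * f n x * f n x) \<longlonglongrightarrow> M"
  shows "M \<le> (LINT x|lborel. r x * g x * g x)"
proof -
  have C0: "0 \<le> C" using C[of 0] by linarith
  define G where "G = (LINT x|lborel. (g x)\<^sup>2)"
  have G: "0 \<le> G" by (simp add: G_def)
  have "M \<le> (LINT x|lborel. r x * g x * g x) + \<delta> * (C * G)" if \<delta>: "0 < \<delta>" for \<delta>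
  proof -
    have "(LINT x|lborel. r x * f n x * f n x) \<le> (LINT x|lborel. r x * g x * g x)
        + (C * (1 + 1 / \<delta>) * (LINT x|lborel. (f n x - g x)\<^sup>2) + \<delta> * (C * G))" for n
    proof -
      have d: "(\<lambda>x. f n x - g x) \<in> borel_H0 s \<Omega>"
        using borel_H0_lincomb[OF f[of n] g, of 1 "-1"] by simp
      have pt: "r x * f n x * f n x \<le> r x * g x * g x
          + (C * (1 + 1 / \<delta>) * (f n x - g x)\<^sup>2 + \<delta> * C * (g x)\<^sup>2)" for x
      proof -
        define b d where "b = g x" and "d = f n x - g x"
        have "0 \<le> (sqrt \<delta> * b - d / sqrt \<delta>)\<^sup>2 \<and> 0 \<le> (sqrt \<delta> * b + d / sqrt \<delta>)\<^sup>2" by simp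
        then have "2 * b * d \<le> \<delta> * b\<^sup>2 + d\<^sup>2 / \<delta> \<and> - (2 * b * d) \<le> \<delta> * b\<^sup>2 + d\<^sup>2 / \<delta>"
          using \<delta> by (simp add: power2_diff power2_sum power_mult_distrib power_divide)
        then have "\<bar>2 * b * d + d\<^sup>2\<bar> \<le> (1 + 1 / \<delta>) * d\<^sup>2 + \<delta> * b\<^sup>2"
          by (simp add: abs_le_iff distrib_right) (smt (verit) zero_le_power2)
        then have "\<bar>r x\<bar> * \<bar>2 * b * d + d\<^sup>2\<bar> \<le> C * ((1 + 1 / \<delta>) * d\<^sup>2 + \<delta> * b\<^sup>2)"
          using C[of x] by (intro mult_mono) auto
        then have "r x * (2 * b * d + d\<^sup>2) \<le> C * ((1 + 1 / \<delta>) * d\<^sup>2 + \<delta> * b\<^sup>2)"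
          unfolding abs_mult[symmetric] by (rule order_trans[OF abs_ge_self])
        moreover have "r x * f n x * f n x = r x * g x * g x + r x * (2 * b * d + d\<^sup>2)"
          by (simp add: b_def d_def power2_eq_square algebra_simps)
        moreover have "C * ((1 + 1 / \<delta>) * d\<^sup>2 + \<delta> * b\<^sup>2)
            = C * (1 + 1 / \<delta>) * (f n x - g x)\<^sup>2 + \<delta> * C * (g x)\<^sup>2"
          by (simp add: b_def d_def distrib_left mult_ac)
        ultimately show ?thesis
          by linarith
      qed
      have "(LINT x|lborel. r x * f n x * f n x) \<le> (LINT x|lborel. r x * g x * g x
          + (C * (1 + 1 / \<delta>) * (f n x - g x)\<^sup>2 + \<delta> * C * (g x)\<^sup>2))"
        using integrable_weighted_product[OF f f r C] integrable_weighted_product[OF g g r C]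
          borel_H0_square_integrable[OF d] borel_H0_square_integrable[OF g] pt
        by (intro integral_mono) auto
      also have "\<dots> = (LINT x|lborel. r x * g x * g x)
          + (C * (1 + 1 / \<delta>) * (LINT x|lborel. (f n x - g x)\<^sup>2) + \<delta> * (C * G))"
        using integrable_weighted_product[OF g g r C]
          borel_H0_square_integrable[OF d] borel_H0_square_integrable[OF g]
        by (simp add: G_def)
      finally show ?thesis .
    qed
    moreover have "(\<lambda>n. (LINT x|lborel. r x * g x * g x)
        + (C * (1 + 1 / \<delta>) * (LINT x|lborel. (f n x - g x)\<^sup>2) + \<delta> * (C * G)))
        \<longlonglongrightarrow> (LINT x|lborel. r x * g x * g x) + (C * (1 + 1 / \<delta>) * 0 + \<delta> * (C * G))"
      by (intro tendsto_intros conv)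
    ultimately show ?thesis
      using LIMSEQ_le[OF lim] by fastforce
  qed
  then have "\<forall>\<^sub>F \<delta> in at_right 0. M \<le> (LINT x|lborel. r x * g x * g x) + \<delta> * (C * G)"
    by (auto simp: eventually_at_right_less eventually_at_filter)
  moreover have "((\<lambda>\<delta>. (LINT x|lborel. r x * g x * g x) + \<delta> * (C * G))
      \<longlongrightarrow> (LINT x|lborel. r x * g x * g x) + 0 * (C * G)) (at_right 0)"
    by (intro tendsto_intros)
  ultimately show ?thesis
    by (intro tendsto_lowerbound[of _ _ "at_right (0::real)"]) auto
qed

lemma energy_scale: "energy s (\<lambda>x. c * u x) (\<lambda>x. c * u x) = c\<^sup>2 * energy s u u"
proof -
  have "gagliardo_integrand s (\<lambda>x. c * u x) (\<lambda>x. c * u x) = (\<lambda>z. c\<^sup>2 * gagliardo_integrand s u u z)"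
    by (simp add: fun_eq_iff gagliardo_integrand_eq power2_eq_square algebra_simps)
  then show ?thesis by (simp add: energy_def)
qed

lemma borel_H0_scale: "u \<in> borel_H0 s \<Omega> \<Longrightarrow> (\<lambda>x. c * u x) \<in> borel_H0 s \<Omega>"
  using borel_H0_lincomb[of u s \<Omega> u c 0] by simp

text \<open>\<open>M\<close> is the maximum of the Rayleigh quotient \<open>\<integral> r u\<^sup>2 / \<parallel>u\<parallel>\<^sup>2\<close>, and \<open>u\<close> attains it.\<close>

definition maximizes_quotient ::
  "real \<Rightarrow> 'a::euclidean_space set \<Rightarrow> ('a \<Rightarrow> real) \<Rightarrow> real \<Rightarrow> ('a \<Rightarrow> real) \<Rightarrow> bool" where
  "maximizes_quotient s \<Omega> r M u \<longleftrightarrow> u \<in> borel_H0 s \<Omega> \<and> 0 < energy s u u \<and>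
     (LINT x|lborel. r x * u x * u x) = M * energy s u u \<and>
     (\<forall>v\<in>borel_H0 s \<Omega>. (LINT x|lborel. r x * v x * v x) \<le> M * energy s v v)"

text \<open>The direct method. A maximizing sequence on the unit ball of the energy converges in \<open>L\<^sup>2\<close> along a
  subsequence. The weighted integral of the limit is at least the supremum, its energy is at most one, and a
  positive supremum then forces its energy to be one. Passing to the absolute value does not increase the
  energy and makes the maximizer nonnegative.\<close>

lemma exists_maximizer:
  fixes r :: "'a::euclidean_space \<Rightarrow> real"
  assumes \<Omega>: "bounded \<Omega>" "\<Omega> \<in> sets borel" and s: "0 < s"
    and r [measurable]: "r \<in> borel_measurable borel" and C: "\<And>x. \<bar>r x\<bar> \<le> C"
    and u0: "u0 \<in> borel_H0 s \<Omega>" "0 < (LINT x|lborel. r x * u0 x * u0 x)"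
  obtains M u where "0 < M" "maximizes_quotient s \<Omega> r M u" "\<And>x. 0 \<le> u x"
proof -
  obtain P where P: "0 < P" "\<And>u. u \<in> borel_H0 s \<Omega> \<Longrightarrow> (LINT x|lborel. (u x)\<^sup>2) \<le> P * energy s u u"
    using borel_H0_Poincare[OF \<Omega>(1) s] by blast
  have C0: "0 \<le> C" using C[of 0] by linarith
  define q where "q v = (LINT x|lborel. r x * v x * v x)" for v
  have qE: "q v \<le> C * P * energy s v v" if v: "v \<in> borel_H0 s \<Omega>" for v
  proof -
    have "q v \<le> (LINT x|lborel. C * (v x)\<^sup>2)"
      unfolding q_def
    proof (rule integral_mono)
      show "r x * v x * v x \<le> C * (v x)\<^sup>2" for x
        using mult_right_mono[OF order_trans[OF abs_ge_self C[of x]], of "(v x)\<^sup>2"]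
        by (simp add: power2_eq_square mult.assoc)
    qed (use integrable_weighted_product[OF v v r C] borel_H0_square_integrable[OF v] in auto)
    also have "\<dots> \<le> C * (P * energy s v v)"
      using P(2)[OF v] C0 by (simp add: mult_left_mono)
    finally show ?thesis by (simp add: mult.assoc)
  qed
  have q_scale: "q (\<lambda>x. c * v x) = c\<^sup>2 * q v" for c v
  proof -
    have "(\<lambda>x. r x * (c * v x) * (c * v x)) = (\<lambda>x. c\<^sup>2 * (r x * v x * v x))"
      by (simp add: fun_eq_iff power2_eq_square algebra_simps)
    then show ?thesis by (simp add: q_def)
  qed
  define S where "S = {v \<in> borel_H0 s \<Omega>. energy s v v \<le> 1}"
  define M where "M = (SUP v\<in>S. q v)"
  have bdd: "bdd_above (q ` S)"
  proof (rule bdd_aboveI2)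
    fix v assume "v \<in> S"
    then show "q v \<le> C * P"
      using qE[of v] C0 P(1) by (auto simp: S_def intro: order_trans[OF _ mult_left_le])
  qed
  have E_pos: "0 < energy s v v" if v: "v \<in> borel_H0 s \<Omega>" "0 < q v" for v
  proof (rule ccontr)
    assume "\<not> 0 < energy s v v"
    then have "energy s v v = 0"
      using energy_nonneg[of s v] by linarith
    with qE[OF v(1)] v(2) show False by simp
  qed
  have normalize: "(\<lambda>x. (1 / sqrt (energy s v v)) * v x) \<in> S
      \<and> q (\<lambda>x. (1 / sqrt (energy s v v)) * v x) = q v / energy s v v"
    if v: "v \<in> borel_H0 s \<Omega>" "0 < energy s v v" for v
    using borel_H0_scale[OF v(1), of "1 / sqrt (energy s v v)"] v(2)
    unfolding S_def mem_Collect_eq energy_scale q_scale by (simp add: power_divide)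
  have q_le: "q v \<le> M * energy s v v" if v: "v \<in> borel_H0 s \<Omega>" "0 < q v" for v
  proof -
    have "q v / energy s v v \<le> M"
      using normalize[OF v(1) E_pos[OF v]] cSUP_upper[OF _ bdd] unfolding M_def by metis
    then show ?thesis
      using E_pos[OF v] by (simp add: field_simps)
  qed
  have u0': "0 < q u0" using u0(2) by (simp add: q_def)
  have "0 < q u0 / energy s u0 u0"
    using u0' E_pos[OF u0(1) u0'] by simp
  also have "\<dots> \<le> M"
    using q_le[OF u0(1) u0'] E_pos[OF u0(1) u0'] by (simp add: field_simps)
  finally have M: "0 < M" .
  have "S \<noteq> {}"
    using normalize[OF u0(1) E_pos[OF u0(1) u0']] by blast
  have "\<exists>v\<in>S. M - 1 / real (Suc n) < q v" for n
    using less_cSUP_iff[OF \<open>S \<noteq> {}\<close> bdd, of "M - 1 / real (Suc n)"] unfolding M_def by simp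
  then obtain f where f: "\<And>n. f n \<in> S" "\<And>n. M - 1 / real (Suc n) < q (f n)"
    by metis
  have fH: "f n \<in> borel_H0 s \<Omega>" and fE: "energy s (f n) (f n) \<le> 1" for n
    using f(1)[of n] by (auto simp: S_def)
  have qf: "q (f n) \<le> M" for n
    unfolding M_def using f(1) bdd by (rule cSUP_upper)
  have lim: "(\<lambda>n. q (f n)) \<longlonglongrightarrow> M"
  proof (rule tendsto_sandwich)
    show "(\<lambda>n. M - 1 / real (Suc n)) \<longlonglongrightarrow> M"
      using tendsto_diff[OF tendsto_const LIMSEQ_Suc[OF lim_1_over_n], of M] by simp
    show "\<forall>\<^sub>F n in sequentially. M - 1 / real (Suc n) \<le> q (f n)"
      using f(2) by (intro always_eventually allI less_imp_le)
    show "\<forall>\<^sub>F n in sequentially. q (f n) \<le> M"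
      using qf by (intro always_eventually allI)
  qed (rule tendsto_const)
  obtain k :: "nat \<Rightarrow> nat" and g where k: "strict_mono k" and g: "g \<in> borel_H0 s \<Omega>" "energy s g g \<le> 1"
    and conv: "(\<lambda>n. LINT x|lborel. (f (k n) x - g x)\<^sup>2) \<longlonglongrightarrow> 0"
    by (rule borel_H0_compact[where f = f, OF \<Omega> s fH fE]) blast
  have "(\<lambda>n. q (f (k n))) \<longlonglongrightarrow> M"
    using LIMSEQ_subseq_LIMSEQ[OF lim k] by (simp add: o_def)
  then have "M \<le> q g"
    unfolding q_def by (intro weighted_square_lsc[OF fH g(1) r C conv])
  define u where "u x = \<bar>g x\<bar>" for x
  have u: "u \<in> borel_H0 s \<Omega>" "q u = q g"
    using borel_H0_abs[OF g(1)] by (simp_all add: u_def[abs_def] q_def mult.assoc)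
  have "energy s u u \<le> energy s g g"
    by (rule energy_contraction[OF g(1) u(1)]) (simp add: u_def)
  then have uE: "energy s u u \<le> 1" using g(2) by simp
  have "0 < q u" using \<open>M \<le> q g\<close> M u(2) by simp
  have "M * 1 \<le> M * energy s u u"
    using q_le[OF u(1) \<open>0 < q u\<close>] \<open>M \<le> q g\<close> u(2) by simp
  then have "1 \<le> energy s u u"
    using M by simp
  then have E1: "energy s u u = 1" using uE by simp
  have qM: "q u = M"
    using q_le[OF u(1) \<open>0 < q u\<close>] \<open>M \<le> q g\<close> u(2) E1 by simp
  have "q v \<le> M * energy s v v" if "v \<in> borel_H0 s \<Omega>" for v
    using q_le[OF that] M energy_nonneg[of s v] by (cases "0 < q v") (auto intro: order_trans[of _ 0])
  then have "maximizes_quotient s \<Omega> r M u"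
    using u(1) E1 qM by (simp add: maximizes_quotient_def q_def)
  then show ?thesis
    using that[OF M] by (simp add: u_def)
qed

text \<open>The quadratic polynomial \<open>t \<mapsto> M \<parallel>u + t \<phi>\<parallel>\<^sup>2 - \<integral> r (u + t \<phi>)\<^sup>2\<close> is nonnegative and vanishes at \<open>t = 0\<close>, so
  its linear coefficient is zero.\<close>

lemma maximizer_Euler_Lagrange:
  fixes r :: "'a::euclidean_space \<Rightarrow> real"
  assumes u: "maximizes_quotient s \<Omega> r M u" and \<phi>: "\<phi> \<in> borel_H0 s \<Omega>"
    and r [measurable]: "r \<in> borel_measurable borel" and C: "\<And>x. \<bar>r x\<bar> \<le> C"
  shows "(LINT x|lborel. r x * u x * \<phi> x) = M * energy s u \<phi>"
proof -
  have uH: "u \<in> borel_H0 s \<Omega>" using u by (simp add: maximizes_quotient_def)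
  define a where "a = (LINT x|lborel. r x * u x * \<phi> x) - M * energy s u \<phi>"
  define b where "b = M * energy s \<phi> \<phi> - (LINT x|lborel. r x * \<phi> x * \<phi> x)"
  have b: "0 \<le> b"
    using u \<phi> by (simp add: maximizes_quotient_def b_def)
  have "2 * t * a \<le> t\<^sup>2 * b" for t
  proof -
    have eq: "(\<lambda>x. r x * (u x + t * \<phi> x) * (u x + t * \<phi> x))
      = (\<lambda>x. r x * u x * u x + 2 * t * (r x * u x * \<phi> x) + t\<^sup>2 * (r x * \<phi> x * \<phi> x))"
      by (simp add: fun_eq_iff power2_eq_square algebra_simps)
    have "(LINT x|lborel. r x * (u x + t * \<phi> x) * (u x + t * \<phi> x))
        = (LINT x|lborel. r x * u x * u x) + 2 * t * (LINT x|lborel. r x * u x * \<phi> x)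
          + t\<^sup>2 * (LINT x|lborel. r x * \<phi> x * \<phi> x)"
      unfolding eq using integrable_weighted_product[OF uH uH r C]
        integrable_weighted_product[OF uH \<phi> r C] integrable_weighted_product[OF \<phi> \<phi> r C] by simp
    moreover have "(LINT x|lborel. r x * (u x + t * \<phi> x) * (u x + t * \<phi> x))
        \<le> M * energy s (\<lambda>x. u x + t * \<phi> x) (\<lambda>x. u x + t * \<phi> x)"
      using u borel_H0_lincomb[OF uH \<phi>, of 1 t] by (simp add: maximizes_quotient_def)
    ultimately show ?thesis
      using u unfolding energy_quadratic[OF uH \<phi>]
      by (simp add: maximizes_quotient_def a_def b_def algebra_simps)
  qed
  note quadratic = this
  \<comment> \<open>The vertex of the parabola is at \<open>a / b\<close>; adding one covers the case \<open>b = 0\<close>.\<close>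
  define t where "t = a / (b + 1)"
  have a: "a = t * (b + 1)"
    using b by (simp add: t_def)
  have "t\<^sup>2 * (b + 2) \<le> 0"
    using quadratic[of t] unfolding a by (simp add: power2_eq_square algebra_simps)
  then have "t = 0"
    using b by (simp add: mult_le_0_iff)
  then have "a = 0"
    using a by simp
  then show ?thesis by (simp add: a_def)
qed

text \<open>The maximizer is an eigenfunction with eigenvalue \<open>1/M\<close> by the Euler--Lagrange equation. Testing the
  equation of any other positive eigenvalue \<open>\<mu>\<close> with its own eigenfunction shows that \<open>1/\<mu>\<close> is a value of
  the Rayleigh quotient.\<close>

lemma lambda1_eq_inverse_maximum:
  fixes \<Omega> :: "'a::euclidean_space set"
  assumes \<Omega>: "\<Omega> \<in> sets borel" and r: "borel_weight \<Omega> \<rho> r"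
    and M: "0 < M" and u: "maximizes_quotient s \<Omega> r M u"
    and definite: "\<And>v. v \<in> borel_H0 s \<Omega> \<Longrightarrow> \<not> (AE x in lborel. v x = 0) \<Longrightarrow> 0 < energy s v v"
  shows "lambda1 s \<Omega> \<rho> = 1 / M"
  unfolding lambda1_def
proof (rule Least_equality)
  have rm: "r \<in> borel_measurable borel" using r by (simp add: borel_weight_def)
  obtain C where C: "\<And>x. \<bar>r x\<bar> \<le> C" using r by (auto simp: borel_weight_def)
  have uH: "u \<in> borel_H0 s \<Omega>" using u by (simp add: maximizes_quotient_def)
  have "\<not> (AE x in lborel. u x = 0)"
  proof
    assume 0: "AE x in lborel. u x = 0"
    have "(LINT x|lborel. r x * u x * u x) = 0"
      using 0 by (intro integral_eq_zero_AE) auto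
    then show False
      using u M by (auto simp: maximizes_quotient_def)
  qed
  moreover have "energy s u \<phi> = 1 / M * (LINT x|lborel. r x * u x * \<phi> x)" if "\<phi> \<in> borel_H0 s \<Omega>" for \<phi>
    using maximizer_Euler_Lagrange[OF u that rm C] M by simp
  ultimately show "0 < 1 / M \<and> frac_eigenvalue s \<Omega> \<rho> (1 / M)"
    unfolding frac_eigenvalue_borel_iff[OF \<Omega> r]
    using uH M by (intro conjI bexI[of _ u] ballI) simp_all
next
  fix \<mu> assume \<mu>: "0 < \<mu> \<and> frac_eigenvalue s \<Omega> \<rho> \<mu>"
  then obtain v where v: "v \<in> borel_H0 s \<Omega>" "\<not> (AE x in lborel. v x = 0)"
    and eq: "energy s v v = \<mu> * (LINT x|lborel. r x * v x * v x)"
    unfolding frac_eigenvalue_borel_iff[OF \<Omega> r] by blast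
  have "(LINT x|lborel. r x * v x * v x) \<le> M * energy s v v"
    using u v(1) by (simp add: maximizes_quotient_def)
  then have "\<mu> * (LINT x|lborel. r x * v x * v x) \<le> \<mu> * (M * energy s v v)"
    using \<mu> by (intro mult_left_mono) auto
  then have "1 * energy s v v \<le> (\<mu> * M) * energy s v v"
    by (simp only: eq[symmetric] mult.assoc[of \<mu> M] mult_1)
  then have "1 \<le> \<mu> * M"
    using definite[OF v] by (simp only: mult_le_cancel_right_pos)
  then show "1 / M \<le> \<mu>"
    using M by (simp add: field_simps)
qed

section \<open>Test functions and the variational characterization\<close>

lemma radial_shell:
  fixes t :: real
  assumes "0 < t"
  shows "(\<exists>k::nat. (1/2) ^ Suc k < t \<and> t \<le> (1/2) ^ k) \<or> (\<exists>k::nat. 2 ^ k < t \<and> t \<le> 2 ^ Suc k)"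
proof (cases "t \<le> 1")
  case True
  define m where "m = (LEAST n. (1/2::real) ^ n < t)"
  have "\<exists>n. (1/2) ^ n < t"
    using real_arch_pow_inv[OF assms, of "1/2"] by simp
  then have m: "(1/2) ^ m < t"
    unfolding m_def by (rule LeastI_ex)
  have "m \<noteq> 0"
  proof
    assume "m = 0"
    with m True show False by simp
  qed
  then obtain k where k: "m = Suc k"
    by (rule not0_implies_Suc[THEN exE])
  have "\<not> (1/2) ^ k < t"
  proof (rule not_less_Least)
    show "k < (LEAST n. (1/2::real) ^ n < t)"
      unfolding m_def[symmetric] k by (rule lessI)
  qed
  then show ?thesis
    using m unfolding k not_less by blast
next
  case False
  define m where "m = (LEAST n. t \<le> (2::real) ^ n)"
  have "\<exists>n. t \<le> 2 ^ n"
    using real_arch_pow[of 2 t] less_imp_le by auto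
  then have m: "t \<le> 2 ^ m"
    unfolding m_def by (rule LeastI_ex)
  have "m \<noteq> 0"
  proof
    assume "m = 0"
    with m False show False by simp
  qed
  then obtain k where k: "m = Suc k"
    by (rule not0_implies_Suc[THEN exE])
  have "\<not> t \<le> 2 ^ k"
  proof (rule not_less_Least)
    show "k < (LEAST n. t \<le> (2::real) ^ n)"
      unfolding m_def[symmetric] k by (rule lessI)
  qed
  then show ?thesis
    using m unfolding k not_le by blast
qed

text \<open>With \<open>N\<close> the dimension, the integrand on the shell \<open>(1/2) ^ Suc k < norm z \<le> (1/2) ^ k\<close> is of order
  \<open>2 powr (k * (N + 2 * s - 2))\<close> and the volume of order \<open>2 powr (- k * N)\<close>; the resulting geometric series
  converges because \<open>s < 1\<close>. On the shell \<open>2 ^ k < norm z \<le> 2 ^ Suc k\<close> the product of the two orders is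
  \<open>2 powr (- 2 * s * k)\<close>, which is summable because \<open>s > 0\<close>.\<close>

lemma nn_integral_truncated_riesz_kernel:
  assumes s: "0 < s" "s < 1"
  shows "(\<integral>\<^sup>+z. ennreal (min 1 ((norm z)\<^sup>2) * riesz_kernel s (z :: 'a::euclidean_space)) \<partial>lborel) < \<infinity>"
proof -
  define p where "p = real DIM('a) + 2 * s"
  have p: "0 < p" using s by (simp add: p_def add_pos_pos)
  define V where "V = measure lborel (cball (0::'a) 1)"
  have vol: "emeasure lborel (cball (0::'a) t) = ennreal (V * t ^ DIM('a))" if "0 \<le> t" for t
    using that by (simp add: V_def emeasure_cball content_cball ennreal_mult'')
  have V: "0 \<le> V" by (simp add: V_def)
  \<comment> \<open>\<open>a k\<close> and \<open>b k\<close> bound the integrand on the \<open>k\<close>-th shell inside and outside the unit ball.\<close>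
  define a where "a k = 2 powr p * (2 powr (p - 2)) ^ k" for k :: nat
  define b where "b k = (2 powr (- p)) ^ k" for k :: nat
  have two: "(2::real) ^ k = 2 powr (real k)" for k
    by (simp add: powr_realpow)
  have half: "(1/2::real) ^ k = 2 powr (- real k)" for k
    by (simp add: powr_minus powr_realpow power_one_over inverse_eq_divide)
  have pw: "(2 powr t) ^ k = (2::real) powr (t * real k)" for t k
    by (simp add: powr_powr flip: powr_realpow)
  have single: "f k \<le> suminf f" for f :: "nat \<Rightarrow> ennreal" and k
    using sum_le_suminf[of f "{k}"] by simp
  have pointwise: "ennreal (min 1 ((norm z)\<^sup>2) * riesz_kernel s z)
      \<le> (\<Sum>k. ennreal (a k) * indicator (cball 0 ((1/2) ^ k)) z)
        + (\<Sum>k. ennreal (b k) * indicator (cball 0 (2 ^ Suc k)) z)" for z :: 'a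
  proof (cases "z = 0")
    case False
    then have "0 < norm z" by simp
    from radial_shell[OF this] show ?thesis
    proof
      assume "\<exists>k::nat. (1/2) ^ Suc k < norm z \<and> norm z \<le> (1/2) ^ k"
      then obtain k where k: "(1/2) ^ Suc k < norm z" "norm z \<le> (1/2) ^ k" by blast
      have 1: "min 1 ((norm z)\<^sup>2) \<le> ((1/2) ^ k)\<^sup>2"
        using power_mono[OF k(2), of 2] by (intro min.coboundedI2) simp
      have "((1/2) ^ Suc k) powr p \<le> norm z powr p"
        using k(1) p by (intro powr_mono2) auto
      then have 2: "riesz_kernel s z \<le> 1 / ((1/2) ^ Suc k) powr p"
        unfolding riesz_kernel_def p_def[symmetric] using False
        by (intro divide_left_mono mult_pos_pos) auto
      have "min 1 ((norm z)\<^sup>2) * riesz_kernel s z \<le> ((1/2) ^ k)\<^sup>2 * (1 / ((1/2) ^ Suc k) powr p)"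
        using 1 2 by (intro mult_mono) auto
      also have "\<dots> = a k"
      proof -
        have "((1/2) ^ k)\<^sup>2 * (1 / ((1/2) ^ Suc k) powr p)
            = (2::real) powr (- real k * 2) * (1 / 2 powr (- real (Suc k) * p))"
          unfolding half pw powr_powr by (simp add: pw[of _ 2, simplified])
        also have "\<dots> = 2 powr (- real k * 2 - (- real (Suc k) * p))"
          by (simp only: powr_diff) simp
        also have "- real k * 2 - (- real (Suc k) * p) = p + (p - 2) * real k"
          by (simp add: algebra_simps)
        also have "2 powr \<dots> = a k"
          unfolding a_def pw powr_add ..
        finally show ?thesis .
      qed
      finally have "ennreal (min 1 ((norm z)\<^sup>2) * riesz_kernel s z)
          \<le> ennreal (a k) * indicator (cball 0 ((1/2) ^ k)) z"
        using k(2) by (simp add: ennreal_leI)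
      also have "\<dots> \<le> (\<Sum>k. ennreal (a k) * indicator (cball 0 ((1/2) ^ k)) z)"
        by (rule single[where f = "\<lambda>k. ennreal (a k) * indicator (cball 0 ((1/2) ^ k)) z"])
      finally show ?thesis
        by (rule order_trans) simp
    next
      assume "\<exists>k::nat. 2 ^ k < norm z \<and> norm z \<le> 2 ^ Suc k"
      then obtain k where k: "2 ^ k < norm z" "norm z \<le> 2 ^ Suc k" by blast
      have "(2 ^ k) powr p \<le> norm z powr p"
        using k(1) p by (intro powr_mono2) auto
      then have 2: "riesz_kernel s z \<le> 1 / (2 ^ k) powr p"
        unfolding riesz_kernel_def p_def[symmetric] using False
        by (intro divide_left_mono mult_pos_pos) auto
      have "min 1 ((norm z)\<^sup>2) * riesz_kernel s z \<le> 1 * (1 / (2 ^ k) powr p)"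
        using 2 by (intro mult_mono) auto
      also have "\<dots> = b k"
        unfolding b_def pw two powr_powr by (simp add: powr_minus_divide mult.commute)
      finally have "ennreal (min 1 ((norm z)\<^sup>2) * riesz_kernel s z)
          \<le> ennreal (b k) * indicator (cball 0 (2 ^ Suc k)) z"
        using k(2) by (simp add: ennreal_leI)
      also have "\<dots> \<le> (\<Sum>k. ennreal (b k) * indicator (cball 0 (2 ^ Suc k)) z)"
        by (rule single[where f = "\<lambda>k. ennreal (b k) * indicator (cball 0 (2 ^ Suc k)) z"])
      finally show ?thesis
        by (rule order_trans) simp
    qed
  qed simp
  have "(\<integral>\<^sup>+z. ennreal (min 1 ((norm z)\<^sup>2) * riesz_kernel s (z::'a)) \<partial>lborel)
      \<le> (\<integral>\<^sup>+(z::'a). (\<Sum>k. ennreal (a k) * indicator (cball 0 ((1/2) ^ k)) z)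
        + (\<Sum>k. ennreal (b k) * indicator (cball 0 (2 ^ Suc k)) z) \<partial>lborel)"
    by (intro nn_integral_mono pointwise)
  also have "\<dots> = (\<Sum>k. ennreal (a k) * emeasure lborel (cball (0::'a) ((1/2) ^ k)))
      + (\<Sum>k. ennreal (b k) * emeasure lborel (cball (0::'a) (2 ^ Suc k)))"
  proof -
    have series: "(\<lambda>z. \<Sum>k. \<alpha> k * indicator (A k) z) \<in> borel_measurable lborel"
        "(\<integral>\<^sup>+z. (\<Sum>k. \<alpha> k * indicator (A k) z) \<partial>lborel) = (\<Sum>k. \<alpha> k * emeasure lborel (A k))"
      if [measurable]: "\<And>k. A k \<in> sets borel" for \<alpha> :: "nat \<Rightarrow> ennreal" and A :: "nat \<Rightarrow> 'a set"
      by (measurable, subst nn_integral_suminf) (auto simp: nn_integral_cmult_indicator)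
    show ?thesis
      by (subst nn_integral_add) (simp_all only: series borel_closed closed_cball)
  qed
  also have "(\<Sum>k. ennreal (a k) * emeasure lborel (cball (0::'a) ((1/2) ^ k)))
      = (\<Sum>k. ennreal (2 powr p * V * (2 powr (2 * s - 2)) ^ k))"
  proof (intro suminf_cong)
    fix k
    have "(2 powr (p - 2)) ^ k * ((1/2) ^ k) ^ DIM('a) = (2 powr (2 * s - 2)) ^ k"
    proof -
      have "((1/2::real) ^ k) ^ DIM('a) = (2 powr (- real DIM('a))) ^ k"
        unfolding half pw by (simp add: mult.commute)
      moreover have "(2 powr (p - 2)) ^ k * (2 powr (- real DIM('a))) ^ k = (2 powr (2 * s - 2)) ^ k"
        unfolding pw powr_add[symmetric] by (simp add: p_def algebra_simps)
      ultimately show ?thesis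
        by (simp only:)
    qed
    then show "ennreal (a k) * emeasure lborel (cball (0::'a) ((1/2) ^ k))
        = ennreal (2 powr p * V * (2 powr (2 * s - 2)) ^ k)"
      by (subst vol) (simp_all add: a_def ennreal_mult'[symmetric] V mult_ac)
  qed
  also have "\<dots> = ennreal (\<Sum>k. 2 powr p * V * (2 powr (2 * s - 2)) ^ k)"
    using s V by (intro suminf_ennreal2 summable_mult summable_geometric) (auto simp: powr_less_one)
  also have "(\<Sum>k. ennreal (b k) * emeasure lborel (cball (0::'a) (2 ^ Suc k)))
      = (\<Sum>k. ennreal (2 ^ DIM('a) * V * (2 powr (- (2 * s))) ^ k))"
  proof (intro suminf_cong)
    fix k
    have "(2 powr (- p)) ^ k * (2 ^ Suc k) ^ DIM('a) = 2 ^ DIM('a) * (2 powr (- (2 * s))) ^ k"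
    proof -
      have "(2 ^ Suc k) ^ DIM('a) = 2 ^ DIM('a) * (2 powr (real DIM('a))) ^ k"
        by (simp add: power_mult_distrib powr_realpow power_mult[symmetric] mult.commute)
      moreover have "(2 powr (- p)) ^ k * (2 powr (real DIM('a))) ^ k = (2 powr (- (2 * s))) ^ k"
        unfolding pw powr_add[symmetric] by (simp add: p_def algebra_simps)
      ultimately show ?thesis
        by (simp only: mult.left_commute)
    qed
    then show "ennreal (b k) * emeasure lborel (cball (0::'a) (2 ^ Suc k))
        = ennreal (2 ^ DIM('a) * V * (2 powr (- (2 * s))) ^ k)"
      by (subst vol) (simp_all add: b_def ennreal_mult'[symmetric] V mult_ac)
  qed
  also have "\<dots> = ennreal (\<Sum>k. 2 ^ DIM('a) * V * (2 powr (- (2 * s))) ^ k)"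
    using s V by (intro suminf_ennreal2 summable_mult summable_geometric) (auto simp: powr_less_one)
  finally show ?thesis
    by (rule le_less_trans) simp
qed

text \<open>The squared increment is bounded by a multiple of \<open>min 1 ((norm (x - y))\<^sup>2)\<close>, and it vanishes unless one of
  the two points lies in the bounded set \<open>\<Omega>\<close>; integrate first over the other point.\<close>

lemma Lipschitz_imp_borel_H0:
  fixes v :: "'a::euclidean_space \<Rightarrow> real"
  assumes \<Omega>: "bounded \<Omega>" "\<Omega> \<in> sets borel" and s: "0 < s" "s < 1"
    and lip: "\<And>x y. \<bar>v x - v y\<bar> \<le> L * norm (x - y)" and B: "\<And>x. \<bar>v x\<bar> \<le> B"
    and out: "\<And>x. x \<notin> \<Omega> \<Longrightarrow> v x = 0"
  shows "v \<in> borel_H0 s \<Omega>"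
proof -
  note [measurable] = \<Omega>(2)
  have B0: "0 \<le> B" using B[of 0] by linarith
  have L0: "0 \<le> L"
  proof -
    obtain b :: 'a where "b \<in> Basis" using nonempty_Basis by blast
    then have "0 \<le> L * norm (b - 0)" using lip[of b 0] by linarith
    then show ?thesis using \<open>b \<in> Basis\<close> by simp
  qed
  have "L-lipschitz_on UNIV v"
    using lip L0 by (intro lipschitz_onI) (auto simp: dist_norm)
  then have v [measurable]: "v \<in> borel_measurable borel"
    by (intro borel_measurable_continuous_onI lipschitz_on_continuous_on)
  have fin: "emeasure lborel \<Omega> < \<infinity>"
    by (rule emeasure_bounded_finite[OF \<Omega>(1)])
  have sq: "integrable lborel (\<lambda>x. (v x)\<^sup>2)"
  proof (rule Bochner_Integration.integrable_bound)
    show "integrable lborel (\<lambda>x. B\<^sup>2 * indicator \<Omega> x)"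
      using fin by simp
    have "(v x)\<^sup>2 \<le> B\<^sup>2 * indicator \<Omega> x" for x
      using power_mono[OF B[of x], of 2] out[of x] by (auto simp: indicator_def)
    then show "AE x in lborel. norm ((v x)\<^sup>2) \<le> norm (B\<^sup>2 * indicator \<Omega> x :: real)"
      by (intro AE_I2) (auto intro: order_trans[OF _ abs_ge_self])
  qed measurable
  define k where "k z = ennreal (min 1 ((norm z)\<^sup>2) * riesz_kernel s z)" for z :: 'a
  have [measurable]: "k \<in> borel_measurable borel"
    unfolding k_def by measurable
  define I where "I = (\<integral>\<^sup>+z. k z \<partial>lborel)"
  have I: "I < \<infinity>"
    unfolding I_def k_def by (rule nn_integral_truncated_riesz_kernel[OF s])
  have k_sym: "k (x - y) = k (y - x)" for x y
    by (simp add: k_def norm_minus_commute riesz_kernel_def)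
  have shift: "(\<integral>\<^sup>+y. k (y - x) \<partial>lborel) = I" for x
  proof -
    have "I = (\<integral>\<^sup>+z. k z \<partial>distr lborel borel ((+) (- x)))"
      by (simp add: lborel_distr_plus I_def)
    also have "\<dots> = (\<integral>\<^sup>+y. k (- x + y) \<partial>lborel)"
      by (rule nn_integral_distr) auto
    finally show ?thesis by simp
  qed
  \<comment> \<open>Increments are at most \<open>L * norm (x - y)\<close> and at most \<open>2 * B\<close>.\<close>
  define c where "c = L\<^sup>2 + 4 * B\<^sup>2"
  have c: "0 \<le> c" by (simp add: c_def)
  have pt: "ennreal (gagliardo_integrand s v v (x, y))
      \<le> ennreal c * (indicator \<Omega> x * k (y - x) + indicator \<Omega> y * k (x - y))" for x y
  proof (cases "x \<in> \<Omega> \<or> y \<in> \<Omega>")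
    case True
    have 1: "(v x - v y)\<^sup>2 \<le> L\<^sup>2 * (norm (x - y))\<^sup>2"
      using power_mono[OF lip[of x y], of 2] by (simp add: power_mult_distrib)
    have "\<bar>v x - v y\<bar> \<le> 2 * B"
      using B[of x] B[of y] by linarith
    then have 2: "(v x - v y)\<^sup>2 \<le> 4 * B\<^sup>2"
      using power_mono[of "\<bar>v x - v y\<bar>" "2 * B" 2] by (simp add: power_mult_distrib)
    have "(v x - v y)\<^sup>2 \<le> c * min 1 ((norm (x - y))\<^sup>2)"
    proof (cases "(norm (x - y))\<^sup>2 \<le> 1")
      case True
      have "L\<^sup>2 * (norm (x - y))\<^sup>2 \<le> c * (norm (x - y))\<^sup>2"
        by (intro mult_right_mono) (auto simp: c_def)
      with 1 True show ?thesis by (simp add: min_def)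
    next
      case False
      have "4 * B\<^sup>2 \<le> c" by (simp add: c_def)
      with 2 False show ?thesis by (simp add: min_def)
    qed
    then have "gagliardo_integrand s v v (x, y) \<le> c * (min 1 ((norm (x - y))\<^sup>2) * riesz_kernel s (x - y))"
      unfolding gagliardo_integrand_diag mult.assoc[symmetric] by (rule mult_right_mono) simp
    then have "ennreal (gagliardo_integrand s v v (x, y)) \<le> ennreal c * k (x - y)"
      by (simp add: k_def c ennreal_mult'[symmetric] ennreal_leI)
    also have "\<dots> \<le> ennreal c * (indicator \<Omega> x * k (y - x) + indicator \<Omega> y * k (x - y))"
      using True by (intro mult_left_mono) (auto simp: k_sym[of y x] indicator_def)
    finally show ?thesis .
  qed (simp add: gagliardo_integrand_diag out)
  have "(\<integral>\<^sup>+z. ennreal (gagliardo_integrand s v v z) \<partial>lborel)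
      = (\<integral>\<^sup>+z. ennreal (gagliardo_integrand s v v z) \<partial>(lborel \<Otimes>\<^sub>M lborel))"
    by (simp add: lborel_prod)
  also have "\<dots> \<le> (\<integral>\<^sup>+z. ennreal c * (indicator \<Omega> (fst z) * k (snd z - fst z)
      + indicator \<Omega> (snd z) * k (fst z - snd z)) \<partial>(lborel \<Otimes>\<^sub>M lborel))"
    using pt by (intro nn_integral_mono) auto
  also have "\<dots> = ennreal c * ((\<integral>\<^sup>+z. indicator \<Omega> (fst z) * k (snd z - fst z) \<partial>(lborel \<Otimes>\<^sub>M lborel))
      + (\<integral>\<^sup>+z. indicator \<Omega> (snd z) * k (fst z - snd z) \<partial>(lborel \<Otimes>\<^sub>M lborel)))"
    by (subst nn_integral_cmult, measurable, subst nn_integral_add, measurable)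
  also have "(\<integral>\<^sup>+z. indicator \<Omega> (fst z) * k (snd z - fst z) \<partial>(lborel \<Otimes>\<^sub>M lborel)) = I * emeasure lborel \<Omega>"
    by (subst lborel.nn_integral_fst[symmetric])
      (auto simp: nn_integral_cmult shift nn_integral_multc mult.commute)
  also have "(\<integral>\<^sup>+z. indicator \<Omega> (snd z) * k (fst z - snd z) \<partial>(lborel \<Otimes>\<^sub>M lborel)) = I * emeasure lborel \<Omega>"
    by (subst lborel_pair.nn_integral_snd[symmetric])
      (auto simp: nn_integral_cmult shift nn_integral_multc mult.commute)
  also have "ennreal c * (I * emeasure lborel \<Omega> + I * emeasure lborel \<Omega>) < \<infinity>"
    using I fin by (simp add: ennreal_mult_less_top)
  finally have "integrable lborel (gagliardo_integrand s v v)"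
    by (intro integrableI_nonneg) (auto simp: gagliardo_integrand_diag_nonneg)
  then show ?thesis
    using sq out by (simp add: borel_H0_def)
qed

text \<open>Inner regularity of Lebesgue measure.\<close>

lemma compact_subset_of_positive_measure:
  fixes A :: "'a::euclidean_space set"
  assumes A [measurable]: "A \<in> sets borel" and bnd: "bounded A" and pos: "0 < emeasure lborel A"
  obtains K where "compact K" "K \<subseteq> A" "0 < measure lborel K"
proof -
  have Am: "A \<in> lmeasurable" "0 < measure lebesgue A"
    using pos emeasure_bounded_finite[OF bnd] by (auto simp: fmeasurable_def measure_def enn2real_positive_iff)
  obtain T where T: "closed T" "T \<subseteq> A" "A - T \<in> lmeasurable" "emeasure lebesgue (A - T) < ennreal (measure lebesgue A)"
    using sets_lebesgue_inner_closed[of A "measure lebesgue A"] Am by (metis fmeasurableD)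
  have cT: "compact T"
    using T(1,2) bnd by (auto simp: compact_eq_bounded_closed intro: bounded_subset)
  have Tm: "T \<in> lmeasurable"
    using cT by (rule lmeasurable_compact)
  have "measure lebesgue (A - T) < measure lebesgue A"
    using T(3,4) Am(2) by (simp add: emeasure_eq_measure2 ennreal_less_iff)
  then have "0 < measure lebesgue T"
    using measurable_measure_Diff[OF Am(1) _ T(2)] Tm by auto
  then have "0 < measure lborel T"
    using T(1) by (simp add: borel_closed)
  then show ?thesis
    using that cT T(2) by blast
qed

text \<open>The functions \<open>\<phi>\<close> are Lipschitz cutoffs that decrease to the indicator of a compact set on which \<open>g\<close> is
  positive. The square appears in two roles, as the square of a competitor in the Rayleigh quotient
  and as a test function in the Euler--Lagrange equation; hence both memberships are recorded.\<close>

lemma test_function_detects_positive_part: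
  fixes g :: "'a::euclidean_space \<Rightarrow> real"
  assumes \<Omega>: "bounded \<Omega>" "open \<Omega>" and s: "0 < s" "s < 1"
    and g: "integrable lborel g" and pos: "emeasure lborel {x \<in> \<Omega>. 0 < g x} > 0"
  obtains \<phi> where "\<phi> \<in> borel_H0 s \<Omega>" "(\<lambda>x. (\<phi> x)\<^sup>2) \<in> borel_H0 s \<Omega>"
    "0 < (LINT x|lborel. g x * (\<phi> x)\<^sup>2)"
proof -
  have [measurable]: "g \<in> borel_measurable borel" "\<Omega> \<in> sets borel"
    using g \<Omega>(2) by auto
  define A where "A = {x \<in> \<Omega>. 0 < g x}"
  have A [measurable]: "A \<in> sets borel"
    unfolding A_def by measurable
  have "bounded A"
    using \<Omega>(1) by (rule bounded_subset) (auto simp: A_def)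
  then obtain K where K: "compact K" "K \<subseteq> A" "0 < measure lborel K"
    using compact_subset_of_positive_measure[OF A] pos by (auto simp: A_def[symmetric])
  have [measurable]: "K \<in> sets borel"
    using K(1) by (simp add: borel_compact)
  have "K \<noteq> {}" using K(3) by auto
  obtain e where e: "0 < e" "(\<Union>x\<in>K. ball x e) \<subseteq> \<Omega>"
    using compact_subset_open_imp_ball_epsilon_subset[OF K(1) \<Omega>(2)] K(2) by (auto simp: A_def)
  \<comment> \<open>The slope is at least \<open>1 / e\<close>, so the cutoffs vanish beyond the distance \<open>e\<close> from \<open>K\<close>, hence outside \<open>\<Omega>\<close>.\<close>
  define \<phi> where "\<phi> n x = max 0 (1 - (real (Suc n) / e) * infdist x K)" for n x
  have inf0: "infdist x K \<ge> 0" for x by (rule infdist_nonneg)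
  have bound: "0 \<le> \<phi> n x" "\<phi> n x \<le> 1" for n x
    using e(1) inf0[of x] by (auto simp: \<phi>_def)
  have out: "\<phi> n x = 0" if x: "x \<notin> \<Omega>" for n x
  proof -
    have "e \<le> infdist x K"
    proof (rule ccontr)
      assume "\<not> e \<le> infdist x K"
      moreover obtain y where "y \<in> K" "infdist x K = dist x y"
        by (rule infdist_attains_inf[OF compact_imp_closed[OF K(1)] \<open>K \<noteq> {}\<close>])
      ultimately have "y \<in> K" "x \<in> ball y e" by (auto simp: dist_commute)
      then show False
        using e(2) x by blast
    qed
    then have "e * 1 \<le> infdist x K * real (Suc n)"
      using e(1) by (intro mult_mono) auto
    then have "1 \<le> (real (Suc n) / e) * infdist x K"
      using e(1) by (simp add: field_simps)
    then show ?thesis by (simp add: \<phi>_def)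
  qed
  have lip: "\<bar>\<phi> n x - \<phi> n y\<bar> \<le> (real (Suc n) / e) * norm (x - y)" for n x y
  proof -
    define c where "c = real (Suc n) / e"
    have c: "0 \<le> c" using e(1) by (simp add: c_def)
    have "\<bar>\<phi> n x - \<phi> n y\<bar> \<le> \<bar>c * infdist x K - c * infdist y K\<bar>"
      unfolding \<phi>_def c_def[symmetric] by (simp add: max_def abs_if)
    also have "\<dots> = c * \<bar>infdist x K - infdist y K\<bar>"
      using c by (simp add: abs_mult right_diff_distrib[symmetric])
    also have "\<dots> \<le> c * dist x y"
      using c by (intro mult_left_mono infdist_triangle_abs)
    finally show ?thesis
      by (simp add: c_def dist_norm)
  qed
  have H1: "\<phi> n \<in> borel_H0 s \<Omega>" for n
    by (rule Lipschitz_imp_borel_H0[OF \<Omega>(1) _ s lip, of _ 1]) (use bound out in auto)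
  have H2: "(\<lambda>x. (\<phi> n x)\<^sup>2) \<in> borel_H0 s \<Omega>" for n
  proof (rule borel_H0_dominated[OF H1[of n] H1[of n], of _ 2 0])
    show "(\<lambda>x. (\<phi> n x)\<^sup>2) \<in> borel_measurable borel"
      using borel_H0_measurable[OF H1[of n]] by measurable
    show "\<bar>(\<phi> n x)\<^sup>2\<bar> \<le> 2 * \<bar>\<phi> n x\<bar> + 0 * \<bar>\<phi> n x\<bar>" for x
      using mult_left_mono[OF bound(2)[of n x] bound(1)[of n x]] bound(1)[of n x]
      by (simp add: power2_eq_square)
    show "\<bar>(\<phi> n x)\<^sup>2 - (\<phi> n y)\<^sup>2\<bar> \<le> 2 * \<bar>\<phi> n x - \<phi> n y\<bar> + 0 * \<bar>\<phi> n x - \<phi> n y\<bar>" for x y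
    proof -
      have "(\<phi> n x)\<^sup>2 - (\<phi> n y)\<^sup>2 = (\<phi> n x + \<phi> n y) * (\<phi> n x - \<phi> n y)"
        by (simp add: power2_eq_square algebra_simps)
      moreover have "\<bar>\<phi> n x + \<phi> n y\<bar> \<le> 2"
        using bound[of n x] bound[of n y] by linarith
      ultimately show ?thesis
        by (simp add: abs_mult mult_right_mono)
    qed
  qed
  have lim: "(\<lambda>n. LINT x|lborel. g x * (\<phi> n x)\<^sup>2) \<longlonglongrightarrow> (LINT x|lborel. g x * indicator K x)"
  proof (rule integral_dominated_convergence)
    show "integrable lborel (\<lambda>x. \<bar>g x\<bar>)" using g by simp
    show "AE x in lborel. (\<lambda>n. g x * (\<phi> n x)\<^sup>2) \<longlonglongrightarrow> g x * indicator K x"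
    proof (intro AE_I2 tendsto_mult tendsto_const)
      fix x
      show "(\<lambda>n. (\<phi> n x)\<^sup>2) \<longlonglongrightarrow> (indicator K x :: real)"
      proof (cases "x \<in> K")
        case True
        then show ?thesis by (simp add: \<phi>_def)
      next
        case False
        then have d: "0 < infdist x K"
          using \<open>K \<noteq> {}\<close> K(1) by (simp add: infdist_pos_not_in_closed compact_imp_closed)
        obtain N :: nat where N: "e / infdist x K < N"
          using reals_Archimedean2 by blast
        have "\<phi> n x = 0" if "N \<le> n" for n
        proof -
          have "e / infdist x K \<le> real (Suc n)" using N that by linarith
          then have "1 \<le> (real (Suc n) / e) * infdist x K"
            using d e(1) by (simp add: field_simps)
          then show ?thesis by (simp add: \<phi>_def)
        qed
        then have "\<forall>\<^sub>F n in sequentially. (\<phi> n x)\<^sup>2 = 0"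
          by (auto simp: eventually_sequentially)
        then show ?thesis
          using False by (auto intro: tendsto_eventually)
      qed
    qed
    show "AE x in lborel. norm (g x * (\<phi> n x)\<^sup>2) \<le> \<bar>g x\<bar>" for n
    proof (intro AE_I2)
      fix x
      have "(\<phi> n x)\<^sup>2 \<le> 1"
        using bound[of n x] by (simp add: power_le_one)
      then show "norm (g x * (\<phi> n x)\<^sup>2) \<le> \<bar>g x\<bar>"
        by (simp add: abs_mult mult_left_le)
    qed
    show "(\<lambda>x. g x * indicator K x) \<in> borel_measurable lborel" by measurable
    show "(\<lambda>x. g x * (\<phi> n x)\<^sup>2) \<in> borel_measurable lborel" for n
      using borel_H0_measurable[OF H1[of n]] by measurable
  qed
  have "0 < (LINT x|lborel. g x * indicator K x)"
  proof -
    have int: "integrable lborel (\<lambda>x. g x * indicator K x)"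
      using g by (intro integrable_real_mult_indicator) auto
    have nonneg: "0 \<le> g x * indicator K x" for x
      using K(2) by (auto simp: A_def indicator_def intro: less_imp_le)
    have "(LINT x|lborel. g x * indicator K x) \<noteq> 0"
    proof
      assume "(LINT x|lborel. g x * indicator K x) = 0"
      then have "AE x in lborel. g x * indicator K x = 0"
        using integral_nonneg_eq_0_iff_AE[OF int] nonneg by simp
      then have "AE x in lborel. x \<notin> K"
        by eventually_elim (use K(2) in \<open>auto simp: A_def indicator_def\<close>)
      then have "emeasure lborel K = 0"
        by (simp add: AE_iff_measurable[of K] )
      then show False
        using K(3) by (simp add: measure_def)
    qed
    moreover have "0 \<le> (LINT x|lborel. g x * indicator K x)"
      using nonneg by simp
    ultimately show ?thesis by linarith
  qed
  then have "\<forall>\<^sub>F n in sequentially. 0 < (LINT x|lborel. g x * (\<phi> n x)\<^sup>2)"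
    using lim by (rule order_tendstoD(1)[rotated])
  then obtain n where "0 < (LINT x|lborel. g x * (\<phi> n x)\<^sup>2)"
    by (auto simp: eventually_sequentially)
  then show ?thesis
    using that H1 H2 by blast
qed

text \<open>The variational characterization of the smallest positive eigenvalue.\<close>

lemma lambda1_attained:
  fixes \<Omega> :: "'a::euclidean_space set"
  assumes \<Omega>: "bounded \<Omega>" "open \<Omega>" and s: "0 < s" "s < 1"
    and w: "borel_weight \<Omega> \<rho> r" and pos: "0 < emeasure lborel {x \<in> \<Omega>. 0 < r x}"
  obtains M u where "0 < M" "maximizes_quotient s \<Omega> r M u" "\<And>x. 0 \<le> u x" "lambda1 s \<Omega> \<rho> = 1 / M"
proof -
  have \<Omega>m [measurable]: "\<Omega> \<in> sets borel" using \<Omega>(2) by simp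
  have r [measurable]: "r \<in> borel_measurable borel" and out: "\<And>x. x \<notin> \<Omega> \<Longrightarrow> r x = 0"
    using w by (auto simp: borel_weight_def)
  obtain C where C: "\<And>x. \<bar>r x\<bar> \<le> C" using w by (auto simp: borel_weight_def)
  have "integrable lborel r"
  proof (rule Bochner_Integration.integrable_bound)
    show "integrable lborel (\<lambda>x. C * indicator \<Omega> x)"
      using emeasure_bounded_finite[OF \<Omega>(1)] by simp
    show "AE x in lborel. norm (r x) \<le> norm (C * indicator \<Omega> x :: real)"
      using C out by (intro AE_I2) (auto simp: indicator_def intro: order_trans[OF _ abs_ge_self])
  qed simp
  then obtain \<phi> where \<phi>: "\<phi> \<in> borel_H0 s \<Omega>" "0 < (LINT x|lborel. r x * (\<phi> x)\<^sup>2)"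
    by (rule test_function_detects_positive_part[OF \<Omega> s _ pos])
  have "0 < (LINT x|lborel. r x * \<phi> x * \<phi> x)"
    using \<phi>(2) by (simp add: power2_eq_square mult.assoc)
  then obtain M u where Mu: "0 < M" "maximizes_quotient s \<Omega> r M u" "\<And>x. 0 \<le> u x"
    by (rule exists_maximizer[OF \<Omega>(1) \<Omega>m s(1) r C \<phi>(1)]) blast
  have "0 < energy s v v" if v: "v \<in> borel_H0 s \<Omega>" "\<not> (AE x in lborel. v x = 0)" for v
  proof (rule ccontr)
    assume "\<not> 0 < energy s v v"
    then have "energy s v v = 0" using energy_nonneg[of s v] by linarith
    moreover obtain P where "\<And>u. u \<in> borel_H0 s \<Omega> \<Longrightarrow> (LINT x|lborel. (u x)\<^sup>2) \<le> P * energy s u u"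
      using borel_H0_Poincare[OF \<Omega>(1) s(1)] by blast
    ultimately have "(LINT x|lborel. (v x)\<^sup>2) \<le> 0" using v(1) by fastforce
    moreover have "0 \<le> (LINT x|lborel. (v x)\<^sup>2)" by simp
    ultimately have "(LINT x|lborel. (v x)\<^sup>2) = 0" by linarith
    then have "AE x in lborel. (v x)\<^sup>2 = 0"
      using integral_nonneg_eq_0_iff_AE[OF borel_H0_square_integrable[OF v(1)]] by simp
    then have "AE x in lborel. v x = 0" by simp
    with v(2) show False ..
  qed
  then have "lambda1 s \<Omega> \<rho> = 1 / M"
    by (rule lambda1_eq_inverse_maximum[OF \<Omega>m w Mu(1,2)])
  with Mu show ?thesis by (rule that)
qed

section \<open>Positivity of nonnegative maximizers\<close>

text \<open>Write \<open>p - a = f - m\<close> and \<open>q - b = g - n\<close> with positive and negative parts. The left-hand side is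
  \<open>(p - q) (f - g) - (f - g)\<^sup>2\<close> minus the mixed products \<open>m g + n f\<close>, and the first two terms are at most
  \<open>(p - q)\<^sup>2 / 4\<close>.\<close>

lemma negative_part_test_inequality:
  fixes a b p q :: real
  shows "(a - b) * (max 0 (p - a) - max 0 (q - b))
     \<le> (p - q)\<^sup>2 / 4 - (max 0 (a - p) * max 0 (q - b) + max 0 (b - q) * max 0 (p - a))"
proof -
  define f g m n where "f = max 0 (p - a)" and "g = max 0 (q - b)"
    and "m = max 0 (a - p)" and "n = max 0 (b - q)"
  have "f * m = 0" "g * n = 0"
    by (auto simp: f_def g_def m_def n_def max_def)
  have ab: "a - b = (p - q) - (f - g) + (m - n)"
    by (auto simp: f_def g_def m_def n_def max_def)
  have "(a - b) * (f - g) = (p - q) * (f - g) - (f - g)\<^sup>2 + (f * m + g * n) - (m * g + n * f)"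
    unfolding ab by (simp add: power2_eq_square algebra_simps)
  also have "\<dots> = (p - q)\<^sup>2 / 4 - ((p - q) / 2 - (f - g))\<^sup>2 - (m * g + n * f)"
    unfolding \<open>f * m = 0\<close> \<open>g * n = 0\<close> by (simp add: power2_eq_square field_simps)
  also have "\<dots> \<le> (p - q)\<^sup>2 / 4 - (m * g + n * f)"
    by simp
  finally show ?thesis
    by (simp add: f_def g_def m_def n_def)
qed

text \<open>A nonlocal strong maximum principle. The equation is tested with \<open>\<phi>\<close>, the positive part of \<open>\<epsilon> \<psi> - u\<close>, where
  \<open>\<psi>\<close> is a Lipschitz function that is positive exactly on \<open>\<Omega>\<close>. The energy of \<open>\<epsilon> \<psi>\<close> and the weighted integral
  are of order \<open>\<epsilon>\<^sup>2\<close>. The interaction between the zero set \<open>Z\<close> of \<open>u\<close> and the set \<open>P\<close> where \<open>\<delta> \<le> u\<close>,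
  in contrast, is of order \<open>\<epsilon>\<close>, because the kernel links points at any distance. So \<open>P \<times> Z\<close> is null.\<close>

lemma maximizer_positive:
  fixes r :: "'a::euclidean_space \<Rightarrow> real"
  assumes \<Omega>: "bounded \<Omega>" "open \<Omega>" and s: "0 < s" "s < 1"
    and r: "r \<in> borel_measurable borel" and C: "\<And>x. \<bar>r x\<bar> \<le> C"
    and M: "0 < M" and u: "maximizes_quotient s \<Omega> r M u" and nonneg: "\<And>x. 0 \<le> u x"
  shows "AE x in lborel. x \<in> \<Omega> \<longrightarrow> 0 < u x"
proof -
  have \<Omega>m [measurable]: "\<Omega> \<in> sets borel" using \<Omega>(2) by auto
  have uH: "u \<in> borel_H0 s \<Omega>" using u by (simp add: maximizes_quotient_def)
  note [measurable] = borel_H0_measurable[OF uH] r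
  have C0: "0 \<le> C" using C[of 0] by linarith
  obtain R where R: "\<And>x. x \<in> \<Omega> \<Longrightarrow> norm x \<le> R" "0 < R"
    using \<Omega>(1) by (auto simp: bounded_pos)
  \<comment> \<open>A point outside \<open>\<Omega>\<close>: it makes the distance to the complement a bounded function.\<close>
  obtain p0 :: 'a where p0: "norm p0 = R + 1"
    using vector_choose_size[of "R + 1"] R(2) by auto
  then have p0: "p0 \<in> - \<Omega>" "norm p0 = R + 1"
    using R(1)[of p0] by auto
  define \<psi> where "\<psi> x = infdist x (- \<Omega>)" for x
  define B where "B = 2 * R + 1"
  have \<psi>0: "0 \<le> \<psi> x" for x by (simp add: \<psi>_def infdist_nonneg)
  have \<psi>_out: "\<psi> x = 0" if "x \<notin> \<Omega>" for x
    using that by (simp add: \<psi>_def)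
  have \<psi>_pos: "0 < \<psi> x" if "x \<in> \<Omega>" for x
    unfolding \<psi>_def using that \<Omega>(2) p0(1) by (intro infdist_pos_not_in_closed) auto
  have \<psi>_B: "\<psi> x \<le> B" for x
  proof (cases "x \<in> \<Omega>")
    case True
    have "\<psi> x \<le> dist x p0"
      unfolding \<psi>_def using p0(1) by (rule infdist_le)
    also have "\<dots> \<le> norm x + norm p0"
      by (simp add: dist_norm norm_triangle_ineq4)
    finally show ?thesis using R(1)[OF True] p0(2) by (simp add: B_def)
  qed (use R(2) in \<open>simp add: \<psi>_out B_def\<close>)
  have \<psi>H: "\<psi> \<in> borel_H0 s \<Omega>"
  proof (rule Lipschitz_imp_borel_H0[OF \<Omega>(1) \<Omega>m s, of _ 1 B])
    show "\<bar>\<psi> x - \<psi> y\<bar> \<le> 1 * norm (x - y)" for x y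
      using infdist_triangle_abs[of x "- \<Omega>" y] by (simp add: \<psi>_def dist_norm)
  qed (use \<psi>0 \<psi>_B \<psi>_out in auto)
  note [measurable] = borel_H0_measurable[OF \<psi>H]
  define Z where "Z = {x \<in> \<Omega>. u x = 0}"
  have [measurable]: "Z \<in> sets borel" unfolding Z_def by measurable
  have B: "0 < B" using R(2) by (simp add: B_def)
  define D where "D = energy s \<psi> \<psi> / 4 + C / M * (LINT x|lborel. (\<psi> x)\<^sup>2)"
  have D: "0 \<le> D"
    using energy_nonneg[of s \<psi>] C0 M by (auto simp: D_def intro!: add_nonneg_nonneg)
  have null: "emeasure lborel {x. \<delta> \<le> u x} * emeasure lborel Z = 0" if \<delta>: "0 < \<delta>" for \<delta>
  proof -
    define P where "P = {x. \<delta> \<le> u x}"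
    have [measurable]: "P \<in> sets borel" unfolding P_def by measurable
    define j where "j z = indicator P (fst z) * indicator Z (snd z) * (\<psi> (snd z) * riesz_kernel s (fst z - snd z))"
      for z :: "'a \<times> 'a"
    have j0: "0 \<le> j z" for z by (simp add: j_def \<psi>0)
    have [measurable]: "j \<in> borel_measurable borel"
      unfolding j_def[abs_def] by (simp add: borel_prod[symmetric])
    \<comment> \<open>The smallness of \<open>\<epsilon>\<close> ensures \<open>\<delta> / 2 \<le> u x - \<epsilon> * \<psi> x\<close> on \<open>P\<close>, so that the interaction term is
      at least of order \<open>\<epsilon>\<close> there.\<close>
    have scaled: "ennreal (\<delta> / 2 * \<epsilon>) * (\<integral>\<^sup>+z. ennreal (j z) \<partial>lborel) \<le> ennreal (\<epsilon>\<^sup>2 * D)"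
      if \<epsilon>: "0 < \<epsilon>" "\<epsilon> * B \<le> \<delta> / 2" for \<epsilon>
    proof -
      define v where "v x = \<epsilon> * \<psi> x + (-1) * u x" for x
      define \<phi> where "\<phi> x = max 0 (v x)" for x
      have vH: "v \<in> borel_H0 s \<Omega>"
        unfolding v_def[abs_def] by (rule borel_H0_lincomb[OF \<psi>H uH])
      have \<phi>H: "\<phi> \<in> borel_H0 s \<Omega>"
        unfolding \<phi>_def[abs_def] by (rule borel_H0_pos_part[OF vH])
      \<comment> \<open>The integral of \<open>F\<close> is of order \<open>\<epsilon>\<^sup>2\<close> by the Euler--Lagrange equation, while \<open>F\<close> dominates a multiple
        of \<open>\<epsilon> * j\<close>.\<close>
      define F where "F z = \<epsilon>\<^sup>2 / 4 * gagliardo_integrand s \<psi> \<psi> z - gagliardo_integrand s u \<phi> z" for z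
      have Fint: "integrable lborel F"
        unfolding F_def[abs_def]
        using integrable_gagliardo_integrand[OF \<psi>H \<psi>H] integrable_gagliardo_integrand[OF uH \<phi>H] by simp
      have jF: "\<delta> / 2 * \<epsilon> * j z \<le> F z" for z
      proof -
        obtain x y where z: "z = (x, y)" by fastforce
        define k where "k = riesz_kernel s (x - y)"
        have k: "0 \<le> k" by (simp add: k_def)
        define m where "m t = max 0 (u t - \<epsilon> * \<psi> t)" for t
        have m\<phi>: "0 \<le> m t" "0 \<le> \<phi> t" for t by (simp_all add: m_def \<phi>_def)
        have "(u x - u y) * (\<phi> x - \<phi> y) \<le> (\<epsilon> * \<psi> x - \<epsilon> * \<psi> y)\<^sup>2 / 4 - (m x * \<phi> y + m y * \<phi> x)"
          using negative_part_test_inequality[of "u x" "u y" "\<epsilon> * \<psi> x" "\<epsilon> * \<psi> y"]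
          by (simp add: m_def \<phi>_def v_def)
        moreover have "(\<epsilon> * \<psi> x - \<epsilon> * \<psi> y)\<^sup>2 / 4 = \<epsilon>\<^sup>2 / 4 * (\<psi> x - \<psi> y)\<^sup>2"
          by (simp add: power_mult_distrib[symmetric] right_diff_distrib)
        ultimately have "(m x * \<phi> y + m y * \<phi> x) * k
            \<le> (\<epsilon>\<^sup>2 / 4 * (\<psi> x - \<psi> y)\<^sup>2 - (u x - u y) * (\<phi> x - \<phi> y)) * k"
          by (intro mult_right_mono k) simp
        also have "\<dots> = F z"
          by (simp add: F_def z gagliardo_integrand_diag gagliardo_integrand_eq k_def left_diff_distrib mult.assoc)
        finally have 1: "(m x * \<phi> y + m y * \<phi> x) * k \<le> F z" .
        have "m x * \<phi> y \<le> m x * \<phi> y + m y * \<phi> x"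
          using m\<phi> by simp
        have 2: "indicator P x * indicator Z y * (\<delta> / 2 * (\<epsilon> * \<psi> y)) \<le> m x * \<phi> y"
        proof (cases "x \<in> P \<and> y \<in> Z")
          case True
          have "\<epsilon> * \<psi> x \<le> \<epsilon> * B"
            using \<psi>_B[of x] \<epsilon>(1) by simp
          moreover have "\<delta> \<le> u x"
            using True by (simp add: P_def)
          ultimately have "\<delta> / 2 \<le> u x - \<epsilon> * \<psi> x"
            using \<epsilon>(2) by linarith
          then have "\<delta> / 2 \<le> m x"
            unfolding m_def by (rule max.coboundedI2)
          moreover have "\<epsilon> * \<psi> y \<le> \<phi> y"
            using True by (simp add: \<phi>_def v_def Z_def)
          ultimately have "\<delta> / 2 * (\<epsilon> * \<psi> y) \<le> m x * \<phi> y"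
            using \<delta> \<epsilon>(1) \<psi>0[of y] m\<phi> by (intro mult_mono) auto
          then show ?thesis using True by simp
        next
          case False
          have "0 \<le> m x * \<phi> y" using m\<phi> by simp
          then show ?thesis using False by (auto simp: indicator_def)
        qed
        have "\<delta> / 2 * \<epsilon> * j z = (indicator P x * indicator Z y * (\<delta> / 2 * (\<epsilon> * \<psi> y))) * k"
          by (simp add: j_def z k_def mult_ac)
        also have "\<dots> \<le> (m x * \<phi> y + m y * \<phi> x) * k"
          using 2 m\<phi> k by (intro mult_right_mono) (auto intro: add_increasing2)
        finally show ?thesis using 1 by linarith
      qed
      have \<phi>u: "u x * \<phi> x \<le> \<epsilon>\<^sup>2 * (\<psi> x)\<^sup>2" for x
      proof (cases "v x \<le> 0")
        case False
        then have "u x \<le> \<epsilon> * \<psi> x" "\<phi> x \<le> \<epsilon> * \<psi> x"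
          using nonneg[of x] by (auto simp: v_def \<phi>_def)
        then have "u x * \<phi> x \<le> (\<epsilon> * \<psi> x) * (\<epsilon> * \<psi> x)"
          using nonneg[of x] \<epsilon>(1) \<psi>0[of x] by (intro mult_mono) (auto simp: \<phi>_def)
        then show ?thesis by (simp add: power2_eq_square mult_ac)
      qed (simp add: \<phi>_def)
      have "- (M * energy s u \<phi>) = (LINT x|lborel. - (r x * u x * \<phi> x))"
        using maximizer_Euler_Lagrange[OF u \<phi>H r C] by simp
      also have "\<dots> \<le> (LINT x|lborel. C * (\<epsilon>\<^sup>2 * (\<psi> x)\<^sup>2))"
      proof (rule integral_mono)
        show "integrable lborel (\<lambda>x. - (r x * u x * \<phi> x))"
          using integrable_weighted_product[OF uH \<phi>H r C] by simp
        show "integrable lborel (\<lambda>x. C * (\<epsilon>\<^sup>2 * (\<psi> x)\<^sup>2))"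
          using borel_H0_square_integrable[OF \<psi>H] by simp
        fix x
        have "0 \<le> u x * \<phi> x" using nonneg[of x] by (simp add: \<phi>_def)
        then have "- r x * (u x * \<phi> x) \<le> C * (\<epsilon>\<^sup>2 * (\<psi> x)\<^sup>2)"
          using C[of x] \<phi>u[of x] C0 by - (rule mult_mono, auto)
        then show "- (r x * u x * \<phi> x) \<le> C * (\<epsilon>\<^sup>2 * (\<psi> x)\<^sup>2)"
          by (simp add: mult.assoc)
      qed
      finally have "- (M * energy s u \<phi>) \<le> C * (\<epsilon>\<^sup>2 * (LINT x|lborel. (\<psi> x)\<^sup>2))"
        by simp
      then have "- energy s u \<phi> \<le> \<epsilon>\<^sup>2 * (C / M * (LINT x|lborel. (\<psi> x)\<^sup>2))"
        using M by (simp add: field_simps)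
      then have F_le: "(LINT z|lborel. F z) \<le> \<epsilon>\<^sup>2 * D"
        using integrable_gagliardo_integrand[OF \<psi>H \<psi>H] integrable_gagliardo_integrand[OF uH \<phi>H]
        by (simp add: F_def[abs_def] D_def energy_def distrib_left)
      have "ennreal (\<delta> / 2 * \<epsilon>) * (\<integral>\<^sup>+z. ennreal (j z) \<partial>lborel) = (\<integral>\<^sup>+z. ennreal (\<delta> / 2 * \<epsilon> * j z) \<partial>lborel)"
      proof -
        have "(\<integral>\<^sup>+z. ennreal (\<delta> / 2 * \<epsilon> * j z) \<partial>lborel)
            = (\<integral>\<^sup>+z. ennreal (\<delta> / 2 * \<epsilon>) * ennreal (j z) \<partial>lborel)"
          using \<delta> \<epsilon>(1) by (intro nn_integral_cong ennreal_mult') simp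
        also have "\<dots> = ennreal (\<delta> / 2 * \<epsilon>) * (\<integral>\<^sup>+z. ennreal (j z) \<partial>lborel)"
          by (rule nn_integral_cmult) measurable
        finally show ?thesis ..
      qed
      also have "\<dots> \<le> (\<integral>\<^sup>+z. ennreal (F z) \<partial>lborel)"
        using jF by (intro nn_integral_mono ennreal_leI)
      also have "\<dots> = ennreal (LINT z|lborel. F z)"
      proof (rule nn_integral_eq_integral[OF Fint], rule AE_I2)
        fix z
        have "0 \<le> \<delta> / 2 * \<epsilon> * j z" using \<delta> \<epsilon>(1) j0[of z] by simp
        then show "0 \<le> F z" using jF[of z] by linarith
      qed
      also have "\<dots> \<le> ennreal (\<epsilon>\<^sup>2 * D)"
        using F_le by (rule ennreal_leI)
      finally show ?thesis .
    qed
    have "(\<integral>\<^sup>+z. ennreal (j z) \<partial>lborel) \<le> 0"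
    proof (rule ennreal_le_epsilon)
      fix \<eta> :: real assume \<eta>: "0 < \<eta>"
      \<comment> \<open>The second entry is chosen such that \<open>\<epsilon> * D \<le> \<eta> * \<delta> / 2\<close>.\<close>
      define \<epsilon> where "\<epsilon> = min (\<delta> / (2 * B)) (\<eta> * \<delta> / (2 * (D + 1)))"
      have \<epsilon>: "0 < \<epsilon>" using \<delta> B \<eta> D by (simp add: \<epsilon>_def)
      have "\<epsilon> * B \<le> \<delta> / (2 * B) * B"
        using B by (intro mult_right_mono) (auto simp: \<epsilon>_def)
      then have \<epsilon>B: "\<epsilon> * B \<le> \<delta> / 2"
        using B by simp
      have "\<epsilon> * D \<le> \<epsilon> * (D + 1)" using \<epsilon> by simp
      also have "\<dots> \<le> \<eta> * \<delta> / (2 * (D + 1)) * (D + 1)"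
        using D by (intro mult_right_mono) (auto simp: \<epsilon>_def)
      also have "\<dots> = \<eta> * \<delta> / 2" using D by (simp add: field_simps)
      finally have "\<epsilon>\<^sup>2 * D \<le> \<delta> / 2 * \<epsilon> * \<eta>"
        using mult_left_mono[of "\<epsilon> * D" "\<eta> * \<delta> / 2" \<epsilon>] \<epsilon> by (simp add: power2_eq_square mult_ac)
      then have "ennreal (\<epsilon>\<^sup>2 * D) \<le> ennreal (\<delta> / 2 * \<epsilon> * \<eta>)"
        by (rule ennreal_leI)
      also have "\<dots> = ennreal (\<delta> / 2 * \<epsilon>) * ennreal \<eta>"
        using \<delta> \<epsilon> by (intro ennreal_mult') simp
      finally have "ennreal (\<delta> / 2 * \<epsilon>) * (\<integral>\<^sup>+z. ennreal (j z) \<partial>lborel) \<le> ennreal (\<delta> / 2 * \<epsilon>) * ennreal \<eta>"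
        by (rule order_trans[OF scaled[OF \<epsilon> \<epsilon>B]])
      then have "(\<integral>\<^sup>+z. ennreal (j z) \<partial>lborel) \<le> ennreal \<eta>"
        using \<delta> \<epsilon> by (subst (asm) ennreal_mult_le_mult_iff) auto
      then show "(\<integral>\<^sup>+z. ennreal (j z) \<partial>lborel) \<le> 0 + ennreal \<eta>" by simp
    qed
    then have "AE z in lborel. j z = 0"
      using j0 by (simp add: nn_integral_0_iff_AE antisym)
    then have "AE z in lborel \<Otimes>\<^sub>M lborel. z \<notin> P \<times> Z"
      unfolding lborel_prod
    proof eventually_elim
      case (elim z)
      obtain x y where z: "z = (x, y)" by fastforce
      show ?case
      proof
        assume "z \<in> P \<times> Z"
        then have xy: "x \<in> P" "y \<in> Z" by (auto simp: z)
        then have "x \<noteq> y" using \<delta> by (auto simp: P_def Z_def)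
        then have "0 < riesz_kernel s (x - y)" by (intro riesz_kernel_pos) simp
        moreover have "0 < \<psi> y" using xy by (intro \<psi>_pos) (simp add: Z_def)
        ultimately show False using elim xy by (simp add: j_def z)
      qed
    qed
    then have "emeasure (lborel \<Otimes>\<^sub>M lborel) (P \<times> Z) = 0"
      by (subst (asm) AE_iff_measurable[of "P \<times> Z"]) (auto simp: space_pair_measure)
    then show ?thesis
      by (simp add: lborel.emeasure_pair_measure_Times P_def[symmetric])
  qed
  have "emeasure lborel Z = 0"
  proof (rule ccontr)
    assume "emeasure lborel Z \<noteq> 0"
    then have "emeasure lborel {x. 1 / real (Suc n) \<le> u x} = 0" for n
      using null[of "1 / real (Suc n)"] by auto
    then have "AE x in lborel. \<not> 1 / real (Suc n) \<le> u x" for n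
      by (subst AE_iff_measurable[of "{x. 1 / real (Suc n) \<le> u x}"]) auto
    then have "AE x in lborel. \<forall>n. \<not> 1 / real (Suc n) \<le> u x"
      by (simp add: AE_all_countable)
    then have "AE x in lborel. r x * u x * u x = 0"
    proof eventually_elim
      case (elim x)
      have "u x = 0"
      proof (rule ccontr)
        assume "u x \<noteq> 0"
        then have "0 < u x" using nonneg[of x] by simp
        then obtain n where "1 / real (Suc n) < u x"
          using nat_approx_posE by blast
        with elim show False by (meson less_imp_le)
      qed
      then show ?case by simp
    qed
    then have "(LINT x|lborel. r x * u x * u x) = 0"
      by (rule integral_eq_zero_AE)
    then show False
      using u M by (auto simp: maximizes_quotient_def)
  qed
  then have "AE x in lborel. x \<notin> Z"
    by (subst AE_iff_measurable[of Z]) auto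
  then show ?thesis
    by eventually_elim (use nonneg in \<open>auto simp: Z_def order_less_le\<close>)
qed

section \<open>Reflections\<close>

text \<open>Let \<open>B\<close> be the unit ball. Fubini's theorem and translation invariance give
  \<open>|f -` A| |B| = \<integral>\<integral> 1\<^sub>A(f x + y) 1\<^sub>B(y) dx dy = \<integral>\<integral> 1\<^sub>A(y) 1\<^sub>B(y - f x) dx dy\<close>. For fixed \<open>y\<close> the set of all
  \<open>x\<close> with \<open>y - f x \<in> B\<close> is the unit ball about \<open>f y\<close>, so the last integral is \<open>|A| |B|\<close>.\<close>

lemma emeasure_linear_isometric_involution:
  fixes f :: "'a::euclidean_space \<Rightarrow> 'a"
  assumes f: "linear f" and iso: "\<And>x. norm (f x) = norm x" and inv: "\<And>x. f (f x) = x"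
    and A [measurable]: "A \<in> sets borel"
  shows "emeasure lborel (f -` A) = emeasure lborel A"
proof -
  have "continuous_on UNIV f"
    using f by (simp add: linear_continuous_on linear_conv_bounded_linear)
  then have [measurable]: "f \<in> borel_measurable borel"
    by (rule borel_measurable_continuous_onI)
  define B where "B = ball (0::'a) 1"
  have [measurable]: "B \<in> sets borel" by (simp add: B_def)
  have shift: "(\<integral>\<^sup>+x. h (c + x) \<partial>lborel) = (\<integral>\<^sup>+x. h x \<partial>lborel)"
    if [measurable]: "h \<in> borel_measurable borel" for h :: "'a \<Rightarrow> ennreal" and c
    by (subst lborel_distr_plus[of c, symmetric], subst nn_integral_distr) auto
  have vol: "emeasure lborel (ball y 1) = emeasure lborel B" for y :: 'a
    by (simp add: B_def emeasure_ball)
  have fA: "f -` A \<in> sets borel"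
    using measurable_sets[of f borel borel A] by simp
  have "emeasure lborel (f -` A) * emeasure lborel B
      = (\<integral>\<^sup>+y. (\<integral>\<^sup>+x. indicator A (f x) * indicator B y \<partial>lborel) \<partial>lborel)"
  proof -
    have "(\<integral>\<^sup>+x. indicator A (f x) \<partial>lborel) = emeasure lborel (f -` A)"
      using nn_integral_indicator[of "f -` A" lborel] fA by (simp add: indicator_vimage)
    then show ?thesis
      by (simp add: nn_integral_multc nn_integral_cmult)
  qed
  also have "\<dots> = (\<integral>\<^sup>+y. (\<integral>\<^sup>+x. indicator A (f x + y) * indicator B y \<partial>lborel) \<partial>lborel)"
  proof (rule nn_integral_cong)
    fix y
    have "(\<integral>\<^sup>+x. indicator A (f x) * indicator B y \<partial>lborel)
        = (\<integral>\<^sup>+x. indicator A (f (f y + x)) * indicator B y \<partial>lborel)"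
      by (rule shift[symmetric]) measurable
    then show "(\<integral>\<^sup>+x. indicator A (f x) * indicator B y \<partial>lborel)
        = (\<integral>\<^sup>+x. indicator A (f x + y) * indicator B y \<partial>lborel)"
      by (simp add: linear_add[OF f] inv add.commute)
  qed
  also have "\<dots> = (\<integral>\<^sup>+x. (\<integral>\<^sup>+y. indicator A (f x + y) * indicator B y \<partial>lborel) \<partial>lborel)"
    by (rule lborel_pair.Fubini') measurable
  also have "\<dots> = (\<integral>\<^sup>+x. (\<integral>\<^sup>+y. indicator A y * indicator B (y - f x) \<partial>lborel) \<partial>lborel)"
  proof (rule nn_integral_cong)
    fix x
    show "(\<integral>\<^sup>+y. indicator A (f x + y) * indicator B y \<partial>lborel)
        = (\<integral>\<^sup>+y. indicator A y * indicator B (y - f x) \<partial>lborel)"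
      using shift[of "\<lambda>y. indicator A y * indicator B (y - f x)" "f x"] by simp
  qed
  also have "\<dots> = (\<integral>\<^sup>+y. (\<integral>\<^sup>+x. indicator A y * indicator B (y - f x) \<partial>lborel) \<partial>lborel)"
    by (rule lborel_pair.Fubini'[symmetric]) measurable
  also have "\<dots> = (\<integral>\<^sup>+y. indicator A y * emeasure lborel B \<partial>lborel)"
  proof (rule nn_integral_cong)
    fix y
    have "y - f x = f (f y - x)" for x
      by (simp add: linear_diff[OF f] inv)
    then have "indicator B (y - f x) = (indicator (ball (f y) 1) x :: ennreal)" for x
      by (simp add: B_def indicator_def iso dist_norm)
    then show "(\<integral>\<^sup>+x. indicator A y * indicator B (y - f x) \<partial>lborel) = indicator A y * emeasure lborel B"
      by (simp add: nn_integral_cmult_indicator vol)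
  qed
  also have "\<dots> = emeasure lborel A * emeasure lborel B"
    by (simp add: nn_integral_multc)
  finally have "emeasure lborel (f -` A) * emeasure lborel B = emeasure lborel A * emeasure lborel B" .
  moreover have "emeasure lborel B \<noteq> 0" "emeasure lborel B \<noteq> \<infinity>"
    using content_ball_pos[of 1 "0::'a"] emeasure_lborel_ball_finite[of "0::'a" 1]
    by (auto simp: B_def measure_def)
  ultimately show ?thesis
    by (metis mult_divide_eq_ennreal infinity_ennreal_def)
qed

text \<open>For a unit vector \<open>e\<close>, the reflection in the hyperplane of all \<open>x\<close> with \<open>e \<bullet> x = c\<close>.\<close>

definition reflect :: "'a::euclidean_space \<Rightarrow> real \<Rightarrow> 'a \<Rightarrow> 'a" where
  "reflect e c x = x - (2 * (e \<bullet> x - c)) *\<^sub>R e"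

context
  fixes e :: "'a::euclidean_space" and c :: real
  assumes e: "norm e = 1"
begin

lemma inner_normal [simp]: "e \<bullet> e = 1"
  using e by (simp add: dot_square_norm)

lemma inner_reflect: "e \<bullet> reflect e c x - c = - (e \<bullet> x - c)"
  by (simp add: reflect_def inner_diff_right algebra_simps)

lemma reflect_reflect [simp]: "reflect e c (reflect e c x) = x"
proof -
  have "reflect e c (reflect e c x) = reflect e c x - (2 * (e \<bullet> reflect e c x - c)) *\<^sub>R e"
    by (rule reflect_def)
  also have "\<dots> = reflect e c x + (2 * (e \<bullet> x - c)) *\<^sub>R e"
    unfolding inner_reflect by (simp only: mult_minus_right scaleR_minus_left diff_minus_eq_add)
  also have "\<dots> = x"
    by (simp add: reflect_def)
  finally show ?thesis .
qed

text \<open>This identity decides every comparison of distances: reflecting one of two points increases their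
  distance exactly if both lie strictly on the same side of the hyperplane.\<close>

lemma norm_reflect_diff_sq:
  "(norm (reflect e c x - y))\<^sup>2 = (norm (x - y))\<^sup>2 + 4 * (e \<bullet> x - c) * (e \<bullet> y - c)"
proof -
  define t where "t = e \<bullet> x - c"
  have "reflect e c x - y = (x - y) - (2 * t) *\<^sub>R e"
    by (simp add: reflect_def t_def)
  then have "(norm (reflect e c x - y))\<^sup>2 = (norm (x - y))\<^sup>2 - 4 * t * (e \<bullet> (x - y)) + 4 * t\<^sup>2"
    by (simp only: power2_norm_eq_inner)
      (simp add: inner_diff_left inner_diff_right power2_eq_square inner_commute algebra_simps)
  also have "e \<bullet> (x - y) = t - (e \<bullet> y - c)"
    by (simp add: t_def inner_diff_right)
  finally show ?thesis
    by (simp add: t_def power2_eq_square algebra_simps)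
qed

lemma norm_reflect_reflect: "norm (reflect e c x - reflect e c y) = norm (x - y)"
proof -
  have "(norm (reflect e c x - reflect e c y))\<^sup>2 = (norm (x - y))\<^sup>2"
    unfolding norm_reflect_diff_sq[of x "reflect e c y"] inner_reflect
      norm_minus_commute[of x "reflect e c y"] norm_reflect_diff_sq[of y x]
    by (simp add: norm_minus_commute algebra_simps)
  then show ?thesis by simp
qed

lemma norm_reflect_swap: "norm (reflect e c x - y) = norm (x - reflect e c y)"
  using norm_reflect_reflect[of x "reflect e c y"] by simp

lemma measurable_reflect [measurable]: "reflect e c \<in> borel_measurable borel"
  unfolding reflect_def[abs_def] by measurable

end

lemma distr_lborel_reflect:
  fixes e :: "'a::euclidean_space"
  assumes e: "norm e = 1"
  shows "distr lborel borel (reflect e c) = lborel"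
proof (rule measure_eqI)
  note [measurable] = measurable_reflect[OF e]
  fix A :: "'a set" assume "A \<in> sets (distr lborel borel (reflect e c))"
  then have A [measurable]: "A \<in> sets borel" by simp
  define f where "f = reflect e 0"
  have lin: "linear f"
    unfolding f_def reflect_def[abs_def]
    by (intro linearI) (simp_all add: inner_add_right algebra_simps scaleR_add_left)
  have f: "f (f x) = x" "norm (f x) = norm x" for x
    using reflect_reflect[OF e, of 0 x] norm_reflect_reflect[OF e, of 0 x 0]
    by (simp_all add: f_def) (simp add: reflect_def)
  have eq: "reflect e c x = (2 * c) *\<^sub>R e + f x" for x
    by (simp add: f_def reflect_def algebra_simps)
  have "emeasure (distr lborel borel (reflect e c)) A = emeasure lborel (reflect e c -` A)"
    by (subst emeasure_distr) auto
  also have "reflect e c -` A = f -` ((+) ((2 * c) *\<^sub>R e) -` A)"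
    by (auto simp: eq)
  also have "emeasure lborel \<dots> = emeasure lborel ((+) ((2 * c) *\<^sub>R e) -` A)"
  proof (rule emeasure_linear_isometric_involution[OF lin f(2) f(1)])
    show "(+) ((2 * c) *\<^sub>R e) -` A \<in> sets borel"
      using measurable_sets[of "(+) ((2 * c) *\<^sub>R e)" borel borel A] by simp
  qed
  also have "\<dots> = emeasure (distr lborel borel ((+) ((2 * c) *\<^sub>R e))) A"
    by (subst emeasure_distr) auto
  also have "\<dots> = emeasure lborel A"
    by (simp add: lborel_distr_plus)
  finally show "emeasure (distr lborel borel (reflect e c)) A = emeasure lborel A" .
qed simp

text \<open>Reflecting one of the two variables is a reflection of the product space, with normal vector
  \<open>(e, 0)\<close> or \<open>(0, e)\<close>.\<close>

lemma distr_lborel_reflect_pair: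
  fixes e :: "'a::euclidean_space"
  assumes e: "norm e = 1"
  shows "distr lborel borel (\<lambda>z. (reflect e c (fst z), snd z)) = (lborel :: ('a \<times> 'a) measure)"
    and "distr lborel borel (\<lambda>z. (fst z, reflect e c (snd z))) = (lborel :: ('a \<times> 'a) measure)"
proof -
  have "norm (e, 0 :: 'a) = 1" "norm (0 :: 'a, e) = 1"
    using e by (simp_all add: norm_Pair)
  then have "distr lborel borel (reflect (e, 0 :: 'a) c) = lborel" "distr lborel borel (reflect (0 :: 'a, e) c) = lborel"
    by (auto intro: distr_lborel_reflect)
  moreover have "reflect (e, 0 :: 'a) c = (\<lambda>z. (reflect e c (fst z), snd z))"
      "reflect (0 :: 'a, e) c = (\<lambda>z. (fst z, reflect e c (snd z)))"
    by (auto simp: reflect_def fun_eq_iff)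
  ultimately show "distr lborel borel (\<lambda>z. (reflect e c (fst z), snd z)) = (lborel :: ('a \<times> 'a) measure)"
      "distr lborel borel (\<lambda>z. (fst z, reflect e c (snd z))) = (lborel :: ('a \<times> 'a) measure)"
    by simp_all
qed

lemma integral_lborel_distr_invariant:
  fixes T :: "'a::euclidean_space \<Rightarrow> 'a" and h :: "'a \<Rightarrow> real"
  assumes T: "distr lborel borel T = lborel" "T \<in> borel_measurable borel" and h: "integrable lborel h"
  shows "integrable lborel (\<lambda>x. h (T x))" "(LINT x|lborel. h (T x)) = (LINT x|lborel. h x)"
proof -
  have "integrable (distr lborel borel T) h"
    using h T(1) by simp
  then show "integrable lborel (\<lambda>x. h (T x))"
    using T(2) h by (subst (asm) integrable_distr_eq) auto
  have "(LINT x|lborel. h x) = (LINT x|distr lborel borel T. h x)"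
    using T(1) by simp
  also have "\<dots> = (LINT x|lborel. h (T x))"
    using T(2) h by (intro integral_distr) auto
  finally show "(LINT x|lborel. h (T x)) = (LINT x|lborel. h x)" ..
qed

lemma AE_lborel_distr_invariant:
  fixes T :: "'a::euclidean_space \<Rightarrow> 'a"
  assumes T: "distr lborel borel T = lborel" "T \<in> borel_measurable borel"
    and P: "AE x in lborel. P x" "{x. P x} \<in> sets borel"
  shows "AE x in lborel. P (T x)"
proof -
  have "AE x in distr lborel borel T. P x"
    unfolding T(1) by (rule P(1))
  then show ?thesis
    using T(2) P(2) by (subst (asm) AE_distr_iff) auto
qed

section \<open>Polarization of functions\<close>

text \<open>The two-point rearrangement: of the two values on a pair of mirror points, the larger one is placed in
  the half-space of all \<open>x\<close> with \<open>c \<le> e \<bullet> x\<close>.\<close>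

definition polarize :: "'a::euclidean_space \<Rightarrow> real \<Rightarrow> ('a \<Rightarrow> real) \<Rightarrow> 'a \<Rightarrow> real" where
  "polarize e c u x = (if e \<bullet> x \<ge> c then max (u x) (u (reflect e c x)) else min (u x) (u (reflect e c x)))"

text \<open>The Gagliardo integrand summed over the four pairs obtained by reflecting one, both or none of the two
  points. Polarization permutes the values on each pair of mirror points, so the sums of \<open>u\<close> and of its
  polarization can be compared pointwise.\<close>

definition reflected_gagliardo ::
  "'a::euclidean_space \<Rightarrow> real \<Rightarrow> real \<Rightarrow> ('a \<Rightarrow> real) \<Rightarrow> 'a \<times> 'a \<Rightarrow> real" where
  "reflected_gagliardo e c s u z =
     gagliardo_integrand s u u (fst z, snd z)
     + gagliardo_integrand s u u (reflect e c (fst z), snd z)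
     + gagliardo_integrand s u u (fst z, reflect e c (snd z))
     + gagliardo_integrand s u u (reflect e c (fst z), reflect e c (snd z))"

definition reflection_gap :: "'a::euclidean_space \<Rightarrow> real \<Rightarrow> ('a \<Rightarrow> real) \<Rightarrow> 'a \<Rightarrow> real" where
  "reflection_gap e c u x = u x - u (reflect e c x)"

context
  fixes e :: "'a::euclidean_space" and c :: real
  assumes e: "norm e = 1"
begin

lemma measurable_polarize [measurable]:
  assumes [measurable]: "u \<in> borel_measurable borel"
  shows "polarize e c u \<in> borel_measurable borel"
proof -
  note [measurable] = measurable_reflect[OF e]
  show ?thesis unfolding polarize_def[abs_def] by measurable
qed

lemma reflect_on_hyperplane: "e \<bullet> x = c \<Longrightarrow> reflect e c x = x"
  by (simp add: reflect_def)

lemma integral_reflected_gagliardo: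
  assumes u [measurable]: "u \<in> borel_measurable borel" and int: "integrable lborel (gagliardo_integrand s u u)"
  shows "integrable lborel (reflected_gagliardo e c s u)"
    and "(LINT z|lborel. reflected_gagliardo e c s u z) = 4 * energy s u u"
proof -
  note [measurable] = measurable_reflect[OF e]
  have m1: "(\<lambda>z::'a \<times> 'a. (reflect e c (fst z), snd z)) \<in> borel_measurable borel"
    and m2: "(\<lambda>z::'a \<times> 'a. (fst z, reflect e c (snd z))) \<in> borel_measurable borel"
    by (simp_all add: borel_prod[symmetric])
  note r1 = integral_lborel_distr_invariant[OF distr_lborel_reflect_pair(1)[OF e] m1]
  note r2 = integral_lborel_distr_invariant[OF distr_lborel_reflect_pair(2)[OF e] m2]
  note i = r1[OF int] r2[OF int] r2[OF r1(1)[OF int]]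
  show "integrable lborel (reflected_gagliardo e c s u)"
    unfolding reflected_gagliardo_def[abs_def] using int i(1,3,5) by simp
  show "(LINT z|lborel. reflected_gagliardo e c s u z) = 4 * energy s u u"
    unfolding reflected_gagliardo_def energy_def using int i by simp
qed

lemma polarize_sum: "polarize e c u x + polarize e c u (reflect e c x) = u x + u (reflect e c x)"
proof -
  have "e \<bullet> reflect e c x \<ge> c \<longleftrightarrow> e \<bullet> x \<le> c" "e \<bullet> x = c \<Longrightarrow> reflect e c x = x"
    using inner_reflect[OF e, of c x] by (auto simp: reflect_def)
  then show ?thesis
    by (cases "e \<bullet> x = c") (auto simp: polarize_def reflect_reflect[OF e] max_def min_def)
qed

lemma reflection_gap_polarize:
  "reflection_gap e c (polarize e c u) x = sgn (e \<bullet> x - c) * \<bar>reflection_gap e c u x\<bar>"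
proof -
  have "e \<bullet> reflect e c x \<ge> c \<longleftrightarrow> e \<bullet> x \<le> c" "e \<bullet> x = c \<Longrightarrow> reflect e c x = x"
    using inner_reflect[OF e, of c x] by (auto simp: reflect_def)
  then show ?thesis
    by (cases "e \<bullet> x = c")
      (auto simp: polarize_def reflection_gap_def reflect_reflect[OF e] max_def min_def sgn_if)
qed

text \<open>In terms of the sums \<open>a\<close>, \<open>b\<close> and the gaps \<open>p\<close>, \<open>q\<close> of the two pairs of values. Polarization
  preserves \<open>a\<close>, \<open>b\<close>, \<open>p\<^sup>2\<close> and \<open>q\<^sup>2\<close>; only the sign of \<open>p q\<close> can change.\<close>

lemma reflected_gagliardo_eq:
  fixes u s x y
  defines "a \<equiv> u x + u (reflect e c x)" and "b \<equiv> u y + u (reflect e c y)"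
    and "k \<equiv> riesz_kernel s (x - y)" and "k' \<equiv> riesz_kernel s (reflect e c x - y)"
    and "p \<equiv> reflection_gap e c u x" and "q \<equiv> reflection_gap e c u y"
  shows "reflected_gagliardo e c s u (x, y)
     = (k + k') * ((a\<^sup>2 + p\<^sup>2 + b\<^sup>2 + q\<^sup>2) / 2 - a * b) - (k - k') * (p * q)"
proof -
  have k: "riesz_kernel s (reflect e c x - reflect e c y) = k"
      "riesz_kernel s (x - reflect e c y) = k'"
    unfolding k_def k'_def
    by (rule riesz_kernel_cong[OF norm_reflect_reflect[OF e]],
        rule riesz_kernel_cong[OF norm_reflect_swap[OF e, symmetric]])
  have u: "u x = (a + p) / 2" "u (reflect e c x) = (a - p) / 2"
      "u y = (b + q) / 2" "u (reflect e c y) = (b - q) / 2"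
    by (simp_all add: a_def b_def p_def q_def reflection_gap_def)
  have "reflected_gagliardo e c s u (x, y)
     = (u x - u y)\<^sup>2 * k + (u (reflect e c x) - u y)\<^sup>2 * k'
       + (u x - u (reflect e c y))\<^sup>2 * k' + (u (reflect e c x) - u (reflect e c y))\<^sup>2 * k"
    unfolding reflected_gagliardo_def gagliardo_integrand_diag fst_conv snd_conv k
    by (simp add: k_def k'_def)
  then show ?thesis
    unfolding u by (simp add: power2_eq_square field_simps)
qed

lemma reflected_gagliardo_polarize:
  fixes u s x y
  defines "k \<equiv> riesz_kernel s (x - y)" and "k' \<equiv> riesz_kernel s (reflect e c x - y)"
    and "p \<equiv> reflection_gap e c u x" and "q \<equiv> reflection_gap e c u y"
  shows "reflected_gagliardo e c s u (x, y) - reflected_gagliardo e c s (polarize e c u) (x, y)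
     = (k - k') * (sgn ((e \<bullet> x - c) * (e \<bullet> y - c)) * \<bar>p * q\<bar> - p * q)"
proof -
  have z: "e \<bullet> x = c \<longrightarrow> p = 0" "e \<bullet> y = c \<longrightarrow> q = 0"
    by (auto simp: p_def q_def reflection_gap_def reflect_on_hyperplane)
  have sq: "(sgn (e \<bullet> x - c) * \<bar>p\<bar>)\<^sup>2 = p\<^sup>2" "(sgn (e \<bullet> y - c) * \<bar>q\<bar>)\<^sup>2 = q\<^sup>2"
    using z by (auto simp: power_mult_distrib sgn_if)
  show ?thesis
    unfolding reflected_gagliardo_eq polarize_sum reflection_gap_polarize
    unfolding k_def[symmetric] k'_def[symmetric] p_def[symmetric] q_def[symmetric] sq
      sgn_mult abs_mult
    by (simp add: algebra_simps)
qed

text \<open>If \<open>x\<close> and \<open>y\<close> lie on the same side, then \<open>x\<close> is closer to \<open>y\<close> than its mirror image is, hence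
  \<open>k' \<le> k\<close>, and the polarized gaps have a nonnegative product. On opposite sides both signs
  are reversed. The pairs at which one of the kernels is evaluated at the origin are treated apart.\<close>

lemma reflected_gagliardo_polarize_le:
  assumes "0 < s"
  shows "reflected_gagliardo e c s (polarize e c u) (x, y) \<le> reflected_gagliardo e c s u (x, y)"
proof -
  define k k' where "k = riesz_kernel s (x - y)" and "k' = riesz_kernel s (reflect e c x - y)"
  define p q where "p = reflection_gap e c u x" and "q = reflection_gap e c u y"
  define t where "t = (e \<bullet> x - c) * (e \<bullet> y - c)"
  have n: "(norm (reflect e c x - y))\<^sup>2 = (norm (x - y))\<^sup>2 + 4 * t"
    using norm_reflect_diff_sq[OF e, of c x y] by (simp add: t_def mult.assoc)
  have "0 \<le> (k - k') * (sgn t * \<bar>p * q\<bar> - p * q)"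
  proof (cases t "0::real" rule: linorder_cases)
    case equal
    then have "e \<bullet> x = c \<or> e \<bullet> y = c"
      by (simp add: t_def)
    then have "p * q = 0"
      by (elim disjE) (simp_all add: p_def q_def reflection_gap_def reflect_on_hyperplane)
    then show ?thesis by auto
  next
    case greater
    then have nn: "norm (x - y) \<le> norm (reflect e c x - y)"
      using n by (intro power2_le_imp_le[of "norm (x - y)"]) auto
    show ?thesis
    \<comment> \<open>For \<open>x = y\<close> the kernel \<open>k\<close> is evaluated at the origin, where it is zero; but then \<open>p = q\<close>.\<close>
    proof (cases "x = y")
      case True
      then show ?thesis using greater by (simp add: p_def q_def)
    next
      case False
      then have "k' \<le> k"
        unfolding k_def k'_def using nn \<open>0 < s\<close> by (intro riesz_kernel_antimono) auto
      then show ?thesis using greater by (intro mult_nonneg_nonneg) auto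
    qed
  next
    case less
    then have nn: "norm (reflect e c x - y) \<le> norm (x - y)"
      using n by (intro power2_le_imp_le[of "norm (reflect e c x - y)"]) auto
    show ?thesis
    \<comment> \<open>Likewise \<open>k'\<close> is zero if \<open>y\<close> is the mirror image of \<open>x\<close>; but then \<open>q = - p\<close>.\<close>
    proof (cases "reflect e c x = y")
      case True
      then have "q = - p"
        by (auto simp: p_def q_def reflection_gap_def reflect_reflect[OF e])
      then show ?thesis using less by simp
    next
      case False
      then have "k \<le> k'"
        unfolding k_def k'_def using nn \<open>0 < s\<close> by (intro riesz_kernel_antimono) auto
      then show ?thesis
        using less by (intro mult_nonpos_nonpos) auto
    qed
  qed
  then show ?thesis
    using reflected_gagliardo_polarize[of s u x y] by (simp add: k_def k'_def p_def q_def t_def)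
qed

text \<open>Strict monotonicity of the kernel makes the inequality rigid: no loss of energy at a pair of points on
  the same side means that the two gaps had compatible signs from the start.\<close>

lemma reflected_gagliardo_polarize_eq:
  assumes "0 < s" and x: "c < e \<bullet> x" and y: "c < e \<bullet> y"
    and eq: "reflected_gagliardo e c s (polarize e c u) (x, y) = reflected_gagliardo e c s u (x, y)"
  shows "0 \<le> reflection_gap e c u x * reflection_gap e c u y"
proof (cases "x = y")
  case False
  have pos: "0 < (e \<bullet> x - c) * (e \<bullet> y - c)"
    using x y by simp
  have "(norm (x - y))\<^sup>2 < (norm (reflect e c x - y))\<^sup>2"
    using norm_reflect_diff_sq[OF e, of c x y, unfolded mult.assoc] pos by linarith
  then have "norm (x - y) < norm (reflect e c x - y)"
    by (rule power2_less_imp_less) simp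
  then have "riesz_kernel s (reflect e c x - y) < riesz_kernel s (x - y)"
    using False \<open>0 < s\<close> by (intro riesz_kernel_strict_antimono) auto
  then have "\<bar>reflection_gap e c u x * reflection_gap e c u y\<bar> = reflection_gap e c u x * reflection_gap e c u y"
    using reflected_gagliardo_polarize[of s u x y] eq pos by simp
  then show ?thesis
    by (metis abs_ge_zero)
qed simp

end

context
  fixes e x0 :: "'a::euclidean_space" and c R :: real
  assumes e: "norm e = 1" and x0: "c < e \<bullet> x0"
begin

lemma reflect_moves_away_from_center:
  assumes "c \<le> e \<bullet> x"
  shows "norm (x - x0) \<le> norm (reflect e c x - x0)"
proof (rule power2_le_imp_le)
  show "(norm (x - x0))\<^sup>2 \<le> (norm (reflect e c x - x0))\<^sup>2"
    using norm_reflect_diff_sq[OF e, of c x x0] assms x0 by simp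
qed simp

lemma reflect_moves_towards_center:
  assumes "e \<bullet> x \<le> c"
  shows "norm (reflect e c x - x0) \<le> norm (x - x0)"
proof -
  have "c \<le> e \<bullet> reflect e c x"
    using inner_reflect[OF e, of c x] assms by linarith
  from reflect_moves_away_from_center[OF this] show ?thesis
    by (simp add: reflect_reflect[OF e])
qed

text \<open>The integrals of the two sums over the product space are four times the energies. The last claim is the
  equality case.\<close>

lemma polarize_borel_H0:
  assumes s: "0 < s" and u: "u \<in> borel_H0 s (ball x0 R)" and nonneg: "\<And>x. 0 \<le> u x"
  shows "polarize e c u \<in> borel_H0 s (ball x0 R)"
    and "energy s (polarize e c u) (polarize e c u) \<le> energy s u u"
    and "energy s (polarize e c u) (polarize e c u) = energy s u u \<Longrightarrow>
      (AE z in lborel. c < e \<bullet> fst z \<and> c < e \<bullet> snd z \<longrightarrow>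
         0 \<le> (u (fst z) - u (reflect e c (fst z))) * (u (snd z) - u (reflect e c (snd z))))"
proof -
  note [measurable] = borel_H0_measurable[OF u] measurable_reflect[OF e]
  have P [measurable]: "polarize e c u \<in> borel_measurable borel"
    by (rule measurable_polarize[OF e borel_H0_measurable[OF u]])
  have "polarize e c u x = 0" if x: "x \<notin> ball x0 R" for x
  proof (cases "c \<le> e \<bullet> x")
    case True
    then have "reflect e c x \<notin> ball x0 R"
      using reflect_moves_away_from_center[OF True] x by (auto simp: dist_norm norm_minus_commute)
    then show ?thesis
      using True x by (simp add: polarize_def borel_H0_outside[OF u])
  next
    case False
    then show ?thesis
      using nonneg[of "reflect e c x"] x by (simp add: polarize_def borel_H0_outside[OF u])
  qed
  moreover have "integrable lborel (\<lambda>x. (polarize e c u x)\<^sup>2)"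
  proof (rule Bochner_Integration.integrable_bound)
    show "integrable lborel (\<lambda>x. (u x)\<^sup>2 + (u (reflect e c x))\<^sup>2)"
      using borel_H0_square_integrable[OF u]
        integral_lborel_distr_invariant(1)[OF distr_lborel_reflect[OF e] measurable_reflect[OF e]
          borel_H0_square_integrable[OF u]] by simp
    have "(polarize e c u x)\<^sup>2 \<le> (u x)\<^sup>2 + (u (reflect e c x))\<^sup>2" for x
      by (auto simp: polarize_def max_def min_def)
    then show "AE x in lborel. norm ((polarize e c u x)\<^sup>2) \<le> norm ((u x)\<^sup>2 + (u (reflect e c x))\<^sup>2)"
      by (intro AE_I2) (auto intro: order_trans[OF _ abs_ge_self])
  qed measurable
  moreover
  have G: "integrable lborel (reflected_gagliardo e c s u)"
      "(LINT z|lborel. reflected_gagliardo e c s u z) = 4 * energy s u u"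
    using integral_reflected_gagliardo[OF e borel_H0_measurable[OF u] borel_H0_gagliardo_integrable[OF u]] by auto
  have le: "reflected_gagliardo e c s (polarize e c u) z \<le> reflected_gagliardo e c s u z" for z
    using reflected_gagliardo_polarize_le[OF e s, of c u "fst z" "snd z"] by simp
  have "integrable lborel (gagliardo_integrand s (polarize e c u) (polarize e c u))"
  proof (rule Bochner_Integration.integrable_bound[OF G(1)])
    have "gagliardo_integrand s (polarize e c u) (polarize e c u) z \<le> reflected_gagliardo e c s u z" for z
      using le[of z] gagliardo_integrand_diag_nonneg[of s "polarize e c u"]
      unfolding reflected_gagliardo_def[of e c s "polarize e c u"] prod.collapse
      by (smt (verit, ccfv_threshold))
    then show "AE z in lborel. norm (gagliardo_integrand s (polarize e c u) (polarize e c u) z)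
        \<le> norm (reflected_gagliardo e c s u z)"
      using gagliardo_integrand_diag_nonneg[of s "polarize e c u"]
      by (intro AE_I2) (auto intro: order_trans[OF _ abs_ge_self])
  qed measurable
  ultimately show PH: "polarize e c u \<in> borel_H0 s (ball x0 R)"
    by (auto simp: borel_H0_def)
  have GP: "integrable lborel (reflected_gagliardo e c s (polarize e c u))"
      "(LINT z|lborel. reflected_gagliardo e c s (polarize e c u) z)
        = 4 * energy s (polarize e c u) (polarize e c u)"
    using integral_reflected_gagliardo[OF e P borel_H0_gagliardo_integrable[OF PH]] by auto
  show "energy s (polarize e c u) (polarize e c u) \<le> energy s u u"
    using integral_mono[OF GP(1) G(1) le] G(2) GP(2) by simp
  assume eq: "energy s (polarize e c u) (polarize e c u) = energy s u u"
  have "AE z in lborel. reflected_gagliardo e c s u z - reflected_gagliardo e c s (polarize e c u) z = 0"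
  proof (subst integral_nonneg_eq_0_iff_AE[symmetric])
    show "integrable lborel (\<lambda>z. reflected_gagliardo e c s u z - reflected_gagliardo e c s (polarize e c u) z)"
      using G GP by simp
    show "AE z in lborel. 0 \<le> reflected_gagliardo e c s u z - reflected_gagliardo e c s (polarize e c u) z"
      using le by simp
    show "(LINT z|lborel. reflected_gagliardo e c s u z - reflected_gagliardo e c s (polarize e c u) z) = 0"
      using G GP eq by simp
  qed
  then show "AE z in lborel. c < e \<bullet> fst z \<and> c < e \<bullet> snd z \<longrightarrow>
         0 \<le> (u (fst z) - u (reflect e c (fst z))) * (u (snd z) - u (reflect e c (snd z)))"
  proof eventually_elim
    case (elim z)
    then show ?case
      using reflected_gagliardo_polarize_eq[OF e s, of c "fst z" "snd z" u]
      by (simp add: reflection_gap_def)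
  qed
qed

text \<open>By the equality case the gap \<open>d\<close> has a constant sign almost everywhere in the half-space. It cannot be
  nonpositive: as the centre lies in the open half-space, the reflection moves a nonempty open part \<open>V\<close> of
  the ball outside the ball, and on \<open>V\<close> the function is positive while it vanishes at the mirror points.\<close>

lemma polarize_fixes_if_energy_preserved:
  assumes s: "0 < s" and R: "0 < R" and u: "u \<in> borel_H0 s (ball x0 R)" and nonneg: "\<And>x. 0 \<le> u x"
    and pos: "AE x in lborel. x \<in> ball x0 R \<longrightarrow> 0 < u x"
    and eq: "energy s (polarize e c u) (polarize e c u) = energy s u u"
  shows "AE x in lborel. polarize e c u x = u x"
proof -
  note [measurable] = borel_H0_measurable[OF u] measurable_reflect[OF e]
  define d where "d x = u x - u (reflect e c x)" for x
  have [measurable]: "d \<in> borel_measurable borel" unfolding d_def[abs_def] by measurable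
  define A where "A = {x. c < e \<bullet> x \<and> 0 < d x}"
  define A' where "A' = {x. c < e \<bullet> x \<and> d x < 0}"
  have [measurable]: "A \<in> sets borel" "A' \<in> sets borel"
    unfolding A_def A'_def by measurable
  have "AE z in lborel \<Otimes>\<^sub>M lborel. z \<notin> A \<times> A'"
    unfolding lborel_prod using polarize_borel_H0(3)[OF s u nonneg eq]
  proof eventually_elim
    case (elim z)
    show ?case
    proof
      assume "z \<in> A \<times> A'"
      then have "c < e \<bullet> fst z" "c < e \<bullet> snd z" "0 < d (fst z)" "d (snd z) < 0"
        by (auto simp: A_def A'_def)
      then have "d (fst z) * d (snd z) < 0" "0 \<le> d (fst z) * d (snd z)"
        using elim by (auto simp: d_def mult_pos_neg)
      then show False by simp
    qed
  qed
  then have "emeasure (lborel \<Otimes>\<^sub>M lborel) (A \<times> A') = 0"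
    by (subst (asm) AE_iff_measurable[of "A \<times> A'"]) (auto simp: space_pair_measure)
  then have "emeasure lborel A = 0 \<or> emeasure lborel A' = 0"
    by (simp add: lborel.emeasure_pair_measure_Times)
  moreover have "emeasure lborel A \<noteq> 0"
  proof
    \<comment> \<open>The part of the ball that the reflection moves outside the closed ball.\<close>
    define V where "V = {x. c < e \<bullet> x} \<inter> ball x0 R \<inter> (\<lambda>x. reflect e c x) -` (- cball x0 R)"
    have "continuous_on UNIV (\<lambda>x. reflect e c x)"
      unfolding reflect_def[abs_def] by (intro continuous_intros)
    then have "open V"
      unfolding V_def by (intro open_Int open_vimage open_ball open_Compl closed_cball)
        (simp_all add: open_halfspace_gt)
    \<comment> \<open>The point of \<open>V\<close> is chosen on the normal through the centre: its distance \<open>t\<close> from the centre is less than \<open>R\<close>,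
      and the distance \<open>t + 2 * h\<close> of its mirror image is larger than \<open>R\<close>.\<close>
    define h where "h = e \<bullet> x0 - c"
    define t where "t = max (R - h) (R / 2)"
    have h: "0 < h" using x0 by (simp add: h_def)
    have t: "0 < t" "t < R" "R < t + 2 * h" using R h by (auto simp: t_def max_def)
    have ee: "e \<bullet> e = 1" using e by (simp add: dot_square_norm)
    define y where "y = x0 + t *\<^sub>R e"
    have y1: "e \<bullet> y - c = h + t" by (simp add: y_def h_def inner_add_right ee)
    have "reflect e c y - x0 = (t - 2 * (h + t)) *\<^sub>R e"
      unfolding reflect_def y1 unfolding y_def by (simp only: scaleR_left_diff_distrib) simp
    then have "norm (reflect e c y - x0) = t + 2 * h"
      using t h e by simp
    moreover have "norm (y - x0) = t"
      using t e by (simp add: y_def)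
    ultimately have "y \<in> V"
      using t h y1 by (auto simp: V_def dist_norm norm_minus_commute)
    assume "emeasure lborel A = 0"
    then have "AE x in lborel. x \<notin> A"
      by (subst AE_iff_measurable[of A]) auto
    then have "AE x in lborel. x \<in> - V"
      using pos
    proof eventually_elim
      case (elim x)
      show ?case
      proof
        assume "x \<in> V"
        then have "0 < u x" "u (reflect e c x) = 0" "c < e \<bullet> x"
          using elim borel_H0_outside[OF u, of "reflect e c x"] by (auto simp: V_def)
        then show False using elim by (simp add: A_def d_def)
      qed
    qed
    then have "AE x in lebesgue. x \<in> - V"
      by (rule AE_completion)
    then have "y \<in> - V"
      using \<open>open V\<close> by (intro mem_closed_if_AE_lebesgue) auto
    then show False
      using \<open>y \<in> V\<close> by simp
  qed
  ultimately have "emeasure lborel A' = 0" by blast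
  then have A': "AE x in lborel. x \<notin> A'"
    by (subst AE_iff_measurable[of A']) auto
  have "AE x in lborel. reflect e c x \<notin> A'"
  proof (rule AE_lborel_distr_invariant[OF distr_lborel_reflect[OF e] measurable_reflect[OF e] A'])
    show "{x. x \<notin> A'} \<in> sets borel" by measurable
  qed
  with A' show ?thesis
  proof eventually_elim
    case (elim x)
    have "c < e \<bullet> reflect e c x \<longleftrightarrow> e \<bullet> x < c"
      using inner_reflect[OF e, of c x] by linarith
    moreover have "e \<bullet> x = c \<Longrightarrow> reflect e c x = x"
      by (simp add: reflect_def)
    ultimately show ?case
      using elim by (cases "e \<bullet> x" c rule: linorder_cases)
        (auto simp: A'_def d_def polarize_def reflect_reflect[OF e])
  qed
qed

end

section \<open>Polarization of weights\<close>

text \<open>A pair of mirror points is affected only if both points belong to \<open>\<Omega>\<close>: the value \<open>0\<close> outside \<open>\<Omega>\<close> must not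
  be mixed with the values of the weight, which may be negative.\<close>

definition polarize_in ::
  "'a::euclidean_space set \<Rightarrow> 'a \<Rightarrow> real \<Rightarrow> ('a \<Rightarrow> real) \<Rightarrow> 'a \<Rightarrow> real" where
  "polarize_in \<Omega> e c r x = (if x \<in> \<Omega> \<and> reflect e c x \<in> \<Omega> then polarize e c r x else r x)"

text \<open>The rearrangement inequality for two pairs of numbers.\<close>

lemma max_min_product_ge:
  fixes a a' b b' :: real
  assumes "0 \<le> b" "0 \<le> b'"
  shows "a * b * b + a' * b' * b' \<le> max a a' * max b b' * max b b' + min a a' * min b b' * min b b'"
proof -
  have "0 \<le> (a - a') * (b' * b' - b * b)" if "a' \<le> a" "b \<le> b'" "0 \<le> b" "0 \<le> b'"
    for a a' b b' :: real
    using that by (intro mult_nonneg_nonneg) (auto intro: mult_mono)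
  from this[of a' a b b'] this[of a a' b' b] assms show ?thesis
    by (auto simp: max_def min_def algebra_simps)
qed

lemma polarize_in_properties:
  assumes e: "norm e = 1" and \<Omega> [measurable]: "\<Omega> \<in> sets borel" and r [measurable]: "r \<in> borel_measurable borel"
    and C: "\<And>x. \<bar>r x\<bar> \<le> C" and out: "\<And>x. x \<notin> \<Omega> \<Longrightarrow> r x = 0"
  shows "polarize_in \<Omega> e c r \<in> borel_measurable borel"
    and "\<And>x. \<bar>polarize_in \<Omega> e c r x\<bar> \<le> C"
    and "\<And>x. x \<notin> \<Omega> \<Longrightarrow> polarize_in \<Omega> e c r x = 0"
proof -
  note [measurable] = measurable_reflect[OF e] measurable_polarize[OF e r]
  show "polarize_in \<Omega> e c r \<in> borel_measurable borel"
    unfolding polarize_in_def[abs_def] by measurable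
  show "\<bar>polarize_in \<Omega> e c r x\<bar> \<le> C" for x
    using C[of x] C[of "reflect e c x"] by (auto simp: polarize_in_def polarize_def max_def min_def)
  show "x \<notin> \<Omega> \<Longrightarrow> polarize_in \<Omega> e c r x = 0" for x
    using out by (simp add: polarize_in_def)
qed

text \<open>The polarized weight is \<open>r \<circ> \<theta>\<close>, where \<open>\<theta>\<close> is the reflection on the set \<open>T\<close> of points whose pair is in the
  wrong order and the identity elsewhere. As \<open>T\<close> is symmetric, \<open>\<theta>\<close> preserves the measure.\<close>

lemma polarize_in_equimeasurable:
  assumes e: "norm e = 1" and \<Omega> [measurable]: "\<Omega> \<in> sets borel" and r [measurable]: "r \<in> borel_measurable borel"
  shows "emeasure lborel {x \<in> \<Omega>. t < polarize_in \<Omega> e c r x} = emeasure lborel {x \<in> \<Omega>. t < r x}"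
proof -
  note [measurable] = measurable_reflect[OF e]
  define T where "T = {x \<in> \<Omega>. reflect e c x \<in> \<Omega> \<and>
     (if c \<le> e \<bullet> x then r x < r (reflect e c x) else r (reflect e c x) < r x)}"
  define L where "L = {x \<in> \<Omega>. t < r x}"
  have [measurable]: "T \<in> sets borel" "L \<in> sets borel"
    unfolding T_def L_def by measurable
  have T_iff: "reflect e c x \<in> T \<longleftrightarrow> x \<in> T" for x
  proof -
    have "c \<le> e \<bullet> reflect e c x \<longleftrightarrow> e \<bullet> x \<le> c" "e \<bullet> x = c \<Longrightarrow> reflect e c x = x"
      using inner_reflect[OF e, of c x] by (auto simp: reflect_def)
    then show ?thesis
      by (cases "e \<bullet> x" c rule: linorder_cases) (auto simp: T_def reflect_reflect[OF e])
  qed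
  have val: "polarize_in \<Omega> e c r x = (if x \<in> T then r (reflect e c x) else r x)" if "x \<in> \<Omega>" for x
    using that by (auto simp: polarize_in_def polarize_def T_def max_def min_def)
  have refl_meas: "reflect e c -` (L \<inter> T) \<in> sets borel"
    using measurable_sets[OF measurable_reflect[OF e], of "L \<inter> T" c] by simp
  have "{x \<in> \<Omega>. t < polarize_in \<Omega> e c r x} = (L - T) \<union> reflect e c -` (L \<inter> T)"
  proof (rule set_eqI)
    fix x
    have TO: "x \<in> T \<Longrightarrow> x \<in> \<Omega> \<and> reflect e c x \<in> \<Omega>"
      by (simp add: T_def)
    show "x \<in> {x \<in> \<Omega>. t < polarize_in \<Omega> e c r x} \<longleftrightarrow> x \<in> (L - T) \<union> reflect e c -` (L \<inter> T)"
    proof (cases "x \<in> T")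
      case True
      then show ?thesis using TO val[of x] T_iff[of x] by (simp add: L_def)
    next
      case False
      then show ?thesis using val[of x] T_iff[of x] by (simp add: L_def conj_commute cong: conj_cong)
    qed
  qed
  then have "emeasure lborel {x \<in> \<Omega>. t < polarize_in \<Omega> e c r x}
      = emeasure lborel (L - T) + emeasure lborel (reflect e c -` (L \<inter> T))"
    using T_iff refl_meas by (simp add: plus_emeasure[symmetric] disjoint_iff)
  also have "emeasure lborel (reflect e c -` (L \<inter> T)) = emeasure (distr lborel borel (reflect e c)) (L \<inter> T)"
    by (subst emeasure_distr) auto
  also have "\<dots> = emeasure lborel (L \<inter> T)"
    by (simp add: distr_lborel_reflect[OF e])
  also have "emeasure lborel (L - T) + emeasure lborel (L \<inter> T) = emeasure lborel L"
    by (subst plus_emeasure) (auto intro: arg_cong[where f = "emeasure lborel"])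
  finally show ?thesis by (simp add: L_def)
qed

text \<open>The difference \<open>f\<close> of the integrands satisfies \<open>0 \<le> f x + f (reflect e c x)\<close> at every pair of mirror
  points. If both points belong to the ball, this is the rearrangement inequality. If only one of them does,
  it lies in the half-space, and polarization changes neither the weight nor the function at the pair.\<close>

lemma weighted_integral_polarize_le:
  fixes e x0 :: "'a::euclidean_space"
  assumes e: "norm e = 1" and x0: "c < e \<bullet> x0" and s: "0 < s"
    and u: "u \<in> borel_H0 s (ball x0 R)" and nonneg: "\<And>x. 0 \<le> u x"
    and r [measurable]: "r \<in> borel_measurable borel" and C: "\<And>x. \<bar>r x\<bar> \<le> C"
    and out: "\<And>x. x \<notin> ball x0 R \<Longrightarrow> r x = 0"
  shows "(LINT x|lborel. r x * u x * u x)
    \<le> (LINT x|lborel. polarize_in (ball x0 R) e c r x * polarize e c u x * polarize e c u x)"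
proof -
  define q where "q = polarize_in (ball x0 R) e c r"
  define v where "v = polarize e c u"
  have vH: "v \<in> borel_H0 s (ball x0 R)"
    unfolding v_def by (rule polarize_borel_H0(1)[OF e x0 s u nonneg])
  have q: "q \<in> borel_measurable borel" "\<And>x. \<bar>q x\<bar> \<le> C" "\<And>x. x \<notin> ball x0 R \<Longrightarrow> q x = 0"
    unfolding q_def using polarize_in_properties[OF e borel_open[OF open_ball] r C out] by auto
  define f where "f x = q x * v x * v x - r x * u x * u x" for x
  have int: "integrable lborel (\<lambda>x. q x * v x * v x)" "integrable lborel (\<lambda>x. r x * u x * u x)"
    using integrable_weighted_product[OF vH vH q(1,2)] integrable_weighted_product[OF u u r C] by auto
  then have fint: "integrable lborel f"
    unfolding f_def[abs_def] by simp
  have key: "0 \<le> f x + f (reflect e c x)" if x: "c \<le> e \<bullet> x" for x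
  proof -
    define y where "y = reflect e c x"
    have yx: "reflect e c y = x" by (simp add: y_def reflect_reflect[OF e])
    have ey: "e \<bullet> y - c = - (e \<bullet> x - c)"
      by (simp add: y_def inner_reflect[OF e])
    have far: "norm (x - x0) \<le> norm (y - x0)"
      unfolding y_def by (rule reflect_moves_away_from_center[OF e x0 x])
    show ?thesis
    proof (cases "e \<bullet> x = c")
      case True
      then have "y = x" by (simp add: y_def reflect_def)
      then have "f x = 0"
        using True by (auto simp: f_def q_def v_def polarize_in_def polarize_def simp flip: y_def)
      then show ?thesis using \<open>y = x\<close> by (simp add: y_def[symmetric])
    next
      case False
      then have ex: "c \<le> e \<bullet> x" "\<not> c \<le> e \<bullet> y" using x ey by auto
      have v_eq: "v x = max (u x) (u y)" "v y = min (u y) (u x)"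
        using ex by (auto simp: v_def polarize_def yx simp flip: y_def)
      show ?thesis
      proof (cases "y \<in> ball x0 R")
        case True
        then have "x \<in> ball x0 R"
          using far by (auto simp: dist_norm norm_minus_commute)
        then have "q x = max (r x) (r y)" "q y = min (r y) (r x)"
          using ex True by (auto simp: q_def polarize_in_def polarize_def yx simp flip: y_def)
        then show ?thesis
          using max_min_product_ge[OF nonneg[of x] nonneg[of y], of "r x" "r y"]
          unfolding y_def[symmetric] by (simp add: f_def v_eq min.commute)
      next
        case False
        then have "u y = 0" "r y = 0" "q y = 0"
          using borel_H0_outside[OF u] out q(3) by auto
        moreover have "q x = r x"
          using False by (simp add: q_def polarize_in_def flip: y_def)
        ultimately show ?thesis
          using nonneg[of x] unfolding y_def[symmetric] by (simp add: f_def v_eq max_absorb1)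
      qed
    qed
  qed
  have pos: "0 \<le> f x + f (reflect e c x)" for x
  proof (cases "c \<le> e \<bullet> x")
    case False
    then have "c \<le> e \<bullet> reflect e c x"
      using inner_reflect[OF e, of c x] by linarith
    from key[OF this] show ?thesis
      by (simp add: reflect_reflect[OF e])
  qed (rule key)
  note inv = integral_lborel_distr_invariant[OF distr_lborel_reflect[OF e] measurable_reflect[OF e] fint]
  have "0 \<le> (LINT x|lborel. f x + f (reflect e c x))"
    using pos by simp
  also have "\<dots> = 2 * (LINT x|lborel. f x)"
    using inv fint by simp
  finally show ?thesis
    using int by (simp add: f_def[abs_def] q_def v_def)
qed

lemma energy_AE_cong:
  fixes u v :: "'a::euclidean_space \<Rightarrow> real"
  assumes "u \<in> borel_measurable borel" "v \<in> borel_measurable borel" "w \<in> borel_measurable borel"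
    and "AE x in lborel. u x = v x"
  shows "energy s u w = energy s v w"
  unfolding energy_def using assms
  by (intro integral_cong_AE gagliardo_integrand_AE_cong) auto

text \<open>Let \<open>q\<close> and \<open>v\<close> be the polarizations of \<open>r\<close> and \<open>u\<close>. The chain
  \<open>M \<parallel>u\<parallel>\<^sup>2 = \<integral> r u\<^sup>2 \<le> \<integral> q v\<^sup>2 \<le> M \<parallel>v\<parallel>\<^sup>2 \<le> M \<parallel>u\<parallel>\<^sup>2\<close> consists of equalities. Hence \<open>v = u\<close>, and \<open>u\<close> solves the
  Euler--Lagrange equation for \<open>r\<close> and for \<open>q\<close> with the same constant. Subtracting the two equations gives
  \<open>(r - q) u = 0\<close>, and \<open>u\<close> is positive in the ball.\<close>

lemma optimal_weight_is_polarized: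
  fixes e x0 :: "'a::euclidean_space"
  assumes e: "norm e = 1" and x0: "c < e \<bullet> x0" and s: "0 < s" "s < 1" and R: "0 < R"
    and r [measurable]: "r \<in> borel_measurable borel" and C: "\<And>x. \<bar>r x\<bar> \<le> C"
    and out: "\<And>x. x \<notin> ball x0 R \<Longrightarrow> r x = 0"
    and M: "0 < M" and u: "maximizes_quotient s (ball x0 R) r M u" and nonneg: "\<And>x. 0 \<le> u x"
    and opt: "\<And>v. v \<in> borel_H0 s (ball x0 R) \<Longrightarrow>
      (LINT x|lborel. polarize_in (ball x0 R) e c r x * v x * v x) \<le> M * energy s v v"
  shows "AE x in lborel. polarize_in (ball x0 R) e c r x = r x"
proof -
  define \<Omega> where "\<Omega> = ball x0 R"
  have \<Omega>: "bounded \<Omega>" "open \<Omega>" and \<Omega>m [measurable]: "\<Omega> \<in> sets borel" by (auto simp: \<Omega>_def)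
  have uH: "u \<in> borel_H0 s \<Omega>" using u by (simp add: maximizes_quotient_def \<Omega>_def)
  have pos: "AE x in lborel. x \<in> \<Omega> \<longrightarrow> 0 < u x"
    using u by (intro maximizer_positive[OF \<Omega> s r C M _ nonneg]) (simp add: \<Omega>_def)
  define q where "q = polarize_in \<Omega> e c r"
  have q: "q \<in> borel_measurable borel" "\<And>x. \<bar>q x\<bar> \<le> C"
    unfolding q_def using polarize_in_properties[OF e \<Omega>m r C] out by (auto simp: \<Omega>_def)
  define v where "v = polarize e c u"
  have vH: "v \<in> borel_H0 s \<Omega>" and vE: "energy s v v \<le> energy s u u"
    unfolding v_def \<Omega>_def
    using polarize_borel_H0(1,2)[OF e x0 s(1) uH[unfolded \<Omega>_def] nonneg] by auto
  note [measurable] = q(1) borel_H0_measurable[OF uH] borel_H0_measurable[OF vH]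
  have "M * energy s u u \<le> (LINT x|lborel. q x * v x * v x)"
    using weighted_integral_polarize_le[OF e x0 s(1) uH[unfolded \<Omega>_def] nonneg r C out] u
    by (simp add: q_def v_def \<Omega>_def maximizes_quotient_def)
  moreover have qv: "(LINT x|lborel. q x * v x * v x) \<le> M * energy s v v"
    using opt vH by (simp add: q_def \<Omega>_def)
  ultimately have "M * energy s u u \<le> M * energy s v v" by linarith
  then have E: "energy s v v = energy s u u"
    using M vE by simp
  have vu: "AE x in lborel. v x = u x"
    unfolding v_def
    using polarize_fixes_if_energy_preserved[OF e x0 s(1) R uH[unfolded \<Omega>_def] nonneg] pos E
    by (simp add: \<Omega>_def v_def)
  have vmax: "maximizes_quotient s \<Omega> q M v"
    using vH opt E qv \<open>M * energy s u u \<le> (LINT x|lborel. q x * v x * v x)\<close> u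
    by (simp add: maximizes_quotient_def q_def \<Omega>_def)
  define g where "g x = (r x - q x) * u x" for x
  have gint: "integrable lborel g"
  proof (rule Bochner_Integration.integrable_bound)
    show "integrable lborel (\<lambda>x. 2 * C * (indicator \<Omega> x + (u x)\<^sup>2))"
      using borel_H0_square_integrable[OF uH] emeasure_bounded_finite[OF \<Omega>(1)] by simp
    show "AE x in lborel. norm (g x) \<le> norm (2 * C * (indicator \<Omega> x + (u x)\<^sup>2))"
    proof (intro AE_I2)
      fix x
      have "\<bar>u x\<bar> \<le> indicator \<Omega> x + (u x)\<^sup>2"
        using abs_mult_le_sum_squares[of 1 "u x"] borel_H0_outside[OF uH, of x] by (auto simp: indicator_def)
      moreover have "\<bar>r x - q x\<bar> \<le> 2 * C"
        using C[of x] q(2)[of x] by linarith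
      ultimately have "\<bar>g x\<bar> \<le> 2 * C * (indicator \<Omega> x + (u x)\<^sup>2)"
        unfolding g_def abs_mult by (intro mult_mono) auto
      then show "norm (g x) \<le> norm (2 * C * (indicator \<Omega> x + (u x)\<^sup>2))"
        by (auto intro: order_trans[OF _ abs_ge_self])
    qed
    show "g \<in> borel_measurable lborel" unfolding g_def[abs_def] by measurable
  qed
  have orth: "(LINT x|lborel. g x * \<phi> x) = 0" if \<phi>: "\<phi> \<in> borel_H0 s \<Omega>" for \<phi>
  proof -
    note [measurable] = borel_H0_measurable[OF \<phi>]
    have "(LINT x|lborel. q x * u x * \<phi> x) = (LINT x|lborel. q x * v x * \<phi> x)"
      using vu by (intro integral_cong_AE) auto
    also have "\<dots> = M * energy s v \<phi>"
      by (rule maximizer_Euler_Lagrange[OF vmax \<phi> q])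
    also have "energy s v \<phi> = energy s u \<phi>"
      using vu by (intro energy_AE_cong) auto
    also have "M * energy s u \<phi> = (LINT x|lborel. r x * u x * \<phi> x)"
      using u maximizer_Euler_Lagrange[OF _ \<phi> r C, of M u] by (simp add: \<Omega>_def)
    finally have "(LINT x|lborel. r x * u x * \<phi> x) - (LINT x|lborel. q x * u x * \<phi> x) = 0" by simp
    then show ?thesis
      using integrable_weighted_product[OF uH \<phi> r C] integrable_weighted_product[OF uH \<phi> q]
      by (simp add: g_def left_diff_distrib)
  qed
  \<comment> \<open>Any test function detecting a sign of \<open>g\<close> would contradict the orthogonality.\<close>
  have null: "emeasure lborel {x \<in> \<Omega>. 0 < \<sigma> * g x} = 0" if "\<sigma> \<in> {1, -1}" for \<sigma>
  proof (rule ccontr)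
    assume "emeasure lborel {x \<in> \<Omega>. 0 < \<sigma> * g x} \<noteq> 0"
    then have "0 < emeasure lborel {x \<in> \<Omega>. 0 < \<sigma> * g x}"
      by (simp add: zero_less_iff_neq_zero)
    then obtain \<phi> where \<phi>: "(\<lambda>x. (\<phi> x)\<^sup>2) \<in> borel_H0 s \<Omega>" "0 < (LINT x|lborel. \<sigma> * g x * (\<phi> x)\<^sup>2)"
      by (rule test_function_detects_positive_part[OF \<Omega> s, rotated]) (use gint in auto)
    have "(LINT x|lborel. \<sigma> * g x * (\<phi> x)\<^sup>2) = \<sigma> * (LINT x|lborel. g x * (\<phi> x)\<^sup>2)"
      by (simp add: mult.assoc)
    then show False
      using \<phi> orth by simp
  qed
  have [measurable]: "g \<in> borel_measurable borel" using gint by simp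
  have sign: "AE x in lborel. \<not> (x \<in> \<Omega> \<and> 0 < \<sigma> * g x)" if "\<sigma> \<in> {1, -1}" for \<sigma>
    using null[OF that] by (subst AE_iff_measurable[of "{x \<in> \<Omega>. 0 < \<sigma> * g x}"]) auto
  have "AE x in lborel. \<not> (x \<in> \<Omega> \<and> 0 < 1 * g x)" "AE x in lborel. \<not> (x \<in> \<Omega> \<and> 0 < - 1 * g x)"
    using sign by blast+
  then have "AE x in lborel. q x = r x"
    using pos
  proof eventually_elim
    case (elim x)
    show ?case
    proof (cases "x \<in> \<Omega>")
      case True
      with elim have "g x = 0" "u x \<noteq> 0" by auto
      then show ?thesis by (simp add: g_def)
    next
      case False
      then show ?thesis by (simp add: q_def polarize_in_def)
    qed
  qed
  then show ?thesis by (simp add: q_def \<Omega>_def)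
qed

section \<open>Weights fixed by all polarizations\<close>

text \<open>A weak form of the density theorem, in which one threshold serves all smaller radii. For a compact set
  \<open>K\<close> contained in \<open>A\<close> and an open set \<open>U\<close> around \<open>K\<close> of measure less than \<open>5/4 |K|\<close>, each sufficiently small
  translate of \<open>K\<close> lies in \<open>U\<close> and therefore meets \<open>K\<close> in measure at least \<open>3/4 |K|\<close>. Averaging over all
  translations by vectors of length less than \<open>\<delta>\<close> yields a point \<open>a\<close> of \<open>K\<close> for which \<open>K\<close> fills more than half
  of \<open>ball a \<delta>\<close>.\<close>

lemma small_balls_mostly_inside:
  fixes A :: "'a::euclidean_space set"
  assumes A [measurable]: "A \<in> sets borel" and bnd: "bounded A" and pos: "0 < emeasure lborel A"
  obtains d where "0 < d" "\<And>\<delta>. 0 < \<delta> \<Longrightarrow> \<delta> \<le> d \<Longrightarrow>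
    \<exists>a\<in>A. measure lborel (ball (0::'a) \<delta>) / 2 < measure lborel (A \<inter> ball a \<delta>)"
proof -
  obtain K where K: "compact K" "K \<subseteq> A" "0 < measure lborel K"
    using compact_subset_of_positive_measure[OF A bnd pos] by blast
  have Km [measurable]: "K \<in> sets borel"
    using K(1) by (simp add: borel_compact)
  have Kf: "K \<in> fmeasurable lborel"
    using K(1) by (simp add: fmeasurable_compact)
  obtain U where U: "open U" "K \<subseteq> U" "emeasure lborel (U - K) < ennreal (measure lborel K / 4)"
    using outer_regular_lborel[OF Km, of "measure lborel K / 4"] K(3) by auto
  have Um [measurable]: "U \<in> sets borel" using U(1) by simp
  have UK: "U - K \<in> fmeasurable lborel"
    using U(3) by (intro fmeasurableI) (auto intro: less_trans)
  have UKU: "U = K \<union> (U - K)" using U(2) by auto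
  have Uf: "U \<in> fmeasurable lborel"
    by (subst UKU) (intro fmeasurable.Un Kf UK)
  have "measure lborel U = measure lborel K + measure lborel (U - K)"
    by (subst UKU, subst measure_Un3[OF Kf UK]) simp
  moreover have "measure lborel (U - K) < measure lborel K / 4"
    using U(3) UK by (simp add: emeasure_eq_measure2 ennreal_less_iff)
  ultimately have Uk: "measure lborel U < 5 / 4 * measure lborel K"
    by simp
  obtain d where d: "0 < d" "(\<Union>x\<in>K. ball x d) \<subseteq> U"
    using compact_subset_open_imp_ball_epsilon_subset[OF K(1) U(1,2)] by blast
  have "\<exists>a\<in>A. measure lborel (ball (0::'a) \<delta>) / 2 < measure lborel (A \<inter> ball a \<delta>)"
    if \<delta>: "0 < \<delta>" "\<delta> \<le> d" for \<delta>
  proof (rule ccontr)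
    assume contra: "\<not> ?thesis"
    define b where "b = measure lborel (ball (0::'a) \<delta>)"
    define \<kappa> where "\<kappa> = measure lborel K"
    have [measurable]: "ball (0::'a) \<delta> \<in> sets borel" by simp
    have b: "0 < b" using \<delta>(1) by (simp add: b_def content_ball_pos)
    have \<kappa>: "0 < \<kappa>" using K(3) by (simp add: \<kappa>_def)
    have small: "emeasure lborel (K \<inter> ball a \<delta>) \<le> ennreal (b / 2)" if a: "a \<in> K" for a
    proof -
      have fin: "A \<inter> ball a \<delta> \<in> fmeasurable lborel"
        using emeasure_bounded_finite[of "A \<inter> ball a \<delta>"] bnd by (intro fmeasurableI) (auto simp: bounded_Int)
      have "emeasure lborel (K \<inter> ball a \<delta>) \<le> emeasure lborel (A \<inter> ball a \<delta>)"
        using K(2) by (intro emeasure_mono) auto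
      also have "\<dots> = ennreal (measure lborel (A \<inter> ball a \<delta>))"
        using fin by (rule emeasure_eq_measure2)
      also have "\<dots> \<le> ennreal (b / 2)"
        using contra a K(2) by (intro ennreal_leI) (auto simp: b_def not_less)
      finally show ?thesis .
    qed
    have large: "ennreal (3 / 4 * \<kappa>) \<le> (\<integral>\<^sup>+x. indicator K x * indicator K (x + z) \<partial>lborel)"
      if z: "z \<in> ball 0 \<delta>" for z
    proof -
      \<comment> \<open>The translate of \<open>K\<close> by \<open>- z\<close>.\<close>
      define K' where "K' = (\<lambda>x. z + x) -` K"
      have K'm [measurable]: "K' \<in> sets borel"
        unfolding K'_def using measurable_sets[of "\<lambda>x. z + x" borel borel K] by simp
      have "emeasure lborel K' = emeasure (distr lborel borel ((+) z)) K"
        unfolding K'_def by (subst emeasure_distr) auto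
      then have eK': "emeasure lborel K' = emeasure lborel K"
        by (simp add: lborel_distr_plus)
      then have K'f: "K' \<in> fmeasurable lborel" "measure lborel K' = \<kappa>"
        using Kf by (auto simp: fmeasurable_def measure_def \<kappa>_def)
      have "K' \<subseteq> U"
      proof
        fix x assume "x \<in> K'"
        then have "z + x \<in> K" by (simp add: K'_def)
        moreover have "x \<in> ball (z + x) d"
          using z \<delta>(2) by (simp add: dist_norm)
        ultimately show "x \<in> U" using d(2) by blast
      qed
      then have "measure lborel (K \<union> K') \<le> measure lborel U"
        using U(2) Uf by (intro measure_mono_fmeasurable) auto
      moreover have "measure lborel (K \<union> K') = \<kappa> + \<kappa> - measure lborel (K \<inter> K')"
        using measure_Un3[OF Kf K'f(1)] K'f(2) by (simp add: \<kappa>_def)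
      ultimately have "3 / 4 * \<kappa> \<le> measure lborel (K \<inter> K')"
        using Uk by (simp add: \<kappa>_def)
      then have "ennreal (3 / 4 * \<kappa>) \<le> emeasure lborel (K \<inter> K')"
        using fmeasurable.Int[OF Kf K'f(1)] by (simp add: emeasure_eq_measure2 ennreal_leI)
      also have "\<dots> = (\<integral>\<^sup>+x. indicator (K \<inter> K') x \<partial>lborel)"
        by simp
      also have "\<dots> = (\<integral>\<^sup>+x. indicator K x * indicator K (x + z) \<partial>lborel)"
        by (intro nn_integral_cong) (auto simp: indicator_def K'_def add.commute)
      finally show ?thesis .
    qed
    have "ennreal (3 / 4 * \<kappa>) * emeasure lborel (ball (0::'a) \<delta>)
        = (\<integral>\<^sup>+z. ennreal (3 / 4 * \<kappa>) * indicator (ball (0::'a) \<delta>) z \<partial>lborel)"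
      by (simp add: nn_integral_cmult_indicator)
    also have "\<dots> \<le> (\<integral>\<^sup>+z. (\<integral>\<^sup>+x. indicator K x * indicator K (x + z) * indicator (ball 0 \<delta>) z \<partial>lborel) \<partial>lborel)"
    proof (rule nn_integral_mono)
      fix z :: 'a
      show "ennreal (3 / 4 * \<kappa>) * indicator (ball 0 \<delta>) z
          \<le> (\<integral>\<^sup>+x. indicator K x * indicator K (x + z) * indicator (ball 0 \<delta>) z \<partial>lborel)"
        using large[of z] by (cases "z \<in> ball 0 \<delta>") (simp_all del: mem_ball)
    qed
    also have "\<dots> = (\<integral>\<^sup>+x. (\<integral>\<^sup>+z. indicator K x * indicator K (x + z) * indicator (ball 0 \<delta>) z \<partial>lborel) \<partial>lborel)"
      by (rule lborel_pair.Fubini') measurable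
    also have "\<dots> = (\<integral>\<^sup>+x. indicator K x * emeasure lborel (K \<inter> ball x \<delta>) \<partial>lborel)"
    proof (rule nn_integral_cong)
      fix x :: 'a
      define h :: "'a \<Rightarrow> ennreal" where "h y = indicator K x * indicator K y * indicator (ball 0 \<delta>) (y - x)" for y
      have [measurable]: "h \<in> borel_measurable borel" unfolding h_def[abs_def] by measurable
      have "(\<integral>\<^sup>+z. h (x + z) \<partial>lborel) = (\<integral>\<^sup>+y. h y \<partial>distr lborel borel ((+) x))"
        by (subst nn_integral_distr) auto
      also have "\<dots> = (\<integral>\<^sup>+y. h y \<partial>lborel)"
        by (simp add: lborel_distr_plus)
      also have "\<dots> = (\<integral>\<^sup>+y. indicator K x * indicator (K \<inter> ball x \<delta>) y \<partial>lborel)"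
        by (intro nn_integral_cong) (auto simp: h_def indicator_def dist_norm norm_minus_commute)
      also have "\<dots> = indicator K x * emeasure lborel (K \<inter> ball x \<delta>)"
        by (rule nn_integral_cmult_indicator) measurable
      finally show "(\<integral>\<^sup>+z. indicator K x * indicator K (x + z) * indicator (ball 0 \<delta>) z \<partial>lborel)
          = indicator K x * emeasure lborel (K \<inter> ball x \<delta>)"
        by (simp add: h_def)
    qed
    also have "\<dots> \<le> (\<integral>\<^sup>+x. ennreal (b / 2) * indicator K x \<partial>lborel)"
      using small by (intro nn_integral_mono) (auto simp: indicator_def)
    also have "\<dots> = ennreal (b / 2) * emeasure lborel K"
      by (rule nn_integral_cmult_indicator) measurable
    finally have "ennreal (3 / 4 * \<kappa>) * ennreal b \<le> ennreal (b / 2) * ennreal \<kappa>"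
      using Kf emeasure_lborel_ball_finite[of "0::'a" \<delta>]
      by (simp add: emeasure_eq_measure2 emeasure_eq_ennreal_measure \<kappa>_def b_def less_top)
    then have "3 / 4 * \<kappa> * b \<le> b / 2 * \<kappa>"
      using b \<kappa> by (simp add: ennreal_mult'[symmetric] ennreal_le_iff)
    then show False
      using b \<kappa> by simp
  qed
  then show ?thesis
    using that d(1) by blast
qed

text \<open>Otherwise there are points \<open>a\<close> and \<open>b\<close> such that \<open>A\<close> and \<open>B\<close> fill more than half of the balls of one
  radius about \<open>a\<close> and \<open>b\<close>, respectively. The reflection in the bisecting hyperplane of \<open>a\<close> and \<open>b\<close> exchanges
  the two balls, so it maps a part of \<open>A\<close> of positive measure into \<open>B\<close>, to points that are farther from the
  centre and carry a larger value of \<open>r\<close>. The centre is on the side of \<open>a\<close>, because it is nearer to \<open>a\<close>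
  than to \<open>b\<close>.\<close>

lemma polarized_imp_ordered:
  fixes r :: "'a::euclidean_space \<Rightarrow> real" and x0 :: 'a
  assumes pol: "\<And>e c. norm e = 1 \<Longrightarrow> c < e \<bullet> x0 \<Longrightarrow>
      AE x in lborel. c < e \<bullet> x \<and> x \<in> \<Omega> \<and> reflect e c x \<in> \<Omega> \<longrightarrow> r (reflect e c x) \<le> r x"
    and A [measurable]: "A \<in> sets borel" and B [measurable]: "B \<in> sets borel"
    and AB: "A \<subseteq> \<Omega>" "B \<subseteq> \<Omega>" "bounded A" "bounded B"
    and near: "\<And>x. x \<in> A \<Longrightarrow> norm (x - x0) < \<theta>" and far: "\<And>x. x \<in> B \<Longrightarrow> \<theta> \<le> norm (x - x0)"
    and low: "\<And>x. x \<in> A \<Longrightarrow> r x \<le> t" and high: "\<And>x. x \<in> B \<Longrightarrow> t < r x"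
  shows "emeasure lborel A = 0 \<or> emeasure lborel B = 0"
proof (rule ccontr)
  assume "\<not> ?thesis"
  then have pos: "0 < emeasure lborel A" "0 < emeasure lborel B"
    by (auto simp: zero_less_iff_neq_zero)
  obtain d1 where d1: "0 < d1" "\<And>\<delta>. 0 < \<delta> \<Longrightarrow> \<delta> \<le> d1 \<Longrightarrow>
    \<exists>a\<in>A. measure lborel (ball (0::'a) \<delta>) / 2 < measure lborel (A \<inter> ball a \<delta>)"
    using small_balls_mostly_inside[OF A AB(3) pos(1)] by blast
  obtain d2 where d2: "0 < d2" "\<And>\<delta>. 0 < \<delta> \<Longrightarrow> \<delta> \<le> d2 \<Longrightarrow>
    \<exists>a\<in>B. measure lborel (ball (0::'a) \<delta>) / 2 < measure lborel (B \<inter> ball a \<delta>)"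
    using small_balls_mostly_inside[OF B AB(4) pos(2)] by blast
  define \<delta> where "\<delta> = min d1 d2"
  have \<delta>: "0 < \<delta>" "\<delta> \<le> d1" "\<delta> \<le> d2" using d1 d2 by (auto simp: \<delta>_def)
  obtain a where a: "a \<in> A" "measure lborel (ball (0::'a) \<delta>) / 2 < measure lborel (A \<inter> ball a \<delta>)"
    using d1(2)[OF \<delta>(1,2)] by blast
  obtain b where b: "b \<in> B" "measure lborel (ball (0::'a) \<delta>) / 2 < measure lborel (B \<inter> ball b \<delta>)"
    using d2(2)[OF \<delta>(1,3)] by blast
  have ab: "norm (a - x0) < norm (b - x0)"
    using near[OF a(1)] far[OF b(1)] by linarith
  then have "a \<noteq> b" by auto
  define L where "L = norm (a - b)"
  have L: "0 < L" using \<open>a \<noteq> b\<close> by (simp add: L_def)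
  define e where "e = (1 / L) *\<^sub>R (a - b)"
  define c where "c = e \<bullet> ((1/2) *\<^sub>R (a + b))"
  have e: "norm e = 1" using L by (simp add: e_def L_def)
  have ea: "e \<bullet> a - c = L / 2"
  proof -
    have "e \<bullet> a - c = e \<bullet> ((1/2) *\<^sub>R (a - b))"
      by (simp add: c_def inner_add_right inner_diff_right field_simps)
    also have "\<dots> = L / 2"
      using L by (simp add: e_def L_def power2_norm_eq_inner[symmetric] power2_eq_square)
    finally show ?thesis .
  qed
  have refl: "reflect e c a = b"
    unfolding reflect_def ea using L by (simp add: e_def)
  have x0: "c < e \<bullet> x0"
  proof -
    have "(norm (a - x0))\<^sup>2 < (norm (b - x0))\<^sup>2"
      using ab by (intro power_strict_mono) auto
    then have "0 < (e \<bullet> a - c) * (e \<bullet> x0 - c)"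
      using norm_reflect_diff_sq[OF e, of c a x0, unfolded refl mult.assoc] by linarith
    then show ?thesis
      unfolding ea using L by (simp add: zero_less_mult_iff)
  qed
  note [measurable] = measurable_reflect[OF e]
  define A' where "A' = A \<inter> ball a \<delta>"
  define B' where "B' = reflect e c -` (B \<inter> ball b \<delta>)"
  have [measurable]: "A' \<in> sets borel" "B' \<in> sets borel"
    using measurable_sets[OF measurable_reflect[OF e], of "B \<inter> ball b \<delta>" c] by (simp_all add: A'_def B'_def)
  have ball_fin: "ball x \<delta> \<in> fmeasurable lborel" for x :: 'a
    using emeasure_lborel_ball_finite[of x \<delta>] by (simp add: fmeasurable_def)
  have sub: "A' \<subseteq> ball a \<delta>" "B' \<subseteq> ball a \<delta>"
  proof -
    show "A' \<subseteq> ball a \<delta>" by (simp add: A'_def)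
    show "B' \<subseteq> ball a \<delta>"
    proof
      fix x assume "x \<in> B'"
      then have "norm (reflect e c x - reflect e c a) < \<delta>"
        by (simp add: B'_def refl dist_norm norm_minus_commute)
      then show "x \<in> ball a \<delta>"
        by (simp add: norm_reflect_reflect[OF e] dist_norm norm_minus_commute)
    qed
  qed
  have fin: "A' \<in> fmeasurable lborel" "B' \<in> fmeasurable lborel"
    using fmeasurableI2[OF ball_fin sub(1)] fmeasurableI2[OF ball_fin sub(2)] by auto
  have "emeasure lborel B' = emeasure (distr lborel borel (reflect e c)) (B \<inter> ball b \<delta>)"
    unfolding B'_def by (subst emeasure_distr) auto
  then have "measure lborel B' = measure lborel (B \<inter> ball b \<delta>)"
    by (simp add: distr_lborel_reflect[OF e] measure_def)
  moreover have "measure lborel (ball a \<delta>) = measure lborel (ball (0::'a) \<delta>)"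
    using \<delta>(1) by (simp add: content_ball)
  moreover have "measure lborel (A' \<union> B') \<le> measure lborel (ball a \<delta>)"
    using sub ball_fin by (intro measure_mono_fmeasurable) auto
  moreover have "measure lborel (A' \<union> B') = measure lborel A' + measure lborel B' - measure lborel (A' \<inter> B')"
    by (rule measure_Un3[OF fin])
  ultimately have "0 < measure lborel (A' \<inter> B')"
    using a(2) b(2) by (simp add: A'_def)
  moreover have "AE x in lborel. x \<notin> A' \<inter> B'"
    using pol[OF e x0]
  proof eventually_elim
    case (elim x)
    show ?case
    proof
      assume "x \<in> A' \<inter> B'"
      then have x: "x \<in> A" "reflect e c x \<in> B" by (auto simp: A'_def B'_def)
      have "norm (x - x0) < norm (reflect e c x - x0)"
        using near[OF x(1)] far[OF x(2)] by linarith
      then have "c < e \<bullet> x"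
        using reflect_moves_towards_center[OF e x0, of x] by linarith
      then show False
        using elim x AB low[OF x(1)] high[OF x(2)] by auto
    qed
  qed
  then have "emeasure lborel (A' \<inter> B') = 0"
    by (subst (asm) AE_iff_measurable[of "A' \<inter> B'"]) auto
  ultimately show False
    by (simp add: measure_def)
qed

text \<open>The radius is the supremum of all \<open>\<theta>\<close> such that the level set has positive measure outside the ball of
  radius \<open>\<theta>\<close>. For such \<open>\<theta>\<close> the level set fills almost all of that ball.\<close>

lemma polarized_level_set_is_ball:
  fixes r :: "'a::euclidean_space \<Rightarrow> real" and x0 :: 'a
  assumes r [measurable]: "r \<in> borel_measurable borel"
    and pol: "\<And>e c. norm e = 1 \<Longrightarrow> c < e \<bullet> x0 \<Longrightarrow>
      AE x in lborel. c < e \<bullet> x \<and> x \<in> ball x0 R \<and> reflect e c x \<in> ball x0 R \<longrightarrow> r (reflect e c x) \<le> r x"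
  shows "\<exists>\<theta>. AE x in lborel. x \<in> ball x0 R \<longrightarrow> (t < r x \<longleftrightarrow> norm (x - x0) < \<theta>)"
proof -
  define E where "E \<theta> = {x \<in> ball x0 R. t < r x \<and> \<theta> \<le> norm (x - x0)}" for \<theta>
  have Em [measurable]: "E \<theta> \<in> sets borel" for \<theta>
    unfolding E_def by measurable
  define Q where "Q = {\<theta>. 0 \<le> \<theta> \<and> \<theta> \<le> R \<and> emeasure lborel (E \<theta>) \<noteq> 0}"
  \<comment> \<open>Inserting \<open>0\<close> covers level sets of measure zero.\<close>
  define \<theta>0 where "\<theta>0 = Sup (insert 0 Q)"
  have bdd: "bdd_above (insert 0 Q)"
    by (rule bdd_aboveI[of _ "max 0 R"]) (auto simp: Q_def)
  have inside: "AE x in lborel. norm (x - x0) < \<theta> \<longrightarrow> t < r x" if \<theta>: "\<theta> \<in> Q" for \<theta>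
  proof -
    define A where "A = {x \<in> ball x0 \<theta>. r x \<le> t}"
    have [measurable]: "A \<in> sets borel" unfolding A_def by measurable
    have "A \<subseteq> ball x0 R" "E \<theta> \<subseteq> ball x0 R"
      using \<theta> by (auto simp: A_def E_def Q_def)
    moreover from this have "bounded A" "bounded (E \<theta>)"
      by (meson bounded_subset bounded_ball)+
    ultimately have "emeasure lborel A = 0 \<or> emeasure lborel (E \<theta>) = 0"
      by (intro polarized_imp_ordered[OF pol, where \<theta> = \<theta> and t = t])
        (auto simp: A_def E_def dist_norm norm_minus_commute)
    then have "emeasure lborel A = 0"
      using \<theta> by (simp add: Q_def)
    then have "AE x in lborel. x \<notin> A"
      by (subst AE_iff_measurable[of A]) auto
    then show ?thesis
      by eventually_elim (auto simp: A_def dist_norm norm_minus_commute)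
  qed
  have outside: "AE x in lborel. x \<in> ball x0 R \<and> t < r x \<longrightarrow> norm (x - x0) < \<theta>" if \<theta>: "\<theta>0 < \<theta>" for \<theta>
  proof (cases "\<theta> \<le> R")
    case True
    have "0 \<le> \<theta>0" unfolding \<theta>0_def using bdd by (intro cSup_upper) auto
    then have "emeasure lborel (E \<theta>) = 0"
      using True \<theta> cSup_upper[OF _ bdd, of \<theta>] by (auto simp: Q_def \<theta>0_def)
    then have "AE x in lborel. x \<notin> E \<theta>"
      by (subst AE_iff_measurable[of "E \<theta>"]) auto
    then show ?thesis
      by eventually_elim (auto simp: E_def)
  next
    case False
    then show ?thesis by (auto simp: dist_norm norm_minus_commute)
  qed
  have inside_all: "AE x in lborel. \<forall>n. norm (x - x0) < \<theta>0 - 1 / real (Suc n) \<longrightarrow> t < r x"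
    unfolding AE_all_countable
  proof
    fix n
    have "\<theta>0 - 1 / real (Suc n) < Sup (insert 0 Q)" by (simp add: \<theta>0_def)
    then obtain \<theta> where \<theta>: "\<theta> \<in> insert 0 Q" "\<theta>0 - 1 / real (Suc n) < \<theta>"
      using less_cSup_iff[OF insert_not_empty bdd] by blast
    show "AE x in lborel. norm (x - x0) < \<theta>0 - 1 / real (Suc n) \<longrightarrow> t < r x"
    proof (cases "\<theta> \<in> Q")
      case True
      from inside[OF this] show ?thesis
        by eventually_elim (use \<theta>(2) in auto)
    next
      case False
      with \<theta> have neg: "\<theta>0 - 1 / real (Suc n) < 0" by auto
      show ?thesis
      proof (intro AE_I2 impI)
        fix x assume "norm (x - x0) < \<theta>0 - 1 / real (Suc n)"
        with neg norm_ge_zero[of "x - x0"] show "t < r x" by linarith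
      qed
    qed
  qed
  have outside_all: "AE x in lborel. \<forall>n. x \<in> ball x0 R \<and> t < r x \<longrightarrow> norm (x - x0) < \<theta>0 + 1 / real (Suc n)"
    unfolding AE_all_countable by (intro allI outside) simp
  have "sphere x0 \<theta>0 \<in> null_sets lborel"
    using negligible_sphere[of x0 \<theta>0] by (auto simp: negligible_iff_null_sets null_sets_completion_iff)
  then have "AE x in lborel. norm (x - x0) \<noteq> \<theta>0"
    by (rule AE_I') (auto simp: dist_norm norm_minus_commute)
  with inside_all outside_all have "AE x in lborel. x \<in> ball x0 R \<longrightarrow> (t < r x \<longleftrightarrow> norm (x - x0) < \<theta>0)"
  proof eventually_elim
    case (elim x)
    show ?case
    proof (intro impI iffI)
      assume "norm (x - x0) < \<theta>0"
      then obtain n where "1 / real (Suc n) < \<theta>0 - norm (x - x0)"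
        using nat_approx_posE[of "\<theta>0 - norm (x - x0)"] by auto
      then have "norm (x - x0) < \<theta>0 - 1 / real (Suc n)" by linarith
      then show "t < r x" using elim(1) by blast
    next
      assume "x \<in> ball x0 R" "t < r x"
      then have le: "norm (x - x0) < \<theta>0 + 1 / real (Suc n)" for n
        using elim(2) by blast
      show "norm (x - x0) < \<theta>0"
      proof (rule ccontr)
        assume "\<not> norm (x - x0) < \<theta>0"
        then have "0 < norm (x - x0) - \<theta>0" using elim(3) by linarith
        then obtain n where "1 / real (Suc n) < norm (x - x0) - \<theta>0"
          using nat_approx_posE by blast
        then show False using le[of n] by linarith
      qed
    qed
  qed
  then show ?thesis by blast
qed

text \<open>A function is determined by its level sets at rational heights; \<open>h d\<close> is the supremum of the rational
  heights whose level ball has radius larger than \<open>d\<close>. The element \<open>- C\<close> and the bound \<open>t \<le> C\<close> make this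
  a supremum of a nonempty bounded set for every \<open>d\<close>.\<close>

lemma polarized_imp_radially_decreasing:
  fixes r :: "'a::euclidean_space \<Rightarrow> real" and x0 :: 'a
  assumes r [measurable]: "r \<in> borel_measurable borel" and C: "\<And>x. \<bar>r x\<bar> \<le> C"
    and pol: "\<And>e c. norm e = 1 \<Longrightarrow> c < e \<bullet> x0 \<Longrightarrow>
      AE x in lborel. c < e \<bullet> x \<and> x \<in> ball x0 R \<and> reflect e c x \<in> ball x0 R \<longrightarrow> r (reflect e c x) \<le> r x"
  obtains h :: "real \<Rightarrow> real" where "antimono h"
    "AE x in lborel. x \<in> ball x0 R \<longrightarrow> r x = h (norm (x - x0))"
proof -
  have "\<exists>\<theta>. AE x in lborel. x \<in> ball x0 R \<longrightarrow> (t < r x \<longleftrightarrow> norm (x - x0) < \<theta>)" for t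
    by (rule polarized_level_set_is_ball[OF r pol])
  then obtain \<theta> where \<theta>: "\<And>t. AE x in lborel. x \<in> ball x0 R \<longrightarrow> (t < r x \<longleftrightarrow> norm (x - x0) < \<theta> t)"
    by metis
  define S where "S d = insert (- C) {t \<in> \<rat>. t \<le> C \<and> d < \<theta> t}" for d
  define h where "h d = Sup (S d)" for d
  have C0: "0 \<le> C" using C[of 0] by linarith
  have bdd: "bdd_above (S d)" for d
    by (rule bdd_aboveI[of _ C]) (use C0 in \<open>auto simp: S_def\<close>)
  have "antimono h"
  proof
    fix d d' :: real assume "d \<le> d'"
    then have "S d' \<subseteq> S d" by (auto simp: S_def)
    then show "h d' \<le> h d"
      unfolding h_def using bdd by (intro cSup_subset_mono) (auto simp: S_def)
  qed
  have "AE x in lborel. \<forall>t\<in>\<rat>. x \<in> ball x0 R \<longrightarrow> (t < r x \<longleftrightarrow> norm (x - x0) < \<theta> t)"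
    using \<theta> by (intro AE_ball_countable'[of \<rat>]) (auto simp: countable_rat)
  then have "AE x in lborel. x \<in> ball x0 R \<longrightarrow> r x = h (norm (x - x0))"
  proof eventually_elim
    case (elim x)
    show ?case
    proof
      assume "x \<in> ball x0 R"
      then have S: "S (norm (x - x0)) = insert (- C) {t \<in> \<rat>. t < r x}"
        using elim C[of x] unfolding S_def by fastforce
      have "h (norm (x - x0)) \<le> r x"
        unfolding h_def S using C[of x] by (intro cSup_least) auto
      moreover have "r x \<le> h (norm (x - x0))"
      proof (rule dense_le)
        fix y assume "y < r x"
        then obtain t where "t \<in> \<rat>" "y < t" "t < r x"
          using Rats_dense_in_real by blast
        then have "t \<in> S (norm (x - x0))" by (simp add: S)
        then have "t \<le> h (norm (x - x0))"
          unfolding h_def using bdd by (rule cSup_upper)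
        then show "y \<le> h (norm (x - x0))" using \<open>y < t\<close> by simp
      qed
      ultimately show "r x = h (norm (x - x0))" by simp
    qed
  qed
  then show ?thesis
    using that \<open>antimono h\<close> by blast
qed

section \<open>Minimizers of the first eigenvalue\<close>

text \<open>A rearrangement of an essentially bounded function is essentially bounded: beyond the bounds its superlevel
  sets have measure zero or the full measure of \<open>\<Omega>\<close>, because those of \<open>\<rho>0\<close> do.\<close>

lemma rearrangement_borel_representative:
  fixes \<Omega> :: "'a::euclidean_space set"
  assumes \<Omega>: "\<Omega> \<in> sets borel" "bounded \<Omega>" and \<rho>0: "\<rho>0 \<in> L_infinity \<Omega>"
    and pos: "emeasure lebesgue {x \<in> \<Omega>. 0 < \<rho>0 x} > 0" and re: "rearrangement \<Omega> \<rho> \<rho>0"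
  obtains r where "borel_weight \<Omega> \<rho> r" "emeasure lborel {x \<in> \<Omega>. 0 < r x} > 0"
    "\<And>t. emeasure lborel {x \<in> \<Omega>. t < r x} = emeasure lebesgue {x \<in> \<Omega>. t < \<rho>0 x}"
proof -
  have \<Omega>l: "\<Omega> \<in> sets lebesgue" using \<Omega>(1) by simp
  note [measurable] = \<Omega>(1)
  have m: "\<rho> \<in> borel_measurable (lebesgue_on \<Omega>)" "\<rho>0 \<in> borel_measurable (lebesgue_on \<Omega>)"
    and eq: "\<And>t. emeasure lebesgue {x \<in> \<Omega>. t < \<rho> x} = emeasure lebesgue {x \<in> \<Omega>. t < \<rho>0 x}"
    using re by (auto simp: rearrangement_def)
  obtain C where C: "AE x in lebesgue. x \<in> \<Omega> \<longrightarrow> \<bar>\<rho>0 x\<bar> \<le> C"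
    using \<rho>0 \<Omega>l by (auto simp: L_infinity_def AE_restrict_space_iff)
  have "(\<lambda>x. if x \<in> \<Omega> then \<rho> x else 0) \<in> borel_measurable lebesgue"
    using m(1) \<Omega>l by (simp add: borel_measurable_if)
  then obtain g where g [measurable]: "g \<in> borel_measurable borel"
    and ae: "AE x in lborel. (if x \<in> \<Omega> then \<rho> x else 0) = g x"
    using lebesgue_borel_representative by blast
  have lev: "emeasure lborel {x \<in> \<Omega>. t < g x} = emeasure lebesgue {x \<in> \<Omega>. t < \<rho>0 x}" for t
  proof -
    have gs: "{x \<in> \<Omega>. t < g x} \<in> sets borel" by measurable
    have "{x \<in> \<Omega>. t < \<rho> x} \<in> sets (lebesgue_on \<Omega>)"
      using m(1) \<Omega>l borel_measurable_iff_greater[of \<rho> "lebesgue_on \<Omega>"] by (simp add: space_restrict_space)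
    then have rs: "{x \<in> \<Omega>. t < \<rho> x} \<in> sets lebesgue"
      using \<Omega>l by (auto simp: sets_restrict_space_iff)
    have "emeasure lborel {x \<in> \<Omega>. t < g x} = emeasure lebesgue {x \<in> \<Omega>. t < g x}"
      using gs by simp
    also have "\<dots> = emeasure lebesgue {x \<in> \<Omega>. t < \<rho> x}"
    proof (rule emeasure_eq_AE)
      show "AE x in lebesgue. x \<in> {x \<in> \<Omega>. t < g x} \<longleftrightarrow> x \<in> {x \<in> \<Omega>. t < \<rho> x}"
        using AE_completion[OF ae] by eventually_elim auto
    qed (use gs rs in auto)
    finally show ?thesis using eq by simp
  qed
  have fin: "emeasure lborel \<Omega> < \<infinity>" by (rule emeasure_bounded_finite[OF \<Omega>(2)])
  have upper: "AE x in lborel. x \<in> \<Omega> \<longrightarrow> g x \<le> C"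
  proof -
    have "AE x in lebesgue. \<not> (x \<in> \<Omega> \<and> C < \<rho>0 x)"
      using C by eventually_elim auto
    from emeasure_eq_0_AE[OF this] have "emeasure lebesgue {x \<in> \<Omega>. C < \<rho>0 x} = 0"
      by simp
    then have "emeasure lborel {x \<in> \<Omega>. C < g x} = 0" by (simp add: lev)
    then have "AE x in lborel. x \<notin> {x \<in> \<Omega>. C < g x}"
      by (subst AE_iff_measurable[of "{x \<in> \<Omega>. C < g x}"]) auto
    then show ?thesis by eventually_elim auto
  qed
  \<comment> \<open>The superlevel sets are strict, so the lower bound needs some room below \<open>- C\<close>.\<close>
  have lower: "AE x in lborel. x \<in> \<Omega> \<longrightarrow> - C - 1 < g x"
  proof -
    define L where "L = {x \<in> \<Omega>. - C - 1 < g x}"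
    have [measurable]: "L \<in> sets borel" unfolding L_def by measurable
    have "{x \<in> \<Omega>. - C - 1 < \<rho>0 x} \<in> sets (lebesgue_on \<Omega>)"
      using m(2) \<Omega>l borel_measurable_iff_greater[of \<rho>0 "lebesgue_on \<Omega>"] by (simp add: space_restrict_space)
    then have rs: "{x \<in> \<Omega>. - C - 1 < \<rho>0 x} \<in> sets lebesgue"
      using \<Omega>l by (auto simp: sets_restrict_space_iff)
    have "emeasure lborel L = emeasure lebesgue {x \<in> \<Omega>. - C - 1 < \<rho>0 x}"
      by (simp add: L_def lev)
    also have "\<dots> = emeasure lebesgue \<Omega>"
    proof (rule emeasure_eq_AE)
      show "AE x in lebesgue. x \<in> {x \<in> \<Omega>. - C - 1 < \<rho>0 x} \<longleftrightarrow> x \<in> \<Omega>"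
        using C by eventually_elim auto
    qed (use rs \<Omega>l in auto)
    also have "\<dots> = emeasure lborel \<Omega>" using \<Omega>(1) by simp
    finally have "emeasure lborel L = emeasure lborel \<Omega>" .
    then have "emeasure lborel (\<Omega> - L) = 0"
      using fin by (subst emeasure_Diff) (auto simp: L_def)
    then have "AE x in lborel. x \<notin> \<Omega> - L"
      by (subst AE_iff_measurable[of "\<Omega> - L"]) auto
    then show ?thesis by eventually_elim (auto simp: L_def)
  qed
  define B where "B = \<bar>C\<bar> + 1"
  define r where "r x = (if x \<in> \<Omega> \<and> \<bar>g x\<bar> \<le> B then g x else 0)" for x
  have [measurable]: "r \<in> borel_measurable borel" unfolding r_def[abs_def] by measurable
  have rg: "AE x in lborel. x \<in> \<Omega> \<longrightarrow> r x = g x"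
    using upper lower by eventually_elim (auto simp: r_def B_def)
  have "borel_weight \<Omega> \<rho> r"
    unfolding borel_weight_def
  proof (intro conjI)
    show "\<exists>C. \<forall>x. \<bar>r x\<bar> \<le> C" by (rule exI[of _ B]) (auto simp: r_def B_def)
    show "AE x in lborel. x \<in> \<Omega> \<longrightarrow> \<rho> x = r x"
      using ae rg by eventually_elim auto
  qed (auto simp: r_def)
  moreover have levr: "emeasure lborel {x \<in> \<Omega>. t < r x} = emeasure lebesgue {x \<in> \<Omega>. t < \<rho>0 x}" for t
    unfolding lev[symmetric] by (rule emeasure_eq_AE) (use rg in \<open>auto elim!: eventually_mono\<close>)
  moreover have "emeasure lborel {x \<in> \<Omega>. 0 < r x} > 0"
    using pos by (simp add: levr)
  ultimately show ?thesis using that by blast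
qed

text \<open>The polarization \<open>q\<close> of the weight with respect to a half-space around the centre is an admissible
  competitor, so \<open>\<lambda>\<^sub>1(q) \<ge> \<lambda>\<^sub>1(\<rho>)\<close>; this bounds the Rayleigh quotient of \<open>q\<close> by the maximum \<open>M\<close> for \<open>\<rho>\<close>.\<close>

theorem minimizer_radially_decreasing:
  fixes x0 :: "'a::euclidean_space" and \<rho>0 \<rho> :: "'a \<Rightarrow> real"
  assumes s: "0 < s" "s < 1" and R: "0 < R"
    and \<rho>0: "\<rho>0 \<in> L_infinity (ball x0 R)" "emeasure lebesgue {x \<in> ball x0 R. \<rho>0 x > 0} > 0"
    and min: "is_arg_min (lambda1 s (ball x0 R)) (\<lambda>\<sigma>. \<sigma> \<in> rearrangement_class (ball x0 R) \<rho>0) \<rho>"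
  shows "radially_decreasing x0 R \<rho>"
proof -
  define \<Omega> where "\<Omega> = ball x0 R"
  have \<Omega>: "bounded \<Omega>" "open \<Omega>" "\<Omega> \<in> sets borel" by (auto simp: \<Omega>_def)
  have "rearrangement \<Omega> \<rho> \<rho>0"
    and opt: "\<And>\<sigma>. rearrangement \<Omega> \<sigma> \<rho>0 \<Longrightarrow> lambda1 s \<Omega> \<rho> \<le> lambda1 s \<Omega> \<sigma>"
    using min by (auto simp: is_arg_min_def rearrangement_class_def \<Omega>_def not_less)
  then obtain r where w: "borel_weight \<Omega> \<rho> r" and pos: "emeasure lborel {x \<in> \<Omega>. 0 < r x} > 0"
    and lev: "\<And>t. emeasure lborel {x \<in> \<Omega>. t < r x} = emeasure lebesgue {x \<in> \<Omega>. t < \<rho>0 x}"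
    using rearrangement_borel_representative[OF \<Omega>(3,1)] \<rho>0 unfolding \<Omega>_def by blast
  have r [measurable]: "r \<in> borel_measurable borel" and out: "\<And>x. x \<notin> \<Omega> \<Longrightarrow> r x = 0"
    using w by (auto simp: borel_weight_def)
  obtain C where C: "\<And>x. \<bar>r x\<bar> \<le> C" using w by (auto simp: borel_weight_def)
  obtain M u where Mu: "0 < M" "maximizes_quotient s \<Omega> r M u" "\<And>x. 0 \<le> u x" "lambda1 s \<Omega> \<rho> = 1 / M"
    by (rule lambda1_attained[OF \<Omega>(1,2) s w pos]) blast
  have pol: "AE x in lborel. c < e \<bullet> x \<and> x \<in> ball x0 R \<and> reflect e c x \<in> ball x0 R \<longrightarrow> r (reflect e c x) \<le> r x"
    if e: "norm e = 1" and x0: "c < e \<bullet> x0" for e c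
  proof -
    define q where "q = polarize_in \<Omega> e c r"
    have q: "q \<in> borel_measurable borel" "\<And>x. \<bar>q x\<bar> \<le> C" "\<And>x. x \<notin> \<Omega> \<Longrightarrow> q x = 0"
      unfolding q_def using polarize_in_properties[OF e \<Omega>(3) r C out] by auto
    have qlev: "emeasure lborel {x \<in> \<Omega>. t < q x} = emeasure lborel {x \<in> \<Omega>. t < r x}" for t
      unfolding q_def by (rule polarize_in_equimeasurable[OF e \<Omega>(3) r])
    have "{x \<in> \<Omega>. t < q x} \<in> sets borel" for t
      using q(1) \<Omega>(3) by measurable
    then have "emeasure lebesgue {x \<in> \<Omega>. t < q x} = emeasure lebesgue {x \<in> \<Omega>. t < \<rho>0 x}" for t
      using qlev[of t] lev[of t] by simp
    moreover have "q \<in> borel_measurable (lebesgue_on \<Omega>)"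
      using q(1) by (intro measurable_restrict_space1 measurable_completion) simp
    moreover have "\<rho>0 \<in> borel_measurable (lebesgue_on \<Omega>)"
      using \<rho>0(1) by (simp add: L_infinity_def \<Omega>_def)
    ultimately have "rearrangement \<Omega> q \<rho>0"
      by (simp add: rearrangement_def)
    then have le: "lambda1 s \<Omega> \<rho> \<le> lambda1 s \<Omega> q" by (rule opt)
    have wq: "borel_weight \<Omega> q q"
      using q by (auto simp: borel_weight_def)
    have qpos: "0 < emeasure lborel {x \<in> \<Omega>. 0 < q x}"
      using pos by (simp only: qlev)
    obtain M' v where Mv: "0 < M'" "maximizes_quotient s \<Omega> q M' v" "\<And>x. 0 \<le> v x" "lambda1 s \<Omega> q = 1 / M'"
      by (rule lambda1_attained[OF \<Omega>(1,2) s wq qpos]) blast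
    have "M' \<le> M"
      using le Mu(1,4) Mv(1,4) by (simp add: field_simps)
    have "AE x in lborel. polarize_in (ball x0 R) e c r x = r x"
    proof (rule optimal_weight_is_polarized[OF e x0 s R r C _ Mu(1)])
      show "maximizes_quotient s (ball x0 R) r M u" using Mu(2) by (simp add: \<Omega>_def)
      show "(LINT x|lborel. polarize_in (ball x0 R) e c r x * v x * v x) \<le> M * energy s v v"
        if "v \<in> borel_H0 s (ball x0 R)" for v
      proof -
        have "(LINT x|lborel. q x * v x * v x) \<le> M' * energy s v v"
          using Mv(2) that by (simp add: maximizes_quotient_def \<Omega>_def)
        also have "\<dots> \<le> M * energy s v v"
          using \<open>M' \<le> M\<close> energy_nonneg by (intro mult_right_mono)
        finally show ?thesis by (simp add: q_def \<Omega>_def)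
      qed
    qed (use out Mu(3) in \<open>auto simp: \<Omega>_def\<close>)
    then show ?thesis
      by eventually_elim (auto simp: polarize_in_def polarize_def max_def split: if_splits)
  qed
  obtain h :: "real \<Rightarrow> real" where h: "antimono h" "AE x in lborel. x \<in> ball x0 R \<longrightarrow> r x = h (norm (x - x0))"
    by (rule polarized_imp_radially_decreasing[OF r C pol])
  have "AE x in lborel. x \<in> ball x0 R \<longrightarrow> \<rho> x = r x"
    using w by (simp add: borel_weight_def \<Omega>_def)
  with h(2) have "AE x in lborel. x \<in> ball x0 R \<longrightarrow> \<rho> x = h (norm (x - x0))"
    by eventually_elim simp
  then have "AE x in lebesgue_on (ball x0 R). \<rho> x = h (norm (x - x0))"
    by (simp add: AE_restrict_space_iff AE_completion)
  moreover have "antimono_on {0..<R} h"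
    using h(1) by (simp add: monotone_on_def)
  ultimately show ?thesis
    by (auto simp: radially_decreasing_def)
qed

theorem corollary5p5:
  fixes x0 :: "real ^ 'n" and R s :: real
    and \<Omega> :: "(real ^ 'n) set" and \<rho>0 \<rho> :: "real ^ 'n \<Rightarrow> real"
  assumes "CARD('n) \<ge> 2"
    and "0 < s" and "s < 1"
    and "0 < R" and "\<Omega> = ball x0 R"
    and "\<rho>0 \<in> L_infinity \<Omega>"
    and "emeasure lebesgue {x \<in> \<Omega>. \<rho>0 x > 0} > 0"
    and "is_arg_min (lambda1 s \<Omega>) (\<lambda>\<sigma>. \<sigma> \<in> rearrangement_class \<Omega> \<rho>0) \<rho>"
  shows "radially_decreasing x0 R \<rho>"
  using minimizer_radially_decreasing[of s R \<rho>0 x0 \<rho>] assms by simp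

end
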